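(* Let $a,b>0$ be constants with $a+b<\tfrac12$. There exists $\varepsilon_0>0$ such that for every fixed $0<\varepsilon<\varepsilon_0$ the following holds. Consider data $n,s,J,H$ with $n\to\infty$, where all out-degrees and in-degrees are prescribed equal to $s$ (i.e. $s_j=t_j=s$ for all $j$) and every arc of $H$ has both ends in $\{w_1,\dots,w_J\}$, such that uniformly $x_j,y_j=O(n^{1/2+\varepsilon})$; $X=O(n^{1+2\varepsilon})$; $J=O(n^{1/2+\varepsilon})$; and $\frac{(1-2\lambda)^2}{3A}\le a\log n$. Let $G$ be uniformly random in $\mathcal{D}(\boldsymbol{s},\boldsymbol{t})$. Then the probability that the subdigraph of $G$ induced by $\{w_1,\dots,w_J\}$ equals $H_J$ is \[ p^X(1-p)^{J(J-1)-X}\exp\Bigl(\frac{J^2}{n}+\frac{(1-2\lambda)\chi_1}{2An}-\frac{\chi_1^2}{4An^2}-\frac{(n+J)(\chi_2+\chi_2')}{4An^2}-\frac{(1-2\lambda)(\chi_3+\chi_3')}{24A^2n^2}+O(n^{-b})\Bigr). \]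
   Context: A simple digraph has no loops and no multiple arcs. $\mathcal{D}(\boldsymbol{s},\boldsymbol{t})$ is the set of simple digraphs on $\{w_1,\dots,w_n\}$ with out-degree $s_j$ and in-degree $t_j$ at $w_j$; here $\boldsymbol{s}=\boldsymbol{t}=(s,\dots,s)$ for a positive integer $s$. $\lambda=s/n$, $A=\tfrac12\lambda(1-\lambda)$, $p=s/(n-1)$. $H$ is a fixed simple digraph on $\{w_1,\dots,w_n\}$ with out-degrees $x_j$, in-degrees $y_j$ and $X$ arcs; $H_J$ is its subdigraph induced by $\{w_1,\dots,w_J\}$. For $\ell=1,2,3$: $\chi_\ell=\sum_{j=1}^J(x_j-p(J-1))^\ell$, $\chi'_\ell=\sum_{k=1}^J(y_k-p(J-1))^\ell$. Asymptotic notation refers to $n\to\infty$. *)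

theory Defs
  imports "HOL-Probability.Probability"
begin

text \<open>Vertices w_1,...,w_n are represented by 0,...,n-1 (w_j = j-1).
  A digraph is a set of arcs (ordered pairs).\<close>

definition simple_digraph :: "nat \<Rightarrow> (nat \<times> nat) set \<Rightarrow> bool" where
  "simple_digraph n G \<longleftrightarrow> G \<subseteq> {0..<n} \<times> {0..<n} \<and> (\<forall>(i,j)\<in>G. i \<noteq> j)"

definition outdeg :: "(nat \<times> nat) set \<Rightarrow> nat \<Rightarrow> nat" where
  "outdeg G v = card {w. (v, w) \<in> G}"

definition indeg :: "(nat \<times> nat) set \<Rightarrow> nat \<Rightarrow> nat" where
  "indeg G v = card {u. (u, v) \<in> G}"

definition regular_digraphs :: "nat \<Rightarrow> nat \<Rightarrow> (nat \<times> nat) set set" where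
  "regular_digraphs n s =
     {G. simple_digraph n G \<and> (\<forall>v<n. outdeg G v = s \<and> indeg G v = s)}"

definition induced :: "(nat \<times> nat) set \<Rightarrow> nat \<Rightarrow> (nat \<times> nat) set" where
  "induced G J = G \<inter> ({0..<J} \<times> {0..<J})"

definition lam :: "nat \<Rightarrow> nat \<Rightarrow> real" where
  "lam n s = real s / real n"

definition AA :: "nat \<Rightarrow> nat \<Rightarrow> real" where
  "AA n s = lam n s * (1 - lam n s) / 2"

definition pp :: "nat \<Rightarrow> nat \<Rightarrow> real" where
  "pp n s = real s / (real n - 1)"

definition chi :: "nat \<Rightarrow> nat \<Rightarrow> nat \<Rightarrow> (nat \<times> nat) set \<Rightarrow> nat \<Rightarrow> real" where
  "chi n s J H l = (\<Sum>j<J. (real (outdeg H j) - pp n s * (real J - 1)) ^ l)"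

definition chi' :: "nat \<Rightarrow> nat \<Rightarrow> nat \<Rightarrow> (nat \<times> nat) set \<Rightarrow> nat \<Rightarrow> real" where
  "chi' n s J H l = (\<Sum>k<J. (real (indeg H k) - pp n s * (real J - 1)) ^ l)"

definition prob_induced :: "nat \<Rightarrow> nat \<Rightarrow> nat \<Rightarrow> (nat \<times> nat) set \<Rightarrow> real" where
  "prob_induced n s J H =
     measure_pmf.prob (pmf_of_set (regular_digraphs n s)) {G. induced G J = induced H J}"

end

theory Submission
  imports Defs "HOL-Real_Asymp.Real_Asymp"
begin

text \<open>
  For a digraph \<open>H\<close> on the first \<open>J\<close> vertices let \<open>N H\<close> be the number of regular digraphs inducing \<open>H\<close>.
  Adding an arc \<open>(i, k)\<close> to \<open>H\<close> is compared with a switching that removes \<open>(i, v)\<close> and \<open>(u, k)\<close> and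
  inserts \<open>(u, v)\<close>, where \<open>u\<close>, \<open>v\<close> lie outside the block.  Double counting gives the ratio of
  \<open>N (insert (i, k) H)\<close> and \<open>N H\<close> in terms of the mean number of such switchings, and the degree
  constraints determine these means up to covariances of entries of the adjacency matrix.

  The covariances are small for the following reason.  Given two columns \<open>v\<close>, \<open>w\<close> outside the block,
  condition on all other columns and on the set of rows where \<open>v\<close> and \<open>w\<close> differ: since both columns
  have the same sum, the sign of the difference is exchangeable over these rows and its sum over them
  is bounded, so its mean is of order \<open>1 / n\<close>.

  Summing the logarithms of the ratios over the arcs of \<open>H\<close> yields the probability of \<open>H\<close> up to a factor
  independent of \<open>H\<close>.  This factor is found by comparison with independent arcs of probability \<open>p\<close>,
  using that the pair probabilities of a random regular digraph are known exactly by symmetry.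
\<close>

section \<open>Switchings\<close>

text \<open>A block may contain about J^2 arcs, so each log ratio must be known up to O(J/n^2 +
  J^3/n^3), powers of the inverse density aside. Switching counts have order n^2, hence an absolute
  error of order J is all that is affordable. The delicate count is that of the patterns
  \<open>i\<close> to \<open>v\<close>, \<open>u\<close> to \<open>k\<close>, \<open>u\<close> to
  \<open>v\<close>: one swap would leave an error of order n there. Two swaps, one of columns and
  one of rows, are therefore performed in succession.

  The degree constraints enter through an identity: if a and b have prescribed sums over the m outer
  vertices, the sum of a_v b_v is the product of these sums divided by m, plus 1/(2m) times the sum
  of (a_v - a_w)(b_v - b_w). The mean of such a difference is governed by the mean inverse Hamming
  distance of two columns, so near coincidence of columns has to be ruled out.

  The density may decay like 1/log n. Constants are carried as explicit powers of a parameter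
  \<open>R\<close>, which in the end is logarithmic and costs one factor n^\<epsilon>. In the
  normalisation J^2/n cancels against the second moments of the degrees under both laws.\<close>

definition ent :: "(nat \<times> nat) set \<Rightarrow> nat \<Rightarrow> nat \<Rightarrow> real" where
  "ent G r c = of_bool ((r, c) \<in> G)"

text \<open>As a symmetric difference this is an involution on all digraphs, whatever the four
  entries are. Only under the hypotheses of \<open>toggle_regular\<close> is it a switching, that
  is, preserves the degrees.\<close>

definition toggle :: "(nat \<times> nat) set \<Rightarrow> nat \<Rightarrow> nat \<Rightarrow> nat \<Rightarrow> nat \<Rightarrow> (nat \<times> nat) set" where
  "toggle G r r' c c' = sym_diff G ({r, r'} \<times> {c, c'})"

definition blockclass :: "nat \<Rightarrow> nat \<Rightarrow> nat \<Rightarrow> (nat \<times> nat) set \<Rightarrow> (nat \<times> nat) set set" where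
  "blockclass n s J H = {G \<in> regular_digraphs n s. induced G J = H}"

lemma ent_01: "ent G r c = 0 \<or> ent G r c = 1"
  by (simp add: ent_def)

lemma ent_nonneg [simp]: "0 \<le> ent G r c" and ent_le_1 [simp]: "ent G r c \<le> 1"
  by (simp_all add: ent_def)

lemma ent_square [simp]: "ent G r c * ent G r c = ent G r c" "(ent G r c)\<^sup>2 = ent G r c"
  by (simp_all add: ent_def)

lemma ent_toggle:
  "ent (toggle G r r' c c') x y =
     (if x \<in> {r, r'} \<and> y \<in> {c, c'} then 1 - ent G x y else ent G x y)"
  by (auto simp: ent_def toggle_def)

lemma ent_toggle_other [simp]:
  "x \<notin> {r, r'} \<or> y \<notin> {c, c'} \<Longrightarrow> ent (toggle G r r' c c') x y = ent G x y"
  unfolding ent_toggle by (rule if_not_P) blast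

lemma toggle_toggle [simp]: "toggle (toggle G r r' c c') r r' c c' = G"
  by (auto simp: toggle_def)

lemma ent_converse [simp]: "ent (G\<inverse>) r c = ent G c r"
  by (simp add: ent_def)

lemma toggle_converse: "toggle (G\<inverse>) r r' c c' = (toggle G c c' r r')\<inverse>"
  by (auto simp: toggle_def)

lemma outdeg_ent:
  assumes "G \<subseteq> {0..<n} \<times> {0..<n}"
  shows "real (outdeg G v) = (\<Sum>c<n. ent G v c)"
proof -
  have "{w. (v, w) \<in> G} = {c \<in> {..<n}. (v, c) \<in> G}"
    using assms by auto
  then show ?thesis
    by (simp add: outdeg_def ent_def of_bool_def flip: sum.inter_filter)
qed

lemma outdeg_converse: "outdeg (G\<inverse>) v = indeg G v" "indeg (G\<inverse>) v = outdeg G v"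
  by (simp_all add: outdeg_def indeg_def)

lemma indeg_ent:
  assumes "G \<subseteq> {0..<n} \<times> {0..<n}"
  shows "real (indeg G v) = (\<Sum>r<n. ent G r v)"
  using outdeg_ent[of "G\<inverse>" n v] assms by (auto simp: outdeg_converse)

lemma simple_digraph_converse [simp]: "simple_digraph n (G\<inverse>) \<longleftrightarrow> simple_digraph n G"
  by (auto simp: simple_digraph_def)

lemma regular_digraphs_converse [simp]: "G\<inverse> \<in> regular_digraphs n s \<longleftrightarrow> G \<in> regular_digraphs n s"
  by (auto simp: regular_digraphs_def outdeg_converse)

lemma induced_converse: "induced (G\<inverse>) J = (induced G J)\<inverse>"
  by (auto simp: induced_def)

lemma blockclass_converse [simp]: "G\<inverse> \<in> blockclass n s J (H\<inverse>) \<longleftrightarrow> G \<in> blockclass n s J H"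
  by (simp add: blockclass_def induced_converse)

text \<open>Reversing all arcs exchanges rows and columns, so each bound proved for columns also
  holds for rows. The row versions below are obtained in this way.\<close>

lemma sum_blockclass_converse:
  "(\<Sum>G\<in>blockclass n s J (H\<inverse>). f G) = (\<Sum>G\<in>blockclass n s J H. f (G\<inverse>))"
  by (rule sum.reindex_bij_witness[of _ converse converse])
     (use blockclass_converse[of "_\<inverse>" n s J H] in \<open>simp_all\<close>)

lemma card_blockclass_converse: "card (blockclass n s J (H\<inverse>)) = card (blockclass n s J H)"
  using sum_blockclass_converse[of "\<lambda>_. 1::nat" n s J H] by simp

lemma regular_iff_ent:
  "G \<in> regular_digraphs n s \<longleftrightarrow> simple_digraph n G \<and>
     (\<forall>v<n. (\<Sum>c<n. ent G v c) = real s \<and> (\<Sum>r<n. ent G r v) = real s)"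
proof (cases "simple_digraph n G")
  case True
  then have "G \<subseteq> {0..<n} \<times> {0..<n}" by (simp add: simple_digraph_def)
  then show ?thesis
    by (simp add: regular_digraphs_def True flip: outdeg_ent[of G n] indeg_ent[of G n])
qed (simp add: regular_digraphs_def)

lemma finite_regular: "finite (regular_digraphs n s)"
  by (rule finite_subset[of _ "Pow ({0..<n} \<times> {0..<n})"])
     (auto simp: regular_digraphs_def simple_digraph_def)

lemma finite_blockclass [simp]: "finite (blockclass n s J H)"
  using finite_regular by (simp add: blockclass_def)

lemma sum_toggle_pair:
  fixes f g :: "nat \<Rightarrow> real"
  assumes "c \<noteq> c'" "c < n" "c' < n" "\<And>y. y \<notin> {c, c'} \<Longrightarrow> g y = f y" "g c + g c' = f c + f c'"
  shows "(\<Sum>y<n. g y) = (\<Sum>y<n. f y)"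
proof -
  have "(\<Sum>y<n. h y) = h c + h c' + (\<Sum>y\<in>{..<n} - {c, c'}. h y)" for h :: "nat \<Rightarrow> real"
    using sum.subset_diff[of "{c, c'}" "{..<n}" h] assms(1-3) by simp
  moreover have "(\<Sum>y\<in>{..<n} - {c, c'}. g y) = (\<Sum>y\<in>{..<n} - {c, c'}. f y)"
    by (rule sum.cong) (use assms(4) in auto)
  ultimately show ?thesis using assms(5) by simp
qed

text \<open>The three equations make the two by two submatrix a permutation matrix; the sum 1 in
  column \<open>c'\<close> follows from them. Disjointness of the row and column indices keeps the
  toggle off the diagonal, so no loop arises.\<close>

lemma toggle_regular:
  assumes G: "G \<in> regular_digraphs n s"
    and lt: "r < n" "r' < n" "c < n" "c' < n"
    and ne: "r \<noteq> r'" "c \<noteq> c'" "{r, r'} \<inter> {c, c'} = {}"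
    and rows: "ent G r c + ent G r c' = 1" "ent G r' c + ent G r' c' = 1"
    and col: "ent G r c + ent G r' c = 1"
  shows "toggle G r r' c c' \<in> regular_digraphs n s"
proof -
  let ?T = "toggle G r r' c c'"
  have sd: "simple_digraph n G" using G by (simp add: regular_iff_ent)
  have "simple_digraph n ?T"
    using sd lt ne(3) by (auto simp: simple_digraph_def toggle_def)
  moreover have "(\<Sum>y<n. ent ?T x y) = (\<Sum>y<n. ent G x y)" for x
  proof (cases "x \<in> {r, r'}")
    case True
    show ?thesis
      by (rule sum_toggle_pair[of c c']) (use True lt ne rows in \<open>auto simp: ent_toggle\<close>)
  qed simp
  moreover have "(\<Sum>x<n. ent ?T x y) = (\<Sum>x<n. ent G x y)" for y
  proof (cases "y \<in> {c, c'}")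
    case True
    show ?thesis
      by (rule sum_toggle_pair[of r r']) (use True lt ne rows col in \<open>auto simp: ent_toggle\<close>)
  qed simp
  ultimately show ?thesis using G by (simp add: regular_iff_ent)
qed

lemma induced_toggle_cols:
  assumes "J \<le> c" "J \<le> c'"
  shows "induced (toggle G r r' c c') J = induced G J"
  using assms by (auto simp: induced_def toggle_def)

text \<open>The product is -1 exactly if the two columns differ with opposite signs in rows
  \<open>r\<close> and \<open>r'\<close>. The rows may lie inside the block; only the columns have
  to avoid it.\<close>

lemma toggle_blockclass:
  assumes G: "G \<in> blockclass n s J H"
    and lt: "r < n" "r' < n" "c < n" "c' < n" "J \<le> c" "J \<le> c'"
    and ne: "r \<noteq> r'" "c \<noteq> c'" "{r, r'} \<inter> {c, c'} = {}"
    and opp: "(ent G r c - ent G r c') * (ent G r' c - ent G r' c') = -1"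
  shows "toggle G r r' c c' \<in> blockclass n s J H"
proof -
  have "toggle G r r' c c' \<in> regular_digraphs n s"
  proof (rule toggle_regular)
    show "G \<in> regular_digraphs n s" using G by (simp add: blockclass_def)
    show "ent G r c + ent G r c' = 1" "ent G r' c + ent G r' c' = 1" "ent G r c + ent G r' c = 1"
      using opp unfolding ent_def
      by (cases "(r, c) \<in> G"; cases "(r, c') \<in> G"; cases "(r', c) \<in> G"; cases "(r', c') \<in> G"; simp)+
  qed (use lt ne in auto)
  then show ?thesis
    using G lt by (simp add: blockclass_def induced_toggle_cols)
qed

text \<open>Conditionally on all entries outside two columns \<open>v\<close>, \<open>w\<close> and on the set of rows in which
  these two columns differ, the sign \<open>\<epsilon>\<close> of the difference is exchangeable over these rows.  Hence
  one may replace \<open>\<epsilon> i\<close> by its average over the rows of \<open>U\<close>.  If no such row exists then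
  \<open>\<epsilon> i = 0\<close>, in accordance with the convention \<open>x / 0 = 0\<close>.\<close>

lemma column_swap_average:
  fixes \<phi> :: "(nat \<times> nat) set \<Rightarrow> real"
  defines "\<epsilon> \<equiv> \<lambda>v w G r. ent G r v - ent G r w"
  assumes vw: "v < n" "w < n" "J \<le> v" "J \<le> w" "v \<noteq> w"
    and U: "U \<subseteq> {..<n} - {v, w}" and i: "i \<in> U"
    and inv: "\<And>G r r'. G \<in> blockclass n s J H \<Longrightarrow> r \<in> U \<Longrightarrow> r' \<in> U \<Longrightarrow> r \<noteq> r' \<Longrightarrow>
                \<phi> (toggle G r r' v w) = \<phi> G"
  shows "(\<Sum>G\<in>blockclass n s J H. \<phi> G * \<epsilon> v w G i) =
     (\<Sum>G\<in>blockclass n s J H. \<phi> G * (\<epsilon> v w G i)\<^sup>2 * (\<Sum>r\<in>U. \<epsilon> v w G r) / (\<Sum>r\<in>U. (\<epsilon> v w G r)\<^sup>2))"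
proof -
  let ?\<Omega> = "blockclass n s J H"
  define e where "e = (\<lambda>G r. ent G r v - ent G r w)"
  define N where "N = (\<lambda>G. \<Sum>r\<in>U. (e G r)\<^sup>2)"
  have finU: "finite U" using U finite_subset by blast
  \<comment> \<open>The two sides differ by a sum of multiples of
    \<open>e G i * e G r * (e G r - e G i)\<close>, which is 0 unless the signs in rows
    \<open>i\<close> and \<open>r\<close> are opposite. In that case the toggle negates both signs
    and hence this expression, so the sum cancels in pairs.\<close>
  have swap: "(\<Sum>G\<in>?\<Omega>. \<phi> G / N G * (e G i * (e G r)\<^sup>2)) =
              (\<Sum>G\<in>?\<Omega>. \<phi> G / N G * ((e G i)\<^sup>2 * e G r))" if r: "r \<in> U" for r
  proof (cases "r = i")
    case True
    then show ?thesis by (simp add: power2_eq_square mult.assoc)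
  next
    case False
    let ?A = "{G \<in> ?\<Omega>. e G i * e G r = -1}"
    define h where "h = (\<lambda>G. \<phi> G / N G * (e G i * e G r * (e G r - e G i)))"
    have T: "toggle G i r v w \<in> ?A" "h (toggle G i r v w) = - h G" if "G \<in> ?A" for G
    proof -
      have G: "G \<in> ?\<Omega>" "e G i * e G r = -1" using that by auto
      have e: "e (toggle G i r v w) x = (if x \<in> {i, r} then - e G x else e G x)" for x
        by (simp add: ent_toggle e_def)
      have N: "N (toggle G i r v w) = N G"
        unfolding N_def by (rule sum.cong) (auto simp: e)
      have "toggle G i r v w \<in> ?\<Omega>"
        by (rule toggle_blockclass) (use G vw i r U False in \<open>auto simp: e_def\<close>)
      then show "toggle G i r v w \<in> ?A" using G by (simp add: e)
      have "\<phi> (toggle G i r v w) = \<phi> G" using inv G(1) i r False by blast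
      then show "h (toggle G i r v w) = - h G"
        unfolding h_def N by (simp add: e algebra_simps)
    qed
    have "(\<Sum>G\<in>?A. h G) = (\<Sum>G\<in>?A. - h G)"
      by (rule sum.reindex_bij_witness[of _ "\<lambda>G. toggle G i r v w" "\<lambda>G. toggle G i r v w"])
         (use T in auto)
    then have "(\<Sum>G\<in>?A. h G) = 0" by (simp add: sum_negf)
    moreover have "(\<Sum>G\<in>?A. h G) = (\<Sum>G\<in>?\<Omega>. h G)"
    proof (rule sum.mono_neutral_left)
      show "\<forall>G\<in>?\<Omega> - ?A. h G = 0"
      proof
        fix G assume "G \<in> ?\<Omega> - ?A"
        then have "e G i * e G r \<noteq> -1" by simp
        then have "e G i * e G r * (e G r - e G i) = 0"
          unfolding e_def ent_def
          by (cases "(i, v) \<in> G"; cases "(i, w) \<in> G"; cases "(r, v) \<in> G"; cases "(r, w) \<in> G"; simp)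
        then show "h G = 0" by (simp add: h_def)
      qed
    qed auto
    ultimately have "(\<Sum>G\<in>?\<Omega>. h G) = 0" by simp
    moreover have "h G = \<phi> G / N G * (e G i * (e G r)\<^sup>2) - \<phi> G / N G * ((e G i)\<^sup>2 * e G r)" for G
      unfolding h_def by (simp add: power2_eq_square algebra_simps)
    ultimately show ?thesis by (simp add: sum_subtractf)
  qed
  \<comment> \<open>Multiplying and dividing by \<open>N G\<close>, the sum of the squares, creates
    a sum over \<open>r\<close> to which \<open>swap\<close> applies term by term.\<close>
  have "(\<Sum>G\<in>?\<Omega>. \<phi> G * e G i) = (\<Sum>G\<in>?\<Omega>. \<Sum>r\<in>U. \<phi> G / N G * (e G i * (e G r)\<^sup>2))"
  proof (rule sum.cong)
    fix G
    show "\<phi> G * e G i = (\<Sum>r\<in>U. \<phi> G / N G * (e G i * (e G r)\<^sup>2))"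
    proof (cases "N G = 0")
      case True
      then have "(e G i)\<^sup>2 = 0"
        unfolding N_def using i finU by (subst (asm) sum_nonneg_eq_0_iff) auto
      then have "e G i = 0" by simp
      then show ?thesis by simp
    next
      case False
      have "(\<Sum>r\<in>U. \<phi> G / N G * (e G i * (e G r)\<^sup>2)) = \<phi> G / N G * (e G i * (\<Sum>r\<in>U. (e G r)\<^sup>2))"
        by (simp only: sum_distrib_left)
      then show ?thesis using False by (simp add: N_def)
    qed
  qed simp
  also have "\<dots> = (\<Sum>G\<in>?\<Omega>. \<Sum>r\<in>U. \<phi> G / N G * ((e G i)\<^sup>2 * e G r))"
    by (subst (1 2) sum.swap) (rule sum.cong, simp, rule swap)
  also have "\<dots> = (\<Sum>G\<in>?\<Omega>. \<phi> G * (e G i)\<^sup>2 * (\<Sum>r\<in>U. e G r) / N G)"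
    by (intro sum.cong refl) (simp only: sum_distrib_left[symmetric], simp)
  finally show ?thesis by (simp add: \<epsilon>_def N_def e_def)
qed

section \<open>Differences and distances of two columns\<close>

lemma col_sum: "G \<in> blockclass n s J H \<Longrightarrow> v < n \<Longrightarrow> (\<Sum>r<n. ent G r v) = real s"
  and row_sum: "G \<in> blockclass n s J H \<Longrightarrow> v < n \<Longrightarrow> (\<Sum>c<n. ent G v c) = real s"
  by (simp_all add: blockclass_def regular_iff_ent)

lemma abs_ent_diff_le_1: "\<bar>ent G a b - ent G c d\<bar> \<le> 1"
  using ent_01[of G a b] ent_01[of G c d] by auto

text \<open>Both columns sum to \<open>s\<close>, so the difference over all rows is 0 and the sum
  over the remaining rows is the negative of the one over \<open>X\<close>.\<close>

lemma column_diff_sum_bound: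
  assumes "G \<in> blockclass n s J H" "v < n" "w < n" "X \<subseteq> {..<n}"
  shows "\<bar>\<Sum>r\<in>{..<n} - X. ent G r v - ent G r w\<bar> \<le> real (card X)"
proof -
  have "(\<Sum>r\<in>{..<n} - X. ent G r v - ent G r w) = (\<Sum>r<n. ent G r v - ent G r w) - (\<Sum>r\<in>X. ent G r v - ent G r w)"
    using assms(4) by (simp add: sum_diff)
  also have "(\<Sum>r<n. ent G r v - ent G r w) = 0"
    using assms by (simp add: sum_subtractf col_sum)
  finally have "\<bar>\<Sum>r\<in>{..<n} - X. ent G r v - ent G r w\<bar> = \<bar>\<Sum>r\<in>X. ent G r v - ent G r w\<bar>" by simp
  also have "\<dots> \<le> (\<Sum>r\<in>X. 1)"
    by (rule order_trans[OF sum_abs]) (intro sum_mono abs_ent_diff_le_1)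
  finally show ?thesis by simp
qed

text \<open>Hamming distance of the columns \<open>v\<close> and \<open>w\<close> on the rows
  \<open>U\<close>: the differences are 0, 1 or -1.\<close>

definition coldist :: "(nat \<times> nat) set \<Rightarrow> nat set \<Rightarrow> nat \<Rightarrow> nat \<Rightarrow> real" where
  "coldist G U v w = (\<Sum>r\<in>U. (ent G r v - ent G r w)\<^sup>2)"

lemma ent_diff_square_01: "(ent G a b - ent G c d)\<^sup>2 = 0 \<or> (ent G a b - ent G c d)\<^sup>2 = 1"
  using ent_01[of G a b] ent_01[of G c d] by auto

lemma ent_diff_square_square: "(ent G a b - ent G c d)\<^sup>2 * (ent G a b - ent G c d)\<^sup>2 = (ent G a b - ent G c d)\<^sup>2"
  by (metis ent_diff_square_01 mult_zero_left mult_1)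

lemma abs_ent_diff_square: "\<bar>ent G a b - ent G c d\<bar> = (ent G a b - ent G c d)\<^sup>2"
  using ent_01[of G a b] ent_01[of G c d] by auto

lemma coldist_nonneg [simp]: "0 \<le> coldist G U v w"
  by (simp add: coldist_def sum_nonneg)

lemma coldist_ge_1:
  assumes "finite U" "coldist G U v w \<noteq> 0"
  shows "1 \<le> coldist G U v w"
proof -
  obtain r where r: "r \<in> U" "(ent G r v - ent G r w)\<^sup>2 \<noteq> 0"
    using assms(2) unfolding coldist_def by (meson sum.neutral)
  then have "1 = (ent G r v - ent G r w)\<^sup>2" using ent_diff_square_01 by metis
  also have "\<dots> \<le> coldist G U v w"
    unfolding coldist_def by (rule member_le_sum) (use r assms(1) in auto)
  finally show ?thesis .
qed

lemma coldist_le_card: "coldist G U v w \<le> real (card U)"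
proof -
  have "coldist G U v w \<le> (\<Sum>r\<in>U. 1)"
    unfolding coldist_def by (rule sum_mono) (metis ent_diff_square_01 order_refl zero_le_one)
  then show ?thesis by simp
qed

lemma coldist_toggle_same:
  "coldist (toggle G r r' v w) U v w = coldist G U v w"
  unfolding coldist_def
proof (rule sum.cong)
  fix x
  show "(ent (toggle G r r' v w) x v - ent (toggle G r r' v w) x w)\<^sup>2 = (ent G x v - ent G x w)\<^sup>2"
    by (cases "x \<in> {r, r'}") (simp_all add: ent_toggle power2_commute)
qed simp

lemma sum_diagonal_split:
  fixes f :: "nat \<Rightarrow> real"
  assumes "finite U" "\<And>r. f r * f r = f r"
  shows "(\<Sum>r\<in>U. \<Sum>r'\<in>U. if r = r' then a * f r else c * (f r * f r')) =
    a * (\<Sum>r\<in>U. f r) - c * (\<Sum>r\<in>U. f r) + c * ((\<Sum>r\<in>U. f r) * (\<Sum>r\<in>U. f r))"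
proof -
  have "(\<Sum>r\<in>U. \<Sum>r'\<in>U. if r = r' then a * f r else c * (f r * f r')) =
    (\<Sum>r\<in>U. \<Sum>r'\<in>U. (if r = r' then (a - c) * f r else 0) + c * (f r * f r'))"
    using assms(2) by (intro sum.cong refl) (auto simp: algebra_simps)
  also have "\<dots> = (\<Sum>r\<in>U. (a - c) * f r) + c * ((\<Sum>r\<in>U. f r) * (\<Sum>r\<in>U. f r))"
    using assms(1) by (simp add: sum.distrib sum_product) (simp only: sum_distrib_left)
  also have "(\<Sum>r\<in>U. (a - c) * f r) = (a - c) * (\<Sum>r\<in>U. f r)"
    by (rule sum_distrib_left[symmetric])
  finally show ?thesis by (simp add: algebra_simps)
qed

text \<open>The signs behave like independent ones. For a product of two different rows, averaging
  over the rows other than \<open>r'\<close> replaces one sign by a bounded sum over the distance,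
  so each of the roughly N^2 products contributes O(1/N) and the diagonal contributes N. The
  constant is 7 = 1 + 6, where 6 bounds the number of excluded rows after \<open>r'\<close> has
  joined \<open>X\<close>.\<close>

lemma column_swap_second_moment:
  fixes \<psi> :: "(nat \<times> nat) set \<Rightarrow> real" and \<eta> :: "(nat \<times> nat) set \<Rightarrow> nat \<Rightarrow> real"
  assumes vz: "v < n" "z < n" "J \<le> v" "J \<le> z" "v \<noteq> z"
    and U: "U = {..<n} - X" "X \<subseteq> {..<n}" "v \<in> X" "z \<in> X" "card X \<le> 5"
    and nonneg: "\<And>G. 0 \<le> \<psi> G" and \<eta>: "\<And>G r. \<bar>\<eta> G r\<bar> \<le> 1"
    and inv: "\<And>G r r'. G \<in> blockclass n s J H \<Longrightarrow> r \<in> U \<Longrightarrow> r' \<in> U \<Longrightarrow> r \<noteq> r' \<Longrightarrow>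
                \<psi> (toggle G r r' v z) = \<psi> G"
    and inv\<eta>: "\<And>G r r' x. \<eta> (toggle G r r' v z) x = \<eta> G x"
  shows "(\<Sum>G\<in>blockclass n s J H. \<psi> G * (\<Sum>r\<in>U. \<eta> G r * (ent G r v - ent G r z))\<^sup>2)
    \<le> 7 * (\<Sum>G\<in>blockclass n s J H. \<psi> G * coldist G U v z)"
proof -
  let ?\<Omega> = "blockclass n s J H"
  define e where "e = (\<lambda>G r. ent G r v - ent G r z)"
  define N where "N = (\<lambda>G. coldist G U v z)"
  have finU: "finite U" using U by simp
  have e2: "(e G r)\<^sup>2 * (e G r)\<^sup>2 = (e G r)\<^sup>2" "\<bar>e G r\<bar> = (e G r)\<^sup>2"
    "(e G r)\<^sup>2 = 0 \<or> (e G r)\<^sup>2 = 1" for G r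
    unfolding e_def by (rule ent_diff_square_square abs_ent_diff_square ent_diff_square_01)+
  have N: "N G = (\<Sum>r\<in>U. (e G r)\<^sup>2)" for G
    by (simp add: N_def coldist_def e_def)
  \<comment> \<open>Majorant of the products: the diagonal terms as they are, the others after
    averaging over the \<open>N G - 1\<close> differing rows apart from \<open>r'\<close>.\<close>
  define Y where "Y = (\<lambda>G r r'. if r = r' then \<psi> G * (e G r)\<^sup>2
      else 6 * \<psi> G * ((e G r)\<^sup>2 * (e G r')\<^sup>2) / (N G - 1))"
  have pair: "(\<Sum>G\<in>?\<Omega>. \<psi> G * ((\<eta> G r * e G r) * (\<eta> G r' * e G r'))) \<le> (\<Sum>G\<in>?\<Omega>. Y G r r')"
    if r: "r \<in> U" "r' \<in> U" for r r'
  proof (cases "r = r'")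
    case True
    have "\<psi> G * ((\<eta> G r * e G r) * (\<eta> G r' * e G r')) \<le> Y G r r'" for G
    proof -
      have "(\<eta> G r)\<^sup>2 \<le> 1" using \<eta>[of G r] by (simp add: abs_square_le_1)
      then have "(\<eta> G r)\<^sup>2 * (e G r)\<^sup>2 \<le> 1 * (e G r)\<^sup>2" by (intro mult_right_mono) auto
      then have "\<psi> G * ((\<eta> G r)\<^sup>2 * (e G r)\<^sup>2) \<le> \<psi> G * (e G r)\<^sup>2"
        using nonneg by (intro mult_left_mono) auto
      then show ?thesis unfolding True[symmetric] Y_def by (simp add: power2_eq_square mult_ac)
    qed
    then show ?thesis by (rule sum_mono)
  next
    case False
    define \<phi> where "\<phi> = (\<lambda>G. \<psi> G * (\<eta> G r * \<eta> G r') * e G r')"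
    define U' where "U' = U - {r'}"
    have "(\<Sum>G\<in>?\<Omega>. \<phi> G * (ent G r v - ent G r z)) =
      (\<Sum>G\<in>?\<Omega>. \<phi> G * (ent G r v - ent G r z)\<^sup>2 * (\<Sum>x\<in>U'. ent G x v - ent G x z)
          / (\<Sum>x\<in>U'. (ent G x v - ent G x z)\<^sup>2))"
    proof (rule column_swap_average)
      fix G x y assume "G \<in> ?\<Omega>" "x \<in> U'" "y \<in> U'" "x \<noteq> y"
      then show "\<phi> (toggle G x y v z) = \<phi> G"
        using inv[of G x y] inv\<eta> by (auto simp: \<phi>_def e_def U'_def)
    qed (use vz U r False in \<open>auto simp: U'_def\<close>)
    also have "\<dots> \<le> (\<Sum>G\<in>?\<Omega>. Y G r r')"
    proof (rule sum_mono)
      fix G assume G: "G \<in> ?\<Omega>"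
      define D where "D = (\<Sum>x\<in>U'. e G x)"
      have "U' = {..<n} - insert r' X" using U by (auto simp: U'_def)
      then have "\<bar>D\<bar> \<le> real (card (insert r' X))"
        unfolding D_def e_def using column_diff_sum_bound[OF G vz(1,2), of "insert r' X"] U r by auto
      also have "\<dots> \<le> 6" using U(5) card_insert_le_m1[of 6 X r'] by simp
      finally have D: "\<bar>D\<bar> \<le> 6" .
      define N' where "N' = (\<Sum>x\<in>U'. (e G x)\<^sup>2)"
      have N': "N' = N G - (e G r')\<^sup>2"
        unfolding N U'_def N'_def using r finU by (simp add: sum_diff1)
      have N'0: "N' \<ge> 0" by (simp add: N'_def sum_nonneg)
      have "\<phi> G * (e G r)\<^sup>2 * D / N' \<le> \<bar>\<phi> G * (e G r)\<^sup>2 * D / N'\<bar>" by (rule abs_ge_self)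
      also have "\<dots> = \<bar>\<phi> G\<bar> * (e G r)\<^sup>2 * \<bar>D\<bar> / N'" using N'0 by (simp add: abs_mult)
      also have "\<dots> \<le> (\<psi> G * (e G r')\<^sup>2) * (e G r)\<^sup>2 * 6 / N'"
      proof -
        have "\<bar>\<eta> G r * \<eta> G r'\<bar> \<le> 1 * 1"
          unfolding abs_mult by (intro mult_mono \<eta>) auto
        then have "\<psi> G * \<bar>\<eta> G r * \<eta> G r'\<bar> * (e G r')\<^sup>2 \<le> \<psi> G * 1 * (e G r')\<^sup>2"
          using nonneg by (intro mult_right_mono mult_left_mono) auto
        then have "\<bar>\<phi> G\<bar> \<le> \<psi> G * (e G r')\<^sup>2"
          unfolding \<phi>_def abs_mult e2(2) using nonneg[of G] by (simp add: abs_mult)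
        then show ?thesis
          using N'0 D nonneg by (intro divide_right_mono mult_mono) auto
      qed
      \<comment> \<open>If \<open>e G r'\<close> is 0, both sides vanish. Otherwise
        \<open>r'\<close> is itself a differing row, and deleting it leaves the distance
        \<open>N G - 1\<close>.\<close>
      also have "\<dots> = Y G r r'"
      proof (cases "(e G r')\<^sup>2 = 0")
        case True
        then show ?thesis using False by (simp add: Y_def)
      next
        case nz: False
        then have "(e G r')\<^sup>2 = 1" using e2(3) by blast
        then show ?thesis unfolding Y_def N' using False by simp
      qed
      finally show "\<phi> G * (ent G r v - ent G r z)\<^sup>2 * (\<Sum>x\<in>U'. ent G x v - ent G x z)
          / (\<Sum>x\<in>U'. (ent G x v - ent G x z)\<^sup>2) \<le> Y G r r'"
        by (simp add: D_def N'_def e_def)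
    qed
    finally show ?thesis by (simp add: \<phi>_def e_def mult_ac)
  qed
  have tot: "(\<Sum>r\<in>U. \<Sum>r'\<in>U. Y G r r') \<le> 7 * (\<psi> G * N G)" for G
  proof -
    have "(\<Sum>r\<in>U. \<Sum>r'\<in>U. Y G r r') = (\<Sum>r\<in>U. \<Sum>r'\<in>U.
        if r = r' then \<psi> G * (e G r)\<^sup>2 else 6 * \<psi> G / (N G - 1) * ((e G r)\<^sup>2 * (e G r')\<^sup>2))"
      by (intro sum.cong refl) (auto simp: Y_def)
    also have "\<dots> = \<psi> G * N G - 6 * \<psi> G / (N G - 1) * N G + 6 * \<psi> G / (N G - 1) * (N G * N G)"
      unfolding N by (rule sum_diagonal_split) (use finU e2(1) in auto)
    also have "\<dots> \<le> 7 * (\<psi> G * N G)"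
    \<comment> \<open>With a single differing row there are no off-diagonal products; the quotients
      by 0 are 0 by convention, in agreement with this.\<close>
    proof (cases "N G = 1")
      case True
      then show ?thesis using nonneg[of G] by simp
    next
      case False
      then have "6 * \<psi> G / (N G - 1) * (N G * N G) - 6 * \<psi> G / (N G - 1) * N G = 6 * (\<psi> G * N G)"
        by (simp add: divide_simps) (simp add: algebra_simps)
      then show ?thesis by simp
    qed
    finally show ?thesis .
  qed
  have "(\<Sum>G\<in>?\<Omega>. \<psi> G * (\<Sum>r\<in>U. \<eta> G r * e G r)\<^sup>2)
      = (\<Sum>G\<in>?\<Omega>. \<Sum>r\<in>U. \<Sum>r'\<in>U. \<psi> G * ((\<eta> G r * e G r) * (\<eta> G r' * e G r')))"
    unfolding power2_eq_square sum_product by (simp only: sum_distrib_left)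
  also have "\<dots> = (\<Sum>r\<in>U. \<Sum>r'\<in>U. \<Sum>G\<in>?\<Omega>. \<psi> G * ((\<eta> G r * e G r) * (\<eta> G r' * e G r')))"
    by (subst sum.swap, rule sum.cong, simp, rule sum.swap)
  also have "\<dots> \<le> (\<Sum>r\<in>U. \<Sum>r'\<in>U. \<Sum>G\<in>?\<Omega>. Y G r r')"
    by (intro sum_mono pair)
  also have "\<dots> = (\<Sum>G\<in>?\<Omega>. \<Sum>r\<in>U. \<Sum>r'\<in>U. Y G r r')"
    by (subst (2) sum.swap, rule sum.cong, simp, rule sum.swap)
  also have "\<dots> \<le> (\<Sum>G\<in>?\<Omega>. 7 * (\<psi> G * N G))"
    by (intro sum_mono tot)
  finally show ?thesis by (simp add: sum_distrib_left e_def N_def)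
qed

section \<open>Columns rarely coincide\<close>

text \<open>After deletion of the block and of three further columns, a row still contains at least
  \<open>\<tau> * n\<close> ones and as many zeros.\<close>

locale dense_block =
  fixes n s J :: nat and \<tau> :: real
  assumes n_ge: "n \<ge> 8" and J_le: "J \<le> n" and \<tau>_pos: "\<tau> > 0"
    and dense: "\<tau> * real n \<le> real s - real J - 3"
    and codense: "\<tau> * real n \<le> real n - real s - real J - 3"
begin

text \<open>Bound for the mean inverse distance of two columns. The constant is 464 = 16 + 448: the
  first part comes from pairs at distance at least \<open>\<tau> * n / 16\<close>, the second from
  the rare pairs that are closer.\<close>

definition \<delta> :: real where "\<delta> = 464 / (\<tau>\<^sup>2 * real n)"

lemma \<tau>_le_1: "\<tau> \<le> 1"
proof -
  have "\<tau> * real n \<le> 1 * real n" using codense by simp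
  then show ?thesis using n_ge by (simp only: mult_le_cancel_right)
qed

lemma \<delta>_nonneg: "\<delta> \<ge> 0"
  by (simp add: \<delta>_def)

text \<open>Whatever entry row \<open>r\<close> has in column \<open>v\<close>, the opposite value
  occurs often outside the block: \<open>dense\<close> supplies the ones and \<open>codense\<close>
  the zeros. Column \<open>r\<close> is left out since its entry in row \<open>r\<close> is on the
  diagonal.\<close>

lemma row_differs_often:
  assumes G: "G \<in> blockclass n s J H" and vw: "v < n" "w < n" and r: "r < n" "r \<noteq> v" "r \<noteq> w"
  shows "\<tau> * real n \<le> (\<Sum>z\<in>{J..<n} - {v, w, r}. (ent G r v - ent G r z)\<^sup>2)"
proof -
  let ?Z = "{J..<n} - {v, w, r}" and ?C = "{..<J} \<union> {v, w, r}"
  have card_C: "card ?C \<le> J + 3"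
    using card_Un_le[of "{..<J}" "{v, w, r}"] card_insert_le_m1[of 3 "{w, r}" v]
      card_insert_le_m1[of 2 "{r}" w] by simp
  have split: "{..<n} = ?Z \<union> ?C" "?Z \<inter> ?C = {}" using J_le vw r by auto
  have "n = card ?Z + card ?C"
    using arg_cong[OF split(1), of card] card_Un_disjoint[of ?Z ?C] split(2)
    by (simp only: card_lessThan) simp
  then have card_Z: "real (card ?Z) \<ge> real n - real J - 3" using card_C by linarith
  have sp: "real s = (\<Sum>z\<in>?Z. ent G r z) + (\<Sum>z\<in>?C. ent G r z)"
    unfolding row_sum[OF G r(1), symmetric] by (subst split(1), rule sum.union_disjoint) (use split in auto)
  have C0: "(\<Sum>z\<in>?C. ent G r z) \<ge> 0" by (simp add: sum_nonneg)
  have "(\<Sum>z\<in>?C. ent G r z) \<le> (\<Sum>z\<in>?C. 1)" by (rule sum_mono) simp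
  then have C1: "(\<Sum>z\<in>?C. ent G r z) \<le> J + 3" using card_C by simp
  show ?thesis
  proof (cases "ent G r v = 0")
    case True
    then have "(\<Sum>z\<in>?Z. (ent G r v - ent G r z)\<^sup>2) = (\<Sum>z\<in>?Z. ent G r z)" by simp
    then show ?thesis using sp C1 dense by linarith
  next
    case False
    then have "ent G r v = 1" using ent_01 by metis
    then have "(\<Sum>z\<in>?Z. (ent G r v - ent G r z)\<^sup>2) = (\<Sum>z\<in>?Z. 1 - ent G r z)"
      by (simp add: power2_diff)
    also have "\<dots> = real (card ?Z) - (\<Sum>z\<in>?Z. ent G r z)" by (simp add: sum_subtractf)
    finally show ?thesis using sp C0 card_Z codense by linarith
  qed
qed

text \<open>Two given columns rarely nearly coincide: column \<open>v\<close> differs from many columns \<open>z\<close> in many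
  rows, and swapping signs between \<open>v\<close> and such a \<open>z\<close> makes \<open>v\<close> differ from \<open>w\<close> by the second
  moment bound.\<close>

lemma inverse_coldist_bound:
  fixes \<phi> :: "(nat \<times> nat) set \<Rightarrow> real"
  assumes vw: "v < n" "w < n" "J \<le> v" "J \<le> w" "v \<noteq> w"
    and X: "X \<subseteq> {..<n}" "card X \<le> 2"
    and nonneg: "\<And>G. 0 \<le> \<phi> G"
    and inv: "\<And>G z r r'. G \<in> blockclass n s J H \<Longrightarrow> z \<notin> {v, w} \<Longrightarrow> r \<notin> X \<Longrightarrow> r' \<notin> X \<Longrightarrow>
                \<phi> (toggle G r r' v z) = \<phi> G"
  shows "(\<Sum>G\<in>blockclass n s J H. \<phi> G / coldist G ({..<n} - ({v, w} \<union> X)) v w)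
           \<le> \<delta> * (\<Sum>G\<in>blockclass n s J H. \<phi> G)"
proof -
  let ?\<Omega> = "blockclass n s J H"
  define U where "U = {..<n} - ({v, w} \<union> X)"
  define Z where "Z = {J..<n} - {v, w}"
  define N where "N = (\<lambda>G. coldist G U v w)"
  define M where "M = (\<lambda>G z. coldist G (U - {z}) v z)"
  \<comment> \<open>By \<open>M_sum\<close> the mean distance of \<open>v\<close> from the at most
    \<open>n\<close> columns \<open>z\<close> is at least \<open>\<tau> * n / 2\<close>, and
    \<open>k\<close> is half of that. As no distance exceeds \<open>n\<close>, at least
    \<open>\<tau> * n / 4\<close> columns then have distance \<open>k\<close> or more from
    \<open>v\<close>.\<close>
  define k where "k = \<tau> * real n / 4"
  define S where "S = (\<Sum>G\<in>?\<Omega>. \<phi> G)"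
  have n0: "real n > 0" using n_ge by simp
  have k0: "k > 0" using \<tau>_pos n0 by (simp add: k_def)
  have S0: "S \<ge> 0" unfolding S_def by (intro sum_nonneg nonneg)
  have finX: "finite X" using X(1) finite_subset by blast
  have card_X: "card ({v, w} \<union> X) \<le> 4"
    using card_Un_le[of "{v, w}" X] X(2) vw(5) by simp
  have card_U: "real (card U) \<ge> real n / 2"
  proof -
    have "card U = n - card ({v, w} \<union> X)"
      unfolding U_def using vw X finX by (subst card_Diff_subset) auto
    then show ?thesis using card_X n_ge by simp
  qed
  have M_sum: "\<tau> * (real n)\<^sup>2 / 2 \<le> (\<Sum>z\<in>Z. M G z)" if G: "G \<in> ?\<Omega>" for G
  proof -
    have "\<tau> * (real n)\<^sup>2 / 2 = \<tau> * real n * (real n / 2)" by (simp add: power2_eq_square)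
    also have "\<dots> \<le> \<tau> * real n * real (card U)"
      using \<tau>_pos card_U by (intro mult_left_mono) auto
    also have "\<dots> = (\<Sum>r\<in>U. \<tau> * real n)" by simp
    also have "\<dots> \<le> (\<Sum>r\<in>U. \<Sum>z\<in>Z - {r}. (ent G r v - ent G r z)\<^sup>2)"
    proof (rule sum_mono)
      fix r assume "r \<in> U"
      then have "r < n" "r \<noteq> v" "r \<noteq> w" by (auto simp: U_def)
      moreover have "Z - {r} = {J..<n} - {v, w, r}" by (auto simp: Z_def)
      ultimately show "\<tau> * real n \<le> (\<Sum>z\<in>Z - {r}. (ent G r v - ent G r z)\<^sup>2)"
        using row_differs_often[OF G vw(1,2)] by simp
    qed
    also have "\<dots> = (\<Sum>r\<in>U. \<Sum>z\<in>Z. of_bool (z \<noteq> r) * (ent G r v - ent G r z)\<^sup>2)"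
      by (intro sum.cong refl sum.mono_neutral_cong_left) (auto simp: Z_def)
    also have "\<dots> = (\<Sum>z\<in>Z. \<Sum>r\<in>U. of_bool (z \<noteq> r) * (ent G r v - ent G r z)\<^sup>2)"
      by (rule sum.swap)
    also have "\<dots> = (\<Sum>z\<in>Z. M G z)"
      unfolding M_def coldist_def
      by (intro sum.cong refl sum.mono_neutral_cong_right) (auto simp: U_def)
    finally show ?thesis .
  qed
  have card_Z: "real (card Z) \<le> real n"
  proof -
    have "Z \<subseteq> {..<n}" by (auto simp: Z_def)
    then show ?thesis using card_mono[of "{..<n}" Z] by simp
  qed
  have many: "\<tau> * real n / 4 \<le> (\<Sum>z\<in>Z. of_bool (k \<le> M G z))" if G: "G \<in> ?\<Omega>" for G
  proof -
    have "M G z \<le> k + real n * of_bool (k \<le> M G z)" for z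
    proof (cases "k \<le> M G z")
      case True
      have "M G z \<le> real (card (U - {z}))" unfolding M_def by (rule coldist_le_card)
      also have "\<dots> \<le> real n"
      proof -
        have "U - {z} \<subseteq> {..<n}" by (auto simp: U_def)
        then show ?thesis using card_mono[of "{..<n}" "U - {z}"] by simp
      qed
      finally show ?thesis using True k0 by simp
    qed (use k0 in auto)
    then have "(\<Sum>z\<in>Z. M G z) \<le> (\<Sum>z\<in>Z. k + real n * of_bool (k \<le> M G z))"
      by (intro sum_mono) simp
    also have "\<dots> = real (card Z) * k + real n * (\<Sum>z\<in>Z. of_bool (k \<le> M G z))"
      unfolding sum.distrib by (simp only: sum_distrib_left[symmetric], simp)
    also have "\<dots> \<le> real n * k + real n * (\<Sum>z\<in>Z. of_bool (k \<le> M G z))"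
      using card_Z k0 by (intro add_right_mono mult_right_mono) auto
    finally have "real n * (\<tau> * real n / 4) \<le> real n * (\<Sum>z\<in>Z. of_bool (k \<le> M G z))"
      using M_sum[OF G] by (simp add: k_def power2_eq_square algebra_simps)
    then show ?thesis using n0 by (simp only: mult_le_cancel_left_pos)
  qed
  have one: "(\<Sum>G\<in>?\<Omega>. \<phi> G * of_bool (k \<le> M G z \<and> N G < k / 4)) \<le> 28 / k * S" if z: "z \<in> Z" for z
  proof -
    \<comment> \<open>Chebyshev weight: if \<open>M G z\<close> is at least \<open>k\<close> but
      \<open>N G\<close> is below \<open>k / 4\<close>, then \<open>- Y G\<close> is at least
      \<open>M G z / 2\<close>, so that \<open>4 * (Y G)\<^sup>2 / (M G z)\<^sup>2\<close> is at
      least 1. Swaps of \<open>v\<close> and \<open>z\<close> do not affect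
      \<open>M G z\<close>.\<close>
    define \<psi> where "\<psi> = (\<lambda>G. \<phi> G * of_bool (k \<le> M G z) * 4 / (M G z)\<^sup>2)"
    define Y where "Y = (\<lambda>G. \<Sum>r\<in>U - {z}. (1 - 2 * ent G r w) * (ent G r v - ent G r z))"
    have zz: "z < n" "J \<le> z" "z \<noteq> v" "z \<noteq> w" using z by (auto simp: Z_def)
    \<comment> \<open>Each summand of (M + Y)/2 is 1 if column \<open>v\<close> differs from both
      \<open>z\<close> and \<open>w\<close> in row \<open>r\<close>, and 0 otherwise. Such rows are
      among those counted by \<open>N G\<close>.\<close>
    have half: "(M G z + Y G) / 2 \<le> N G" for G
    proof -
      have "(M G z + Y G) / 2 = (\<Sum>r\<in>U - {z}. ((ent G r v - ent G r z)\<^sup>2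
          + (1 - 2 * ent G r w) * (ent G r v - ent G r z)) / 2)"
        by (simp add: M_def coldist_def Y_def sum.distrib sum_divide_distrib[symmetric])
      also have "\<dots> \<le> (\<Sum>r\<in>U - {z}. (ent G r v - ent G r w)\<^sup>2)"
      proof (rule sum_mono)
        fix r
        show "((ent G r v - ent G r z)\<^sup>2 + (1 - 2 * ent G r w) * (ent G r v - ent G r z)) / 2
          \<le> (ent G r v - ent G r w)\<^sup>2"
          unfolding ent_def by (cases "(r, v) \<in> G"; cases "(r, w) \<in> G"; cases "(r, z) \<in> G"; simp)
      qed
      also have "\<dots> \<le> N G"
        unfolding N_def coldist_def by (rule sum_mono2) (auto simp: U_def)
      finally show ?thesis .
    qed
    have "(\<Sum>G\<in>?\<Omega>. \<phi> G * of_bool (k \<le> M G z \<and> N G < k / 4)) \<le> (\<Sum>G\<in>?\<Omega>. \<psi> G * (Y G)\<^sup>2)"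
    proof (rule sum_mono)
      fix G
      show "\<phi> G * of_bool (k \<le> M G z \<and> N G < k / 4) \<le> \<psi> G * (Y G)\<^sup>2"
      proof (cases "k \<le> M G z \<and> N G < k / 4")
        case True
        then have M0: "M G z > 0" using k0 by linarith
        have "M G z + Y G \<le> 2 * N G" using half[of G] by simp
        then have "M G z / 2 \<le> - Y G" using conjunct1[OF True] conjunct2[OF True] by (simp add: field_simps)
        then have "(M G z / 2)\<^sup>2 \<le> (- Y G)\<^sup>2" using M0 by (intro power_mono) auto
        then have "1 \<le> 4 / (M G z)\<^sup>2 * (Y G)\<^sup>2" using M0 by (simp add: field_simps)
        then have "\<phi> G * 1 \<le> \<phi> G * (4 / (M G z)\<^sup>2 * (Y G)\<^sup>2)"
          using nonneg by (intro mult_left_mono) auto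
        then show ?thesis using True by (simp add: \<psi>_def)
      next
        case False
        then have "\<phi> G * of_bool (k \<le> M G z \<and> N G < k / 4) = 0" by simp
        also have "\<dots> \<le> \<psi> G * (Y G)\<^sup>2" using nonneg[of G] by (simp add: \<psi>_def)
        finally show ?thesis .
      qed
    qed
    also have "\<dots> \<le> 7 * (\<Sum>G\<in>?\<Omega>. \<psi> G * coldist G (U - {z}) v z)"
      unfolding Y_def
    proof (rule column_swap_second_moment[where X = "insert z ({v, w} \<union> X)"])
      show "card (insert z ({v, w} \<union> X)) \<le> 5"
        using card_insert_le_m1[of 5 "{v, w} \<union> X" z] card_X by simp
      show "0 \<le> \<psi> G" for G using nonneg[of G] by (simp add: \<psi>_def)
      show "\<bar>1 - 2 * ent G r w\<bar> \<le> 1" for G r using ent_01[of G r w] by auto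
      show "1 - 2 * ent (toggle G r r' v z) x w = 1 - 2 * ent G x w" for G r r' x
        using vw zz by simp
      fix G r r' assume "G \<in> ?\<Omega>" "r \<in> U - {z}" "r' \<in> U - {z}"
      then have "\<phi> (toggle G r r' v z) = \<phi> G"
        using inv[of G z r r'] zz by (auto simp: U_def)
      then show "\<psi> (toggle G r r' v z) = \<psi> G"
        by (simp add: \<psi>_def M_def coldist_toggle_same)
    qed (use vw zz X in \<open>auto simp: U_def\<close>)
    also have "\<dots> \<le> 7 * (\<Sum>G\<in>?\<Omega>. \<phi> G * (4 / k))"
    proof (intro mult_left_mono sum_mono)
      fix G
      show "\<psi> G * coldist G (U - {z}) v z \<le> \<phi> G * (4 / k)"
      proof (cases "k \<le> M G z")
        case True
        then have M0: "M G z > 0" using k0 by linarith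
        have "\<psi> G * M G z = \<phi> G * (4 / M G z)"
          using True M0 by (simp add: \<psi>_def power2_eq_square)
        also have "\<dots> \<le> \<phi> G * (4 / k)"
          using nonneg True k0 by (intro mult_left_mono divide_left_mono) auto
        finally show ?thesis by (simp add: M_def)
      next
        case False
        then show ?thesis using nonneg[of G] k0 by (simp add: \<psi>_def)
      qed
    qed simp
    also have "\<dots> = 28 / k * S" unfolding S_def by (simp only: sum_distrib_right[symmetric], simp)
    finally show ?thesis .
  qed
  \<comment> \<open>Double counting of pairs of a digraph and a column \<open>z\<close>: a bad
    digraph has at least \<open>\<tau> * n / 4\<close> columns \<open>z\<close> at distance
    \<open>k\<close> or more from \<open>v\<close>, while each \<open>z\<close> accounts for weight
    at most \<open>28 / k * S\<close>. Here 448 = 28 * 16.\<close>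
  have bad: "(\<Sum>G\<in>?\<Omega>. \<phi> G * of_bool (N G < k / 4)) \<le> 448 / (\<tau>\<^sup>2 * real n) * S"
  proof -
    have "\<tau> * real n / 4 * (\<Sum>G\<in>?\<Omega>. \<phi> G * of_bool (N G < k / 4))
        = (\<Sum>G\<in>?\<Omega>. \<phi> G * of_bool (N G < k / 4) * (\<tau> * real n / 4))"
      unfolding sum_distrib_left by (rule sum.cong) (simp_all only: mult.commute)
    also have "\<dots> \<le> (\<Sum>G\<in>?\<Omega>. \<phi> G * of_bool (N G < k / 4) * (\<Sum>z\<in>Z. of_bool (k \<le> M G z)))"
      using nonneg by (intro sum_mono mult_left_mono many) auto
    also have "\<dots> = (\<Sum>G\<in>?\<Omega>. \<Sum>z\<in>Z. \<phi> G * of_bool (k \<le> M G z \<and> N G < k / 4))"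
      unfolding sum_distrib_left by (intro sum.cong refl) (simp only: of_bool_conj mult_ac)
    also have "\<dots> = (\<Sum>z\<in>Z. \<Sum>G\<in>?\<Omega>. \<phi> G * of_bool (k \<le> M G z \<and> N G < k / 4))"
      by (rule sum.swap)
    also have "\<dots> \<le> (\<Sum>z\<in>Z. 28 / k * S)" by (intro sum_mono one)
    also have "\<dots> = real (card Z) * (28 / k * S)" by simp
    also have "\<dots> \<le> real n * (28 / k * S)"
      using card_Z k0 S0 by (intro mult_right_mono) auto
    also have "\<dots> = \<tau> * real n / 4 * (448 / (\<tau>\<^sup>2 * real n) * S)"
      using \<tau>_pos n0 by (simp add: k_def power2_eq_square field_simps)
    finally show ?thesis
      using \<tau>_pos n0 by (subst (asm) mult_le_cancel_left_pos) auto
  qed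
  have "(\<Sum>G\<in>?\<Omega>. \<phi> G / N G) \<le> (\<Sum>G\<in>?\<Omega>. \<phi> G * (16 / (\<tau> * real n)) + \<phi> G * of_bool (N G < k / 4))"
  proof (rule sum_mono)
    fix G
    have "1 / N G \<le> 16 / (\<tau> * real n) + of_bool (N G < k / 4)"
    proof (cases "N G < k / 4")
      case True
      \<comment> \<open>The distance is an integer and 1/0 is 0, so the inverse is at most 1 even
        for coinciding columns.\<close>
      have "1 / N G \<le> 1"
      proof (cases "N G = 0")
        case False
        then have "N G \<ge> 1" unfolding N_def by (intro coldist_ge_1) (auto simp: U_def)
        then show ?thesis by simp
      qed simp
      moreover have "0 \<le> 16 / (\<tau> * real n)" using \<tau>_pos by simp
      moreover have "of_bool (N G < k / 4) = (1::real)" using True by simp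
      ultimately show ?thesis by linarith
    next
      case False
      then have "1 / N G \<le> 1 / (k / 4)" using k0 by (intro divide_left_mono) auto
      then show ?thesis using False by (simp add: k_def)
    qed
    then have "\<phi> G * (1 / N G) \<le> \<phi> G * (16 / (\<tau> * real n) + of_bool (N G < k / 4))"
      using nonneg by (intro mult_left_mono) auto
    then show "\<phi> G / N G \<le> \<phi> G * (16 / (\<tau> * real n)) + \<phi> G * of_bool (N G < k / 4)"
      by (simp add: distrib_left)
  qed
  also have "\<dots> = 16 / (\<tau> * real n) * S + (\<Sum>G\<in>?\<Omega>. \<phi> G * of_bool (N G < k / 4))"
    unfolding sum.distrib S_def sum_distrib_left by (simp only: mult.commute)
  also have "\<dots> \<le> 16 / (\<tau>\<^sup>2 * real n) * S + 448 / (\<tau>\<^sup>2 * real n) * S"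
  proof (rule add_mono[OF mult_right_mono bad])
    have "\<tau>\<^sup>2 \<le> \<tau>" using \<tau>_pos \<tau>_le_1 by (simp add: power2_eq_square mult_left_le)
    then show "16 / (\<tau> * real n) \<le> 16 / (\<tau>\<^sup>2 * real n)"
      using \<tau>_pos n0 by (intro divide_left_mono mult_right_mono) auto
  qed (rule S0)
  also have "\<dots> = \<delta> * S" by (simp add: \<delta>_def field_simps)
  finally show ?thesis by (simp add: N_def U_def S_def)
qed

end

section \<open>Covariances of entries\<close>

text \<open>If the sums of \<open>a\<close> and \<open>b\<close> over \<open>W\<close> are
  prescribed, this expresses the sum of products through differences, the quantities that swaps
  control.\<close>

lemma sum_pair_differences:
  fixes a b :: "nat \<Rightarrow> real"
  assumes "finite W"
  shows "(\<Sum>v\<in>W. \<Sum>w\<in>W. (a v - a w) * (b v - b w)) =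
    2 * real (card W) * (\<Sum>v\<in>W. a v * b v) - 2 * (\<Sum>v\<in>W. a v) * (\<Sum>v\<in>W. b v)"
proof -
  have "(\<Sum>v\<in>W. \<Sum>w\<in>W. (a v - a w) * (b v - b w)) =
    (\<Sum>v\<in>W. \<Sum>w\<in>W. a v * b v + a w * b w - a v * b w - a w * b v)"
    by (simp add: algebra_simps)
  also have "\<dots> = 2 * real (card W) * (\<Sum>v\<in>W. a v * b v)
     - (\<Sum>v\<in>W. \<Sum>w\<in>W. a v * b w) - (\<Sum>v\<in>W. \<Sum>w\<in>W. a w * b v)"
    by (simp add: sum.distrib sum_subtractf flip: sum_distrib_left)
  also have "(\<Sum>v\<in>W. \<Sum>w\<in>W. a w * b v) = (\<Sum>v\<in>W. \<Sum>w\<in>W. a v * b w)"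
    by (rule sum.swap)
  also have "(\<Sum>v\<in>W. \<Sum>w\<in>W. a v * b w) = (\<Sum>v\<in>W. a v) * (\<Sum>v\<in>W. b v)"
    by (simp add: sum_product)
  finally show ?thesis by simp
qed

text \<open>The pair identity applied twice, in the row index \<open>u\<close> and then in the
  column index \<open>v\<close>. The right-hand side contains the path count, the two cherry counts
  and the total of \<open>M\<close>.\<close>

lemma sum_double_differences:
  fixes a b :: "nat \<Rightarrow> real" and M :: "nat \<Rightarrow> nat \<Rightarrow> real"
  assumes W: "finite W" and m: "m = real (card W)"
  shows "(\<Sum>v\<in>W. \<Sum>w\<in>W. \<Sum>u\<in>W. \<Sum>u'\<in>W.
      (a v - a w) * ((b u - b u') * (M u v - M u w - (M u' v - M u' w)))) =
    4 * (m\<^sup>2 * (\<Sum>u\<in>W. \<Sum>v\<in>W. a v * b u * M u v) - m * (\<Sum>v\<in>W. a v) * (\<Sum>u\<in>W. \<Sum>v\<in>W. b u * M u v)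
      - m * (\<Sum>u\<in>W. b u) * (\<Sum>u\<in>W. \<Sum>v\<in>W. a v * M u v)
      + (\<Sum>v\<in>W. a v) * (\<Sum>u\<in>W. b u) * (\<Sum>u\<in>W. \<Sum>v\<in>W. M u v))"
proof -
  define c where "c = (\<lambda>v. 2 * m * (\<Sum>u\<in>W. b u * M u v) - 2 * (\<Sum>u\<in>W. b u) * (\<Sum>u\<in>W. M u v))"
  have "(\<Sum>u\<in>W. \<Sum>u'\<in>W. (b u - b u') * (M u v - M u w - (M u' v - M u' w))) = c v - c w" for v w
  proof -
    have "(\<Sum>u\<in>W. \<Sum>u'\<in>W. (b u - b u') * (M u v - M u w - (M u' v - M u' w))) =
      2 * m * (\<Sum>u\<in>W. b u * (M u v - M u w)) - 2 * (\<Sum>u\<in>W. b u) * (\<Sum>u\<in>W. M u v - M u w)"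
      unfolding m by (rule sum_pair_differences[OF W])
    then show ?thesis
      by (simp add: c_def sum_subtractf right_diff_distrib)
  qed
  then have "(\<Sum>v\<in>W. \<Sum>w\<in>W. \<Sum>u\<in>W. \<Sum>u'\<in>W.
      (a v - a w) * ((b u - b u') * (M u v - M u w - (M u' v - M u' w)))) =
      (\<Sum>v\<in>W. \<Sum>w\<in>W. (a v - a w) * (c v - c w))"
    by (simp flip: sum_distrib_left)
  also have "\<dots> = 2 * m * (\<Sum>v\<in>W. a v * c v) - 2 * (\<Sum>v\<in>W. a v) * (\<Sum>v\<in>W. c v)"
    unfolding m by (rule sum_pair_differences[OF W])
  also have "(\<Sum>v\<in>W. c v) = 2 * m * (\<Sum>u\<in>W. \<Sum>v\<in>W. b u * M u v)
       - 2 * (\<Sum>u\<in>W. b u) * (\<Sum>u\<in>W. \<Sum>v\<in>W. M u v)"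
  proof -
    have "(\<Sum>v\<in>W. c v) = 2 * m * (\<Sum>v\<in>W. \<Sum>u\<in>W. b u * M u v) - 2 * (\<Sum>u\<in>W. b u) * (\<Sum>v\<in>W. \<Sum>u\<in>W. M u v)"
      unfolding c_def by (simp only: sum_subtractf sum_distrib_left[symmetric])
    then show ?thesis
      by (simp only: sum.swap[of "\<lambda>v u. b u * M u v" W W] sum.swap[of "\<lambda>v u. M u v" W W])
  qed
  also have "(\<Sum>v\<in>W. a v * c v) = 2 * m * (\<Sum>v\<in>W. a v * (\<Sum>u\<in>W. b u * M u v))
       - 2 * (\<Sum>u\<in>W. b u) * (\<Sum>v\<in>W. a v * (\<Sum>u\<in>W. M u v))"
  proof -
    have "a v * c v = 2 * m * (a v * (\<Sum>u\<in>W. b u * M u v)) - 2 * (\<Sum>u\<in>W. b u) * (a v * (\<Sum>u\<in>W. M u v))" for v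
      unfolding c_def by (simp add: algebra_simps)
    then show ?thesis by (simp only: sum_subtractf sum_distrib_left[symmetric])
  qed
  also have "(\<Sum>v\<in>W. a v * (\<Sum>u\<in>W. b u * M u v)) = (\<Sum>u\<in>W. \<Sum>v\<in>W. a v * b u * M u v)"
    unfolding sum_distrib_left by (subst sum.swap) (simp add: mult.assoc)
  also have "(\<Sum>v\<in>W. a v * (\<Sum>u\<in>W. M u v)) = (\<Sum>u\<in>W. \<Sum>v\<in>W. a v * M u v)"
    unfolding sum_distrib_left by (rule sum.swap)
  finally show ?thesis by (simp add: power2_eq_square algebra_simps)
qed

lemma ent_diag: "G \<in> blockclass n s J H \<Longrightarrow> ent G v v = 0"
  by (auto simp: blockclass_def regular_digraphs_def simple_digraph_def ent_def)

lemma ent_block: "G \<in> blockclass n s J H \<Longrightarrow> a < J \<Longrightarrow> b < J \<Longrightarrow> ent G a b = ent H a b"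
  by (auto simp: blockclass_def induced_def ent_def)

lemma blockclass_subset: "G \<in> blockclass n s J H \<Longrightarrow> H \<subseteq> {0..<J} \<times> {0..<J}"
  by (auto simp: blockclass_def induced_def)

lemma card_ent:
  assumes "H \<subseteq> {0..<J} \<times> {0..<J}"
  shows "real (card H) = (\<Sum>a<J. \<Sum>b<J. ent H a b)"
proof -
  have "(\<Sum>a<J. \<Sum>b<J. ent H a b) = (\<Sum>p\<in>{..<J} \<times> {..<J}. of_bool (p \<in> H))"
    unfolding sum.cartesian_product by (rule sum.cong) (auto simp: ent_def)
  also have "\<dots> = real (card ({..<J} \<times> {..<J} \<inter> H))" by (simp add: Collect_mem_eq)
  also have "{..<J} \<times> {..<J} \<inter> H = H" using assms by auto
  finally show ?thesis ..
qed

context dense_block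
begin

definition m :: real where "m = real n - real J"

lemma m_pos: "m > 0"
proof -
  have "0 < \<tau> * real n" using \<tau>_pos n_ge by simp
  then have "0 < real n - real s - real J - 3" using codense by linarith
  then show ?thesis by (simp add: m_def)
qed

lemma card_W: "real (card {J..<n}) = m"
  using J_le by (simp add: m_def of_nat_diff)

lemma m_le_n: "m \<le> real n" by (simp add: m_def)

text \<open>Averaging replaces the sign in row \<open>i\<close> by a sum of signs divided by the
  distance of the columns. That sum is at most 4, the number of excluded rows, and
  \<open>\<delta>\<close> bounds the mean inverse distance.\<close>

lemma column_swap_bound:
  fixes \<phi> :: "(nat \<times> nat) set \<Rightarrow> real"
  assumes vw: "v < n" "w < n" "J \<le> v" "J \<le> w" "v \<noteq> w"
    and X: "X \<subseteq> {..<n}" "card X \<le> 2" and i: "i < n" "i \<notin> {v, w} \<union> X"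
    and B: "\<And>G. \<bar>\<phi> G\<bar> \<le> B"
    and inv: "\<And>G r r'. G \<in> blockclass n s J H \<Longrightarrow> r \<notin> {v, w} \<union> X \<Longrightarrow> r' \<notin> {v, w} \<union> X \<Longrightarrow>
                \<phi> (toggle G r r' v w) = \<phi> G"
  shows "\<bar>\<Sum>G\<in>blockclass n s J H. \<phi> G * (ent G i v - ent G i w)\<bar>
    \<le> 4 * B * \<delta> * real (card (blockclass n s J H))"
proof -
  let ?\<Omega> = "blockclass n s J H"
  define U where "U = {..<n} - ({v, w} \<union> X)"
  have B0: "B \<ge> 0" using B[of undefined] by linarith
  have card_X: "card ({v, w} \<union> X) \<le> 4"
    using card_Un_le[of "{v, w}" X] X(2) vw(5) by simp
  have "(\<Sum>G\<in>?\<Omega>. \<phi> G * (ent G i v - ent G i w)) = (\<Sum>G\<in>?\<Omega>. \<phi> G * (ent G i v - ent G i w)\<^sup>2 *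
      (\<Sum>r\<in>U. ent G r v - ent G r w) / coldist G U v w)"
    unfolding coldist_def
    by (rule column_swap_average) (use vw i inv in \<open>auto simp: U_def\<close>)
  then have "\<bar>\<Sum>G\<in>?\<Omega>. \<phi> G * (ent G i v - ent G i w)\<bar> \<le> (\<Sum>G\<in>?\<Omega>. \<bar>\<phi> G * (ent G i v - ent G i w)\<^sup>2 *
      (\<Sum>r\<in>U. ent G r v - ent G r w) / coldist G U v w\<bar>)"
    by (simp only: sum_abs)
  also have "\<dots> \<le> (\<Sum>G\<in>?\<Omega>. (4 * B) / coldist G U v w)"
  proof (rule sum_mono)
    fix G assume G: "G \<in> ?\<Omega>"
    have D: "\<bar>\<Sum>r\<in>U. ent G r v - ent G r w\<bar> \<le> 4"
      using column_diff_sum_bound[OF G vw(1,2), of "{v, w} \<union> X"] card_X vw X by (simp add: U_def)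
    have "\<bar>\<phi> G * (ent G i v - ent G i w)\<^sup>2 * (\<Sum>r\<in>U. ent G r v - ent G r w) / coldist G U v w\<bar>
      = \<bar>\<phi> G\<bar> * (ent G i v - ent G i w)\<^sup>2 * \<bar>\<Sum>r\<in>U. ent G r v - ent G r w\<bar> / coldist G U v w"
      by (simp add: abs_mult)
    also have "\<dots> \<le> B * 1 * 4 / coldist G U v w"
      using B[of G] B0 D ent_diff_square_01[of G i v i w]
      by (intro divide_right_mono mult_mono) auto
    finally show "\<bar>\<phi> G * (ent G i v - ent G i w)\<^sup>2 * (\<Sum>r\<in>U. ent G r v - ent G r w) / coldist G U v w\<bar>
       \<le> (4 * B) / coldist G U v w" by (simp add: mult.commute)
  qed
  also have "\<dots> \<le> \<delta> * (\<Sum>G\<in>?\<Omega>. 4 * B)"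
    unfolding U_def by (rule inverse_coldist_bound) (use vw X B0 in auto)
  finally show ?thesis by (simp add: mult_ac)
qed

text \<open>Freezing row \<open>j\<close> makes the second factor invariant under the switches, so
  it can serve as the weight.\<close>

lemma same_column_cov:
  assumes "v < n" "w < n" "J \<le> v" "J \<le> w" "v \<noteq> w" "i < J" "j < J" "i \<noteq> j"
  shows "\<bar>\<Sum>G\<in>blockclass n s J H. (ent G i v - ent G i w) * (ent G j v - ent G j w)\<bar>
    \<le> 4 * \<delta> * real (card (blockclass n s J H))"
proof -
  have "\<bar>\<Sum>G\<in>blockclass n s J H. (ent G j v - ent G j w) * (ent G i v - ent G i w)\<bar>
    \<le> 4 * 1 * \<delta> * real (card (blockclass n s J H))"
    by (rule column_swap_bound[where X = "{j}"])
       (use assms J_le abs_ent_diff_le_1 in auto)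
  then show ?thesis by (simp add: mult.commute)
qed

lemma row_column_cov:
  assumes "v < n" "w < n" "J \<le> v" "J \<le> w" "v \<noteq> w" "i < J" "k < J"
  shows "\<bar>\<Sum>G\<in>blockclass n s J H. (ent G i v - ent G i w) * (ent G v k - ent G w k)\<bar>
    \<le> 4 * \<delta> * real (card (blockclass n s J H))"
proof -
  have "\<bar>\<Sum>G\<in>blockclass n s J H. (ent G v k - ent G w k) * (ent G i v - ent G i w)\<bar>
    \<le> 4 * 1 * \<delta> * real (card (blockclass n s J H))"
    by (rule column_swap_bound[where X = "{}"])
       (use assms J_le abs_ent_diff_le_1 in auto)
  then show ?thesis by (simp add: mult.commute)
qed

text \<open>A single swap with rows \<open>u\<close> and \<open>u'\<close> frozen. This gains only
  one factor \<open>\<delta>\<close>, but allows coincidences between {u, u'} and {v, w}, which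
  concern only O(m^3) quadruples.\<close>

lemma path_cov:
  assumes "v < n" "w < n" "J \<le> v" "J \<le> w" "v \<noteq> w" "i < J" "k < J"
    and "u < n" "u' < n" "J \<le> u" "J \<le> u'"
  shows "\<bar>\<Sum>G\<in>blockclass n s J H. (ent G i v - ent G i w) *
      ((ent G u k - ent G u' k) * (ent G u v - ent G u w - (ent G u' v - ent G u' w)))\<bar>
    \<le> 8 * \<delta> * real (card (blockclass n s J H))"
proof -
  have "\<bar>\<Sum>G\<in>blockclass n s J H. ((ent G u k - ent G u' k) * (ent G u v - ent G u w - (ent G u' v - ent G u' w)))
       * (ent G i v - ent G i w)\<bar>
    \<le> 4 * 2 * \<delta> * real (card (blockclass n s J H))"
  proof (rule column_swap_bound[where X = "{u, u'}"])
    show "\<bar>(ent G u k - ent G u' k) * (ent G u v - ent G u w - (ent G u' v - ent G u' w))\<bar> \<le> 2" for G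
    proof -
      have "\<bar>ent G u v - ent G u w - (ent G u' v - ent G u' w)\<bar> \<le> 2"
        using abs_ent_diff_le_1[of G u v u w] abs_ent_diff_le_1[of G u' v u' w] by linarith
      then have "\<bar>ent G u k - ent G u' k\<bar> * \<bar>ent G u v - ent G u w - (ent G u' v - ent G u' w)\<bar> \<le> 1 * 2"
        by (intro mult_mono abs_ent_diff_le_1) auto
      then show ?thesis by (simp add: abs_mult)
    qed
  qed (use assms J_le card_insert_le_m1[of 2 "{u'}" u] in auto)
  then show ?thesis by (simp add: mult.commute)
qed

text \<open>The distance of the rows \<open>u\<close> and \<open>u'\<close> depends only on entries
  in these rows, which the switches between columns leave alone when \<open>u\<close> and
  \<open>u'\<close> are frozen. It may therefore be the weight in
  \<open>inverse_coldist_bound\<close>, which is then applied a second time to the reversed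
  class.\<close>

lemma inverse_dist_product_bound:
  assumes "v < n" "w < n" "J \<le> v" "J \<le> w" "v \<noteq> w" "u < n" "u' < n" "J \<le> u" "J \<le> u'" "u \<noteq> u'"
  defines "U \<equiv> {..<n} - {v, w, u, u'}"
  shows "(\<Sum>G\<in>blockclass n s J H. 1 / coldist (G\<inverse>) U u u' / coldist G U v w)
    \<le> \<delta>\<^sup>2 * real (card (blockclass n s J H))"
proof -
  have U1: "U = {..<n} - ({v, w} \<union> {u, u'})" and U2: "U = {..<n} - ({u, u'} \<union> {v, w})"
    by (auto simp: U_def)
  have "(\<Sum>G\<in>blockclass n s J H. 1 / coldist (G\<inverse>) U u u' / coldist G U v w)
    \<le> \<delta> * (\<Sum>G\<in>blockclass n s J H. 1 / coldist (G\<inverse>) U u u')"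
    unfolding U1
  proof (rule inverse_coldist_bound)
    fix G z r r' assume "r \<notin> {u, u'}" "r' \<notin> {u, u'}"
    then show "1 / coldist ((toggle G r r' v z)\<inverse>) ({..<n} - ({v, w} \<union> {u, u'})) u u' =
       1 / coldist (G\<inverse>) ({..<n} - ({v, w} \<union> {u, u'})) u u'"
      by (simp add: coldist_def)
  qed (use assms in auto)
  also have "(\<Sum>G\<in>blockclass n s J H. 1 / coldist (G\<inverse>) U u u')
      = (\<Sum>G\<in>blockclass n s J (H\<inverse>). 1 / coldist G U u u')"
    by (rule sum_blockclass_converse[symmetric])
  also have "\<dots> \<le> \<delta> * (\<Sum>G\<in>blockclass n s J (H\<inverse>). 1)"
    unfolding U2 by (rule inverse_coldist_bound) (use assms in auto)
  finally show ?thesis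
    using \<delta>_nonneg by (simp add: power2_eq_square card_blockclass_converse mult_left_mono mult.assoc)
qed

text \<open>A switch in the columns \<open>v\<close>, \<open>w\<close> is followed by one in the rows \<open>u\<close>, \<open>u'\<close>; each gains a
  factor \<open>\<delta>\<close>.\<close>

lemma path_cov_distinct:
  assumes vw: "v < n" "w < n" "J \<le> v" "J \<le> w" "v \<noteq> w" and ik: "i < J" "k < J"
    and uu: "u < n" "u' < n" "J \<le> u" "J \<le> u'" "u \<noteq> u'" and disj: "{u, u'} \<inter> {v, w} = {}"
  shows "\<bar>\<Sum>G\<in>blockclass n s J H. (ent G i v - ent G i w) *
      ((ent G u k - ent G u' k) * (ent G u v - ent G u w - (ent G u' v - ent G u' w)))\<bar>
    \<le> 32 * \<delta>\<^sup>2 * real (card (blockclass n s J H))"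
proof -
  let ?\<Omega> = "blockclass n s J H"
  define U where "U = {..<n} - {v, w, u, u'}"
  have card4: "card {v, w, u, u'} \<le> 4"
    using card_insert_le_m1[of 4 "{w, u, u'}" v] card_insert_le_m1[of 3 "{u, u'}" w] uu(5) by simp
  define D where "D = (\<lambda>G v w. \<Sum>r\<in>U. ent G r v - ent G r w)"
  define K where "K = (\<lambda>G. ent G u v - ent G u w - (ent G u' v - ent G u' w))"
  \<comment> \<open>What the first swap leaves behind. \<open>D\<close> and \<open>coldist\<close>
    run over rows other than \<open>u\<close> and \<open>u'\<close>, and \<open>K\<close> involves
    only the columns \<open>v\<close> and \<open>w\<close>, so toggles in rows \<open>u\<close>,
    \<open>u'\<close> and columns from \<open>U\<close> do not change \<open>\<phi>\<close>. This
    permits the second averaging, in the reversed digraph.\<close>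
  define \<phi> where "\<phi> = (\<lambda>G. K G * (ent G i v - ent G i w)\<^sup>2 * D G v w / coldist G U v w)"
  have "(\<Sum>G\<in>?\<Omega>. (ent G i v - ent G i w) * ((ent G u k - ent G u' k) * K G))
      = (\<Sum>G\<in>?\<Omega>. ((ent G u k - ent G u' k) * K G) * (ent G i v - ent G i w))"
    by (simp add: mult.commute)
  also have "\<dots> = (\<Sum>G\<in>?\<Omega>. ((ent G u k - ent G u' k) * K G) * (ent G i v - ent G i w)\<^sup>2 *
      D G v w / coldist G U v w)"
    unfolding D_def coldist_def
    by (rule column_swap_average) (use vw ik uu J_le in \<open>auto simp: U_def K_def\<close>)
  also have "\<dots> = (\<Sum>G\<in>?\<Omega>. \<phi> G * (ent G u k - ent G u' k))"
    by (simp add: \<phi>_def mult_ac)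
  also have "\<dots> = (\<Sum>G\<in>blockclass n s J (H\<inverse>). \<phi> (G\<inverse>) * (ent G k u - ent G k u'))"
    using sum_blockclass_converse[of "\<lambda>G. \<phi> (G\<inverse>) * (ent G k u - ent G k u')" n s J H]
    by simp
  also have "\<dots> = (\<Sum>G\<in>blockclass n s J (H\<inverse>). \<phi> (G\<inverse>) * (ent G k u - ent G k u')\<^sup>2 *
      D G u u' / coldist G U u u')"
    unfolding D_def coldist_def
  proof (rule column_swap_average)
    fix G r r' assume r: "r \<in> U" "r' \<in> U"
    have "\<phi> ((toggle G r r' u u')\<inverse>) = \<phi> (toggle (G\<inverse>) u u' r r')"
      by (simp add: toggle_converse)
    also have "\<dots> = \<phi> (G\<inverse>)"
      using r by (auto simp: \<phi>_def K_def D_def coldist_def U_def)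
    finally show "\<phi> ((toggle G r r' u u')\<inverse>) = \<phi> (G\<inverse>)" .
  qed (use uu ik J_le disj vw in \<open>auto simp: U_def\<close>)
  finally have "\<bar>\<Sum>G\<in>?\<Omega>. (ent G i v - ent G i w) * ((ent G u k - ent G u' k) * K G)\<bar>
    \<le> (\<Sum>G\<in>blockclass n s J (H\<inverse>). \<bar>\<phi> (G\<inverse>) * (ent G k u - ent G k u')\<^sup>2 * D G u u' / coldist G U u u'\<bar>)"
    by (simp only: sum_abs)
  \<comment> \<open>The factor is 32 = 2 * 4 * 4: the mixed difference \<open>K\<close> is at most
    2, and each sum of signs is at most 4, the number of excluded indices.\<close>
  also have "\<dots> \<le> (\<Sum>G\<in>blockclass n s J (H\<inverse>). 32 * (1 / coldist G U u u' / coldist (G\<inverse>) U v w))"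
  proof (rule sum_mono)
    fix G assume G: "G \<in> blockclass n s J (H\<inverse>)"
    then have G': "G\<inverse> \<in> ?\<Omega>" using blockclass_converse[of "G\<inverse>" n s J H] by simp
    have K: "\<bar>K (G\<inverse>)\<bar> \<le> 2"
      using abs_ent_diff_le_1[of "G\<inverse>" u v u w] abs_ent_diff_le_1[of "G\<inverse>" u' v u' w]
      unfolding K_def by linarith
    have D1: "\<bar>D (G\<inverse>) v w\<bar> \<le> 4" and D2: "\<bar>D G u u'\<bar> \<le> 4"
      using column_diff_sum_bound[OF G' vw(1,2), of "{v, w, u, u'}"]
        column_diff_sum_bound[OF G uu(1,2), of "{v, w, u, u'}"] card4 vw uu
      unfolding D_def U_def by auto
    have "\<bar>\<phi> (G\<inverse>)\<bar> = \<bar>K (G\<inverse>)\<bar> * (ent (G\<inverse>) i v - ent (G\<inverse>) i w)\<^sup>2 * \<bar>D (G\<inverse>) v w\<bar> / coldist (G\<inverse>) U v w"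
      by (simp add: \<phi>_def abs_mult)
    also have "\<dots> \<le> 2 * 1 * 4 / coldist (G\<inverse>) U v w"
      using K D1 ent_diff_square_01[of "G\<inverse>" i v i w] by (intro divide_right_mono mult_mono) auto
    finally have phi: "\<bar>\<phi> (G\<inverse>)\<bar> \<le> 8 / coldist (G\<inverse>) U v w" by simp
    have "\<bar>\<phi> (G\<inverse>) * (ent G k u - ent G k u')\<^sup>2 * D G u u' / coldist G U u u'\<bar>
      = \<bar>\<phi> (G\<inverse>)\<bar> * (ent G k u - ent G k u')\<^sup>2 * \<bar>D G u u'\<bar> / coldist G U u u'"
      by (simp add: abs_mult)
    also have "\<dots> \<le> 8 / coldist (G\<inverse>) U v w * 1 * 4 / coldist G U u u'"
      using phi D2 ent_diff_square_01[of G k u k u'] by (intro divide_right_mono mult_mono) auto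
    finally show "\<bar>\<phi> (G\<inverse>) * (ent G k u - ent G k u')\<^sup>2 * D G u u' / coldist G U u u'\<bar>
       \<le> 32 * (1 / coldist G U u u' / coldist (G\<inverse>) U v w)" by (simp add: field_simps)
  qed
  also have "\<dots> = 32 * (\<Sum>G\<in>?\<Omega>. 1 / coldist (G\<inverse>) U u u' / coldist G U v w)"
    by (simp only: sum_distrib_left sum_blockclass_converse converse_converse)
  also have "\<dots> \<le> 32 * (\<delta>\<^sup>2 * real (card ?\<Omega>))"
    unfolding U_def by (intro mult_left_mono inverse_dist_product_bound) (use vw uu in auto)
  finally show ?thesis by (simp add: K_def mult_ac)
qed

end

lemma sum_abs_swap_bound:
  fixes f :: "'a \<Rightarrow> 'b \<Rightarrow> real"
  assumes "\<And>v. v \<in> W \<Longrightarrow> \<bar>\<Sum>G\<in>\<Omega>. f G v\<bar> \<le> g v"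
  shows "\<bar>\<Sum>G\<in>\<Omega>. \<Sum>v\<in>W. f G v\<bar> \<le> (\<Sum>v\<in>W. g v)"
proof -
  have "\<bar>\<Sum>G\<in>\<Omega>. \<Sum>v\<in>W. f G v\<bar> = \<bar>\<Sum>v\<in>W. \<Sum>G\<in>\<Omega>. f G v\<bar>"
    by (subst sum.swap) simp
  also have "\<dots> \<le> (\<Sum>v\<in>W. g v)"
    by (rule order_trans[OF sum_abs]) (intro sum_mono assms)
  finally show ?thesis .
qed

lemma sum_affine_combination:
  fixes f g h :: "'a \<Rightarrow> real"
  shows "(\<Sum>x\<in>A. K * (f x - a * g x - b * h x + c)) =
    K * ((\<Sum>x\<in>A. f x) - a * (\<Sum>x\<in>A. g x) - b * (\<Sum>x\<in>A. h x) + real (card A) * c)"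
  by (simp add: sum.distrib sum_subtractf flip: sum_distrib_left)

context dense_block
begin

section \<open>Forced densities and means of small arc patterns\<close>

lemma m_nat: "real (n - J) = m"
  using card_W by simp

text \<open>The fraction of outer vertices that receive an arc from \<open>i\<close>; it is the same
  for every digraph in the class.\<close>

definition outprob :: "(nat \<times> nat) set \<Rightarrow> nat \<Rightarrow> real" where
  "outprob H i = (real s - real (outdeg H i)) / m"

definition inprob :: "(nat \<times> nat) set \<Rightarrow> nat \<Rightarrow> real" where
  "inprob H k = (real s - real (indeg H k)) / m"

text \<open>Number of arcs with both ends outside the block: \<open>m * s\<close> arcs start
  outside, and \<open>J * s - card H\<close> of these end inside.\<close>

definition arcs_out :: "(nat \<times> nat) set \<Rightarrow> real" where
  "arcs_out H = m * real s - real J * real s + real (card H)"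

lemma inprob_converse: "inprob H k = outprob (H\<inverse>) k"
  by (simp add: inprob_def outprob_def outdeg_converse)

lemma arcs_out_converse: "arcs_out (H\<inverse>) = arcs_out H"
  by (simp add: arcs_out_def card_inverse)

lemma sum_split_W: "(\<Sum>c<n. f c) = (\<Sum>c<J. f c) + (\<Sum>c\<in>{J..<n}. f c)" for f :: "nat \<Rightarrow> real"
proof -
  have "{..<n} = {..<J} \<union> {J..<n}" using J_le by auto
  then show ?thesis by (simp add: sum.union_disjoint ivl_disj_int)
qed

lemma row_sum_W:
  assumes G: "G \<in> blockclass n s J H" and i: "i < J"
  shows "(\<Sum>v\<in>{J..<n}. ent G i v) = m * outprob H i"
proof -
  have "(\<Sum>c<J. ent G i c) = (\<Sum>c<J. ent H i c)"
    using ent_block[OF G i] by simp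
  also have "\<dots> = real (outdeg H i)"
    using blockclass_subset[OF G] by (simp add: outdeg_ent)
  finally show ?thesis
    using row_sum[OF G, of i] i J_le m_pos unfolding sum_split_W by (simp add: outprob_def)
qed

lemma col_sum_W:
  assumes G: "G \<in> blockclass n s J H" and k: "k < J"
  shows "(\<Sum>v\<in>{J..<n}. ent G v k) = m * inprob H k"
  using row_sum_W[of "G\<inverse>" "H\<inverse>" k] G k by (simp add: inprob_converse)

lemma outprob_range:
  assumes G: "G \<in> blockclass n s J H" and i: "i < J"
  shows "0 \<le> outprob H i" "outprob H i \<le> 1"
proof -
  have "0 \<le> m * outprob H i" unfolding row_sum_W[OF G i, symmetric] by (simp add: sum_nonneg)
  then show "0 \<le> outprob H i" using m_pos by (simp add: zero_le_mult_iff)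
  have "(\<Sum>v\<in>{J..<n}. ent G i v) \<le> (\<Sum>v\<in>{J..<n}. 1)" by (rule sum_mono) simp
  then have "m * outprob H i \<le> m * 1" unfolding row_sum_W[OF G i] using card_W by simp
  then show "outprob H i \<le> 1" using m_pos by (simp only: mult_le_cancel_left_pos)
qed

lemma inprob_range:
  assumes "G \<in> blockclass n s J H" "k < J"
  shows "0 \<le> inprob H k" "inprob H k \<le> 1"
  using outprob_range[of "G\<inverse>" "H\<inverse>" k] assms by (simp_all add: inprob_converse)

lemma sum_outprob:
  assumes "H \<subseteq> {0..<J} \<times> {0..<J}"
  shows "(\<Sum>j<J. m * outprob H j) = real J * real s - real (card H)"
  using m_pos assms by (simp add: outprob_def sum_subtractf outdeg_ent card_ent)

lemma arcs_out_sum: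
  assumes G: "G \<in> blockclass n s J H"
  shows "(\<Sum>u\<in>{J..<n}. \<Sum>v\<in>{J..<n}. ent G u v) = arcs_out H"
proof -
  have "(\<Sum>u\<in>{J..<n}. ent G u v) = real s - (\<Sum>j<J. ent G j v)" if "v \<in> {J..<n}" for v
    using col_sum[OF G, of v] that unfolding sum_split_W by simp
  then have "(\<Sum>v\<in>{J..<n}. \<Sum>u\<in>{J..<n}. ent G u v) = (\<Sum>v\<in>{J..<n}. real s - (\<Sum>j<J. ent G j v))"
    by simp
  also have "\<dots> = m * real s - (\<Sum>v\<in>{J..<n}. \<Sum>j<J. ent G j v)"
    unfolding sum_subtractf sum_constant card_W ..
  also have "(\<Sum>v\<in>{J..<n}. \<Sum>j<J. ent G j v) = (\<Sum>j<J. \<Sum>v\<in>{J..<n}. ent G j v)"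
    by (rule sum.swap)
  also have "\<dots> = (\<Sum>j<J. m * outprob H j)"
    by (intro sum.cong refl row_sum_W[OF G]) simp
  also have "\<dots> = real J * real s - real (card H)"
    using blockclass_subset[OF G] by (rule sum_outprob)
  finally show ?thesis by (subst sum.swap) (simp add: arcs_out_def)
qed

text \<open>Since the sums are constant on \<Omega>, the difference products add up to exactly 2m
  times the deviation to be bounded. There are m^2 pairs, which gives
  \<open>m * c / 2\<close>.\<close>

lemma pair_mean_bound:
  fixes a b :: "(nat \<times> nat) set \<Rightarrow> nat \<Rightarrow> real"
  assumes a: "\<And>G. G \<in> \<Omega> \<Longrightarrow> (\<Sum>v\<in>{J..<n}. a G v) = m * \<alpha>"
    and b: "\<And>G. G \<in> \<Omega> \<Longrightarrow> (\<Sum>v\<in>{J..<n}. b G v) = m * \<beta>"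
    and cov: "\<And>v w. v \<in> {J..<n} \<Longrightarrow> w \<in> {J..<n} \<Longrightarrow> v \<noteq> w \<Longrightarrow>
       \<bar>\<Sum>G\<in>\<Omega>. (a G v - a G w) * (b G v - b G w)\<bar> \<le> c"
    and c: "c \<ge> 0"
  shows "\<bar>(\<Sum>G\<in>\<Omega>. \<Sum>v\<in>{J..<n}. a G v * b G v) - real (card \<Omega>) * (m * \<alpha> * \<beta>)\<bar> \<le> m * c / 2"
proof -
  let ?W = "{J..<n}"
  define P where "P = (\<Sum>G\<in>\<Omega>. \<Sum>v\<in>?W. a G v * b G v) - real (card \<Omega>) * (m * \<alpha> * \<beta>)"
  have "(\<Sum>G\<in>\<Omega>. \<Sum>v\<in>?W. \<Sum>w\<in>?W. (a G v - a G w) * (b G v - b G w))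
     = (\<Sum>G\<in>\<Omega>. 2 * m * (\<Sum>v\<in>?W. a G v * b G v) - 2 * (m * \<alpha>) * (m * \<beta>))"
    using a b by (intro sum.cong refl) (simp add: sum_pair_differences m_nat)
  also have "\<dots> = 2 * m * P"
    unfolding sum_subtractf P_def by (simp add: sum_distrib_left algebra_simps)
  finally have "2 * m * \<bar>P\<bar> = \<bar>\<Sum>G\<in>\<Omega>. \<Sum>v\<in>?W. \<Sum>w\<in>?W. (a G v - a G w) * (b G v - b G w)\<bar>"
    using m_pos by (simp add: abs_mult)
  also have "\<dots> \<le> (\<Sum>v\<in>?W. \<Sum>w\<in>?W. c)"
  proof (intro sum_abs_swap_bound)
    fix v w assume "v \<in> ?W" "w \<in> ?W"
    then show "\<bar>\<Sum>G\<in>\<Omega>. (a G v - a G w) * (b G v - b G w)\<bar> \<le> c"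
      using cov[of v w] c by (cases "v = w") auto
  qed
  also have "\<dots> = m * m * c" unfolding sum_constant card_W by simp
  finally have "2 * m * \<bar>P\<bar> \<le> 2 * m * (m * c / 2)" by simp
  then have "\<bar>P\<bar> \<le> m * c / 2" using m_pos by (simp only: mult_le_cancel_left_pos)
  then show ?thesis by (simp only: P_def)
qed

lemma codegree_mean:
  assumes "i < J" "j < J" "i \<noteq> j"
  shows "\<bar>(\<Sum>G\<in>blockclass n s J H. \<Sum>v\<in>{J..<n}. ent G i v * ent G j v)
      - real (card (blockclass n s J H)) * (m * outprob H i * outprob H j)\<bar>
    \<le> 2 * m * \<delta> * real (card (blockclass n s J H))"
proof -
  have "\<bar>(\<Sum>G\<in>blockclass n s J H. \<Sum>v\<in>{J..<n}. ent G i v * ent G j v)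
      - real (card (blockclass n s J H)) * (m * outprob H i * outprob H j)\<bar>
    \<le> m * (4 * \<delta> * real (card (blockclass n s J H))) / 2"
    by (rule pair_mean_bound) (use assms row_sum_W same_column_cov \<delta>_nonneg in auto)
  then show ?thesis by (simp add: mult_ac)
qed

lemma through_vertex_mean:
  assumes "i < J" "k < J"
  shows "\<bar>(\<Sum>G\<in>blockclass n s J H. \<Sum>v\<in>{J..<n}. ent G i v * ent G v k)
      - real (card (blockclass n s J H)) * (m * outprob H i * inprob H k)\<bar>
    \<le> 2 * m * \<delta> * real (card (blockclass n s J H))"
proof -
  have "\<bar>(\<Sum>G\<in>blockclass n s J H. \<Sum>v\<in>{J..<n}. ent G i v * ent G v k)
      - real (card (blockclass n s J H)) * (m * outprob H i * inprob H k)\<bar>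
    \<le> m * (4 * \<delta> * real (card (blockclass n s J H))) / 2"
    by (rule pair_mean_bound) (use assms row_sum_W col_sum_W row_column_cov \<delta>_nonneg in auto)
  then show ?thesis by (simp add: mult_ac)
qed

text \<open>In an outer column the entries outside the block sum to \<open>s\<close> minus those
  inside, so the count reduces to the codegrees of \<open>i\<close> with the vertices
  \<open>j < J\<close>. For \<open>j = i\<close> the codegree is exactly
  \<open>m * outprob H i\<close>, because entries are idempotent; this produces the correction term.
  Each other \<open>j\<close> contributes one codegree error.\<close>

lemma out_cherry_mean:
  assumes i: "i < J"
  shows "\<bar>(\<Sum>G\<in>blockclass n s J H. \<Sum>u\<in>{J..<n}. \<Sum>v\<in>{J..<n}. ent G i v * ent G u v)
      - real (card (blockclass n s J H)) *
         (outprob H i * arcs_out H - m * outprob H i * (1 - outprob H i))\<bar>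
    \<le> 2 * real J * m * \<delta> * real (card (blockclass n s J H))"
proof (cases "blockclass n s J H = {}")
  case False
  let ?\<Omega> = "blockclass n s J H"
  let ?W = "{J..<n}"
  define C where "C = real (card ?\<Omega>)"
  define P where "P = outprob H i"
  obtain G0 where G0: "G0 \<in> ?\<Omega>" using False by blast
  define D where "D = (\<lambda>j. (\<Sum>G\<in>?\<Omega>. \<Sum>v\<in>?W. ent G i v * ent G j v) - C * (m * P * outprob H j))"
  have pt: "(\<Sum>u\<in>?W. \<Sum>v\<in>?W. ent G i v * ent G u v) =
     m * P * (real s - 1) - (\<Sum>j\<in>{..<J} - {i}. \<Sum>v\<in>?W. ent G i v * ent G j v)" if G: "G \<in> ?\<Omega>" for G
  proof -
    have "(\<Sum>u\<in>?W. \<Sum>v\<in>?W. ent G i v * ent G u v) = (\<Sum>v\<in>?W. ent G i v * (\<Sum>u\<in>?W. ent G u v))"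
      by (subst sum.swap) (simp add: sum_distrib_left)
    also have "\<dots> = (\<Sum>v\<in>?W. ent G i v * (real s - (\<Sum>j<J. ent G j v)))"
    proof (intro sum.cong refl)
      fix v assume "v \<in> ?W"
      then have "(\<Sum>u\<in>?W. ent G u v) = real s - (\<Sum>j<J. ent G j v)"
        using col_sum[OF G, of v] unfolding sum_split_W by simp
      then show "ent G i v * (\<Sum>u\<in>?W. ent G u v) = ent G i v * (real s - (\<Sum>j<J. ent G j v))"
        by simp
    qed
    also have "\<dots> = (\<Sum>v\<in>?W. ent G i v) * real s - (\<Sum>j<J. \<Sum>v\<in>?W. ent G i v * ent G j v)"
      by (subst sum.swap) (simp add: right_diff_distrib sum_subtractf sum_distrib_left sum_distrib_right)
    also have "(\<Sum>j<J. \<Sum>v\<in>?W. ent G i v * ent G j v) =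
       (\<Sum>v\<in>?W. ent G i v * ent G i v) + (\<Sum>j\<in>{..<J} - {i}. \<Sum>v\<in>?W. ent G i v * ent G j v)"
      using i by (subst sum.remove[of _ i]) auto
    finally show ?thesis using row_sum_W[OF G i] by (simp add: P_def algebra_simps)
  qed
  have "(\<Sum>G\<in>?\<Omega>. \<Sum>u\<in>?W. \<Sum>v\<in>?W. ent G i v * ent G u v) =
     C * (m * P * (real s - 1)) - (\<Sum>G\<in>?\<Omega>. \<Sum>j\<in>{..<J} - {i}. \<Sum>v\<in>?W. ent G i v * ent G j v)"
    using pt by (simp add: sum_subtractf C_def)
  also have "(\<Sum>G\<in>?\<Omega>. \<Sum>j\<in>{..<J} - {i}. \<Sum>v\<in>?W. ent G i v * ent G j v)
     = (\<Sum>j\<in>{..<J} - {i}. D j + C * P * (m * outprob H j))"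
    by (subst sum.swap) (simp add: D_def algebra_simps)
  also have "\<dots> = (\<Sum>j\<in>{..<J} - {i}. D j) + C * P * (\<Sum>j\<in>{..<J} - {i}. m * outprob H j)"
    unfolding sum.distrib sum_distrib_left ..
  also have "(\<Sum>j\<in>{..<J} - {i}. m * outprob H j) = real J * real s - real (card H) - m * P"
    using sum_outprob[OF blockclass_subset[OF G0]] i
    by (subst (asm) sum.remove[of _ i]) (auto simp: P_def)
  finally have "(\<Sum>G\<in>?\<Omega>. \<Sum>u\<in>?W. \<Sum>v\<in>?W. ent G i v * ent G u v)
      - C * (P * arcs_out H - m * P * (1 - P)) = - (\<Sum>j\<in>{..<J} - {i}. D j)"
    by (simp add: arcs_out_def algebra_simps)
  then have "\<bar>(\<Sum>G\<in>?\<Omega>. \<Sum>u\<in>?W. \<Sum>v\<in>?W. ent G i v * ent G u v)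
      - C * (P * arcs_out H - m * P * (1 - P))\<bar> = \<bar>\<Sum>j\<in>{..<J} - {i}. D j\<bar>" by simp
  also have "\<dots> \<le> (\<Sum>j\<in>{..<J} - {i}. \<bar>D j\<bar>)" by (rule sum_abs)
  also have "\<dots> \<le> (\<Sum>j\<in>{..<J} - {i}. 2 * m * \<delta> * C)"
    by (intro sum_mono) (use i codegree_mean[of i _ H] in \<open>auto simp: D_def C_def P_def\<close>)
  also have "\<dots> = real (card ({..<J} - {i})) * (2 * m * \<delta> * C)" by simp
  also have "\<dots> \<le> real J * (2 * m * \<delta> * C)"
    using \<delta>_nonneg m_pos card_Diff1_le[of "{..<J}" i] by (intro mult_right_mono) (auto simp: C_def)
  finally show ?thesis by (simp add: C_def P_def mult_ac)
qed simp

lemma in_cherry_mean: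
  assumes k: "k < J"
  shows "\<bar>(\<Sum>G\<in>blockclass n s J H. \<Sum>u\<in>{J..<n}. \<Sum>v\<in>{J..<n}. ent G u k * ent G u v)
      - real (card (blockclass n s J H)) *
         (inprob H k * arcs_out H - m * inprob H k * (1 - inprob H k))\<bar>
    \<le> 2 * real J * m * \<delta> * real (card (blockclass n s J H))"
proof -
  have "(\<Sum>G\<in>blockclass n s J (H\<inverse>). \<Sum>u\<in>{J..<n}. \<Sum>v\<in>{J..<n}. ent G k v * ent G u v)
      = (\<Sum>G\<in>blockclass n s J H. \<Sum>u\<in>{J..<n}. \<Sum>v\<in>{J..<n}. ent G u k * ent G u v)"
    unfolding sum_blockclass_converse ent_converse by (intro sum.cong refl sum.swap)
  then show ?thesis
    using out_cherry_mean[OF k, of "H\<inverse>"]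
    by (simp add: card_blockclass_converse arcs_out_converse inprob_converse)
qed

text \<open>The double difference identity is divided by 4m^2. The m^4 quadruples without
  coincidence contribute 32 \<delta>^2 each, and the at most 4m^3 coincidences between {u, u'} and
  {v, w} contribute 8 \<delta> each. The cherry counts stay in the statement and are estimated
  separately.\<close>

lemma path_mean:
  assumes ik: "i < J" "k < J"
  defines "\<Omega> \<equiv> \<lambda>H. blockclass n s J H"
  shows "\<bar>(\<Sum>G\<in>\<Omega> H. \<Sum>u\<in>{J..<n}. \<Sum>v\<in>{J..<n}. ent G i v * ent G u k * ent G u v)
      - outprob H i * (\<Sum>G\<in>\<Omega> H. \<Sum>u\<in>{J..<n}. \<Sum>v\<in>{J..<n}. ent G u k * ent G u v)
      - inprob H k * (\<Sum>G\<in>\<Omega> H. \<Sum>u\<in>{J..<n}. \<Sum>v\<in>{J..<n}. ent G i v * ent G u v)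
      + real (card (\<Omega> H)) * (outprob H i * inprob H k * arcs_out H)\<bar>
    \<le> (8 * m\<^sup>2 * \<delta>\<^sup>2 + 8 * m * \<delta>) * real (card (\<Omega> H))" (is "\<bar>?Q\<bar> \<le> _")
proof -
  let ?\<Omega> = "blockclass n s J H"
  let ?W = "{J..<n}"
  define C where "C = real (card ?\<Omega>)"
  define t where "t = (\<lambda>G v w u u'. (ent G i v - ent G i w) * ((ent G u k - ent G u' k) *
     (ent G u v - ent G u w - (ent G u' v - ent G u' w))))"
  define g where "g = (\<lambda>v w u u' :: nat. 32 * \<delta>\<^sup>2 * C + 8 * \<delta> * C * (of_bool (u = v) + of_bool (u = w)
      + of_bool (u' = v) + of_bool (u' = w)))"
  have C0: "C \<ge> 0" by (simp add: C_def)
  have "(\<Sum>G\<in>?\<Omega>. \<Sum>v\<in>?W. \<Sum>w\<in>?W. \<Sum>u\<in>?W. \<Sum>u'\<in>?W. t G v w u u') =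
    (\<Sum>G\<in>?\<Omega>. 4 * m\<^sup>2 * ((\<Sum>u\<in>?W. \<Sum>v\<in>?W. ent G i v * ent G u k * ent G u v)
      - outprob H i * (\<Sum>u\<in>?W. \<Sum>v\<in>?W. ent G u k * ent G u v)
      - inprob H k * (\<Sum>u\<in>?W. \<Sum>v\<in>?W. ent G i v * ent G u v)
      + outprob H i * inprob H k * arcs_out H))"
  proof (rule sum.cong)
    fix G assume G: "G \<in> ?\<Omega>"
    show "(\<Sum>v\<in>?W. \<Sum>w\<in>?W. \<Sum>u\<in>?W. \<Sum>u'\<in>?W. t G v w u u') =
      4 * m\<^sup>2 * ((\<Sum>u\<in>?W. \<Sum>v\<in>?W. ent G i v * ent G u k * ent G u v)
      - outprob H i * (\<Sum>u\<in>?W. \<Sum>v\<in>?W. ent G u k * ent G u v)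
      - inprob H k * (\<Sum>u\<in>?W. \<Sum>v\<in>?W. ent G i v * ent G u v)
      + outprob H i * inprob H k * arcs_out H)"
      unfolding t_def
      by (subst sum_double_differences[of _ m])
         (simp_all add: m_nat row_sum_W[OF G ik(1)] col_sum_W[OF G ik(2)] arcs_out_sum[OF G]
            power2_eq_square algebra_simps)
  qed simp
  also have "\<dots> = 4 * m\<^sup>2 * ?Q"
    unfolding \<Omega>_def by (rule sum_affine_combination)
  finally have "4 * m\<^sup>2 * \<bar>?Q\<bar> = \<bar>\<Sum>G\<in>?\<Omega>. \<Sum>v\<in>?W. \<Sum>w\<in>?W. \<Sum>u\<in>?W. \<Sum>u'\<in>?W. t G v w u u'\<bar>"
    by (simp add: abs_mult)
  also have "\<dots> \<le> (\<Sum>v\<in>?W. \<Sum>w\<in>?W. \<Sum>u\<in>?W. \<Sum>u'\<in>?W. g v w u u')"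
  proof (intro sum_abs_swap_bound)
    fix v w u u' assume W: "v \<in> ?W" "w \<in> ?W" "u \<in> ?W" "u' \<in> ?W"
    have g0: "0 \<le> g v w u u'" using \<delta>_nonneg C0 by (simp add: g_def)
    consider "v = w \<or> u = u'" | "v \<noteq> w" "u \<noteq> u'" "{u, u'} \<inter> {v, w} = {}"
      | "v \<noteq> w" "{u, u'} \<inter> {v, w} \<noteq> {}" by blast
    then show "\<bar>\<Sum>G\<in>?\<Omega>. t G v w u u'\<bar> \<le> g v w u u'"
    proof cases
      case 1
      then have "t G v w u u' = 0" for G unfolding t_def by auto
      then show ?thesis using g0 by simp
    next
      case 2
      then have "\<bar>\<Sum>G\<in>?\<Omega>. t G v w u u'\<bar> \<le> 32 * \<delta>\<^sup>2 * C"
        unfolding t_def C_def using W ik by (intro path_cov_distinct) auto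
      also have "\<dots> \<le> g v w u u'" using \<delta>_nonneg C0 by (simp add: g_def)
      finally show ?thesis .
    next
      case 3
      then have "\<bar>\<Sum>G\<in>?\<Omega>. t G v w u u'\<bar> \<le> 8 * \<delta> * C"
        unfolding t_def C_def using W ik by (intro path_cov) auto
      also have "\<dots> \<le> 8 * \<delta> * C * (of_bool (u = v) + of_bool (u = w) + of_bool (u' = v) + of_bool (u' = w))"
      proof -
        have "(1::real) \<le> of_bool (u = v) + of_bool (u = w) + of_bool (u' = v) + of_bool (u' = w)"
          using 3(2) by auto
        then have "8 * \<delta> * C * 1 \<le> 8 * \<delta> * C * (of_bool (u = v) + of_bool (u = w) + of_bool (u' = v) + of_bool (u' = w))"
          using \<delta>_nonneg C0 by (intro mult_left_mono) auto
        then show ?thesis by simp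
      qed
      also have "\<dots> \<le> g v w u u'" using \<delta>_nonneg C0 by (simp add: g_def)
      finally show ?thesis .
    qed
  qed
  also have "\<dots> = 4 * m\<^sup>2 * ((8 * m\<^sup>2 * \<delta>\<^sup>2 + 8 * m * \<delta>) * C)"
    by (simp add: g_def sum.distrib m_nat power2_eq_square algebra_simps flip: sum_distrib_left)
  finally have "\<bar>?Q\<bar> \<le> (8 * m\<^sup>2 * \<delta>\<^sup>2 + 8 * m * \<delta>) * C"
    using m_pos by (subst (asm) mult_le_cancel_left_pos) auto
  then show ?thesis by (simp only: C_def \<Omega>_def)
qed

end

section \<open>Ratio of class sizes\<close>

lemma outdeg_insert:
  assumes "(i, k) \<notin> H" "finite H"
  shows "outdeg (insert (i, k) H) j = outdeg H j + of_bool (j = i)"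
proof -
  have fin: "finite {w. (j, w) \<in> H}"
    by (rule finite_subset[of _ "snd ` H"]) (use assms in force)+
  have "{w. (j, w) \<in> insert (i, k) H} = (if j = i then insert k {w. (j, w) \<in> H} else {w. (j, w) \<in> H})"
    by auto
  then show ?thesis using fin assms by (auto simp: outdeg_def)
qed

lemma indeg_insert:
  assumes "(i, k) \<notin> H" "finite H"
  shows "indeg (insert (i, k) H) j = indeg H j + of_bool (j = k)"
proof -
  have "(insert (i, k) H)\<inverse> = insert (k, i) (H\<inverse>)" by auto
  then show ?thesis
    using outdeg_insert[of k i "H\<inverse>" j] assms by (simp flip: outdeg_converse(1))
qed

context dense_block
begin

text \<open>Pairs (u, v) for which toggling inserts the arc (i, k); \<open>v = u\<close> is excluded
  because (u, v) becomes an arc.\<close>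

definition fwd_switches :: "(nat \<times> nat) set \<Rightarrow> nat \<Rightarrow> nat \<Rightarrow> real" where
  "fwd_switches G i k = (\<Sum>u\<in>{J..<n}. \<Sum>v\<in>{J..<n} - {u}. ent G i v * ent G u k * (1 - ent G u v))"

definition bwd_switches :: "(nat \<times> nat) set \<Rightarrow> nat \<Rightarrow> nat \<Rightarrow> real" where
  "bwd_switches G i k = (\<Sum>u\<in>{J..<n}. \<Sum>v\<in>{J..<n} - {u}. (1 - ent G i v) * (1 - ent G u k) * ent G u v)"

lemma toggle_adds_arc:
  assumes G: "G \<in> regular_digraphs n s" and ik: "i < J" "k < J" "i \<noteq> k"
    and uv: "u \<in> {J..<n}" "v \<in> {J..<n}" "u \<noteq> v"
    and e: "ent G i v + ent G i k = 1" "ent G u v + ent G u k = 1" "ent G i v + ent G u v = 1"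
  shows "toggle G i u v k \<in> regular_digraphs n s"
    and "induced (toggle G i u v k) J = sym_diff (induced G J) {(i, k)}"
proof -
  show "toggle G i u v k \<in> regular_digraphs n s"
    by (rule toggle_regular) (use G ik uv e J_le in auto)
  show "induced (toggle G i u v k) J = sym_diff (induced G J) {(i, k)}"
    using ik uv by (auto simp: induced_def toggle_def)
qed

text \<open>For each pair (u, v) the toggle, being an involution, is a bijection between the
  configurations counted on the two sides. The entry at (i, k) need not appear in the counts, since
  the class determines it.\<close>

lemma switch_double_count:
  assumes ik: "i < J" "k < J" "i \<noteq> k" and H: "(i, k) \<notin> H"
  shows "(\<Sum>G\<in>blockclass n s J H. fwd_switches G i k) =
    (\<Sum>G\<in>blockclass n s J (insert (i, k) H). bwd_switches G i k)"
proof -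
  let ?A = "blockclass n s J H" and ?B = "blockclass n s J (insert (i, k) H)"
  have one: "(\<Sum>G\<in>?A. ent G i v * ent G u k * (1 - ent G u v)) =
    (\<Sum>G\<in>?B. (1 - ent G i v) * (1 - ent G u k) * ent G u v)"
    if u: "u \<in> {J..<n}" and v: "v \<in> {J..<n} - {u}" for u v
  proof (rule sum.reindex_bij_witness_not_neutral[where j = "\<lambda>G. toggle G i u v k" and i = "\<lambda>G. toggle G i u v k"
        and S' = "{G \<in> ?A. ent G i v * ent G u k * (1 - ent G u v) = 0}"
        and T' = "{G \<in> ?B. (1 - ent G i v) * (1 - ent G u k) * ent G u v = 0}"])
    have e: "ent (toggle G i u v k) i v = 1 - ent G i v" "ent (toggle G i u v k) u k = 1 - ent G u k"
      "ent (toggle G i u v k) u v = 1 - ent G u v" for G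
      by (simp_all add: ent_toggle)
    fix G
    assume G: "G \<in> ?A - {G \<in> ?A. ent G i v * ent G u k * (1 - ent G u v) = 0}"
    then have GA: "G \<in> ?A" by simp
    have 1: "ent G i v = 1" "ent G u k = 1" "ent G u v = 0"
      using G ent_01[of G i v] ent_01[of G u k] ent_01[of G u v] by auto
    moreover have "ent G i k = 0"
      using ent_block[OF GA ik(1,2)] H by (simp add: ent_def)
    ultimately have "toggle G i u v k \<in> ?B"
      using toggle_adds_arc[of G i k u v] GA u v ik H by (auto simp: blockclass_def)
    then show "toggle G i u v k \<in> ?B - {G \<in> ?B. (1 - ent G i v) * (1 - ent G u k) * ent G u v = 0}"
      using 1 by (simp add: e)
  next
    have e: "ent (toggle G i u v k) i v = 1 - ent G i v" "ent (toggle G i u v k) u k = 1 - ent G u k"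
      "ent (toggle G i u v k) u v = 1 - ent G u v" for G
      by (simp_all add: ent_toggle)
    fix G
    assume G: "G \<in> ?B - {G \<in> ?B. (1 - ent G i v) * (1 - ent G u k) * ent G u v = 0}"
    then have GB: "G \<in> ?B" by simp
    have 1: "ent G i v = 0" "ent G u k = 0" "ent G u v = 1"
      using G ent_01[of G i v] ent_01[of G u k] ent_01[of G u v] by auto
    moreover have "ent G i k = 1"
      using ent_block[OF GB ik(1,2)] by (simp add: ent_def)
    ultimately have "toggle G i u v k \<in> ?A"
      using toggle_adds_arc[of G i k u v] GB u v ik H by (auto simp: blockclass_def)
    then show "toggle G i u v k \<in> ?A - {G \<in> ?A. ent G i v * ent G u k * (1 - ent G u v) = 0}"
      using 1 by (simp add: e)
  next
    fix G
    show "(1 - ent (toggle G i u v k) i v) * (1 - ent (toggle G i u v k) u k) * ent (toggle G i u v k) u v =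
      ent G i v * ent G u k * (1 - ent G u v)" by (simp add: ent_toggle)
  qed auto
  have "(\<Sum>G\<in>?A. fwd_switches G i k) = (\<Sum>u\<in>{J..<n}. \<Sum>v\<in>{J..<n} - {u}. \<Sum>G\<in>?A. ent G i v * ent G u k * (1 - ent G u v))"
    unfolding fwd_switches_def by (subst sum.swap, rule sum.cong, simp, rule sum.swap)
  also have "\<dots> = (\<Sum>u\<in>{J..<n}. \<Sum>v\<in>{J..<n} - {u}. \<Sum>G\<in>?B. (1 - ent G i v) * (1 - ent G u k) * ent G u v)"
    by (intro sum.cong refl one)
  also have "\<dots> = (\<Sum>G\<in>?B. bwd_switches G i k)"
    unfolding bwd_switches_def by (subst (2) sum.swap, rule sum.cong, simp, rule sum.swap)
  finally show ?thesis .
qed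

text \<open>Obtained by replacing every pattern count by its leading term. The summands
  \<open>m * (1 - outprob H i)\<close> and \<open>m * (1 - inprob H k)\<close> are the cherry
  corrections: if \<open>i\<close> already sends an arc to \<open>v\<close>, an outer arc into
  \<open>v\<close> is slightly less likely.\<close>

definition fwd_mean :: "(nat \<times> nat) set \<Rightarrow> nat \<Rightarrow> nat \<Rightarrow> real" where
  "fwd_mean H i k = outprob H i * inprob H k *
     (m\<^sup>2 - m - arcs_out H + m * (1 - outprob H i) + m * (1 - inprob H k))"

definition bwd_mean :: "(nat \<times> nat) set \<Rightarrow> nat \<Rightarrow> nat \<Rightarrow> real" where
  "bwd_mean H i k = (1 - outprob H i) * (1 - inprob H k) *
     (arcs_out H + m * outprob H i + m * inprob H k)"

text \<open>Budget per digraph: 8m^2 \<delta>^2 + 8m \<delta> for the paths, 2m \<delta> for the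
  vertices passed through, and room for four cherry errors 2Jm \<delta>. When m \<delta> is bounded
  this is O(J).\<close>

definition switch_error :: real where
  "switch_error = 8 * m\<^sup>2 * \<delta>\<^sup>2 + 10 * m * \<delta> + 8 * real J * m * \<delta>"

lemma switch_error_nonneg: "switch_error \<ge> 0"
  using m_pos \<delta>_nonneg by (simp add: switch_error_def)

lemma switch_means:
  assumes ik: "i < J" "k < J"
  shows fwd_switches_mean: "\<bar>(\<Sum>G\<in>blockclass n s J H. fwd_switches G i k)
      - real (card (blockclass n s J H)) * fwd_mean H i k\<bar> \<le> switch_error * real (card (blockclass n s J H))"
    and bwd_switches_mean: "\<bar>(\<Sum>G\<in>blockclass n s J H. bwd_switches G i k)
      - real (card (blockclass n s J H)) * bwd_mean H i k\<bar> \<le> switch_error * real (card (blockclass n s J H))"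
proof -
  let ?\<Omega> = "blockclass n s J H" and ?W = "{J..<n}"
  define C where "C = real (card ?\<Omega>)"
  define \<pi> where "\<pi> = outprob H i"
  define \<kappa> where "\<kappa> = inprob H k"
  define S where "S = arcs_out H"
  define V where "V = (\<Sum>G\<in>?\<Omega>. \<Sum>v\<in>?W. ent G i v * ent G v k)"
  define P1 where "P1 = (\<Sum>G\<in>?\<Omega>. \<Sum>u\<in>?W. \<Sum>v\<in>?W. ent G i v * ent G u v)"
  define P2 where "P2 = (\<Sum>G\<in>?\<Omega>. \<Sum>u\<in>?W. \<Sum>v\<in>?W. ent G u k * ent G u v)"
  define T where "T = (\<Sum>G\<in>?\<Omega>. \<Sum>u\<in>?W. \<Sum>v\<in>?W. ent G i v * ent G u k * ent G u v)"
  define F where "F = (\<Sum>G\<in>?\<Omega>. fwd_switches G i k)"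
  define B where "B = (\<Sum>G\<in>?\<Omega>. bwd_switches G i k)"
  have Fpt: "fwd_switches G i k = (m * \<pi>) * (m * \<kappa>) - (\<Sum>v\<in>?W. ent G i v * ent G v k)
      - (\<Sum>u\<in>?W. \<Sum>v\<in>?W. ent G i v * ent G u k * ent G u v)" if G: "G \<in> ?\<Omega>" for G
  proof -
    \<comment> \<open>The omitted term \<open>v = u\<close> equals
      \<open>ent G i u * ent G u k\<close>, because the diagonal entry is 0. It is the source of the
      through-vertex count \<open>V\<close>.\<close>
    have "fwd_switches G i k = (\<Sum>u\<in>?W. (\<Sum>v\<in>?W. ent G i v * ent G u k * (1 - ent G u v)) - ent G i u * ent G u k)"
      unfolding fwd_switches_def by (intro sum.cong refl) (simp add: sum_diff1 ent_diag[OF G])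
    also have "\<dots> = (\<Sum>u\<in>?W. \<Sum>v\<in>?W. ent G i v * ent G u k) - (\<Sum>u\<in>?W. \<Sum>v\<in>?W. ent G i v * ent G u k * ent G u v)
        - (\<Sum>u\<in>?W. ent G i u * ent G u k)"
      by (simp add: sum_subtractf right_diff_distrib)
    also have "(\<Sum>u\<in>?W. \<Sum>v\<in>?W. ent G i v * ent G u k) = (\<Sum>v\<in>?W. ent G i v) * (\<Sum>u\<in>?W. ent G u k)"
      by (subst sum.swap) (simp add: sum_product)
    finally show ?thesis
      by (simp add: row_sum_W[OF G ik(1)] col_sum_W[OF G ik(2)] \<pi>_def \<kappa>_def)
  qed
  have Bpt: "bwd_switches G i k = S - (\<Sum>u\<in>?W. \<Sum>v\<in>?W. ent G i v * ent G u v)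
      - (\<Sum>u\<in>?W. \<Sum>v\<in>?W. ent G u k * ent G u v)
      + (\<Sum>u\<in>?W. \<Sum>v\<in>?W. ent G i v * ent G u k * ent G u v)" if G: "G \<in> ?\<Omega>" for G
  proof -
    have "bwd_switches G i k = (\<Sum>u\<in>?W. \<Sum>v\<in>?W. (1 - ent G i v) * (1 - ent G u k) * ent G u v)"
      unfolding bwd_switches_def by (rule sum.cong[OF refl]) (simp add: sum_diff1 ent_diag[OF G])
    also have "\<dots> = (\<Sum>u\<in>?W. \<Sum>v\<in>?W. ent G u v - ent G i v * ent G u v - ent G u k * ent G u v
         + ent G i v * ent G u k * ent G u v)"
      by (intro sum.cong refl) (simp add: algebra_simps)
    finally show ?thesis
      by (simp add: sum.distrib sum_subtractf S_def arcs_out_sum[OF G])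
  qed
  have Feq: "F = C * ((m * \<pi>) * (m * \<kappa>)) - V - T"
    unfolding F_def V_def T_def C_def using Fpt by (simp add: sum_subtractf)
  have Beq: "B = C * S - P1 - P2 + T"
    unfolding B_def P1_def P2_def T_def C_def using Bpt by (simp add: sum_subtractf sum.distrib)
  define e1 where "e1 = (8 * m\<^sup>2 * \<delta>\<^sup>2 + 8 * m * \<delta>) * C"
  define e2 where "e2 = 2 * real J * m * \<delta> * C"
  define e3 where "e3 = 2 * m * \<delta> * C"
  define q where "q = T - \<pi> * P2 - \<kappa> * P1 + C * (\<pi> * \<kappa> * S)"
  define d1 where "d1 = P1 - C * (\<pi> * S - m * \<pi> * (1 - \<pi>))"
  define d2 where "d2 = P2 - C * (\<kappa> * S - m * \<kappa> * (1 - \<kappa>))"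
  define d3 where "d3 = V - C * (m * \<pi> * \<kappa>)"
  have q: "\<bar>q\<bar> \<le> e1"
    unfolding q_def e1_def T_def P1_def P2_def C_def \<pi>_def \<kappa>_def S_def by (rule path_mean[OF ik])
  have d1: "\<bar>d1\<bar> \<le> e2" unfolding d1_def e2_def P1_def C_def \<pi>_def S_def by (rule out_cherry_mean[OF ik(1)])
  have d2: "\<bar>d2\<bar> \<le> e2" unfolding d2_def e2_def P2_def C_def \<kappa>_def S_def by (rule in_cherry_mean[OF ik(2)])
  have d3: "\<bar>d3\<bar> \<le> e3" unfolding d3_def e3_def V_def C_def \<pi>_def \<kappa>_def by (rule through_vertex_mean[OF ik])
  have "\<bar>F - C * fwd_mean H i k\<bar> \<le> switch_error * C \<and> \<bar>B - C * bwd_mean H i k\<bar> \<le> switch_error * C"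
  proof (cases "?\<Omega> = {}")
    case True
    then show ?thesis by (simp add: F_def B_def C_def)
  next
    case False
    then obtain G where G: "G \<in> ?\<Omega>" by blast
    have \<pi>01: "0 \<le> \<pi>" "\<pi> \<le> 1" and \<kappa>01: "0 \<le> \<kappa>" "\<kappa> \<le> 1"
      using outprob_range[OF G ik(1)] inprob_range[OF G ik(2)] by (simp_all add: \<pi>_def \<kappa>_def)
    \<comment> \<open>The deviations enter with coefficients from the interval [0, 1], so the
      individual bounds may simply be added.\<close>
    have "F - C * fwd_mean H i k = - d3 - q - \<pi> * d2 - \<kappa> * d1"
      unfolding Feq d3_def q_def d1_def d2_def fwd_mean_def \<pi>_def[symmetric] \<kappa>_def[symmetric] S_def[symmetric]
      by (simp add: power2_eq_square algebra_simps)
    moreover have "B - C * bwd_mean H i k = q - (1 - \<kappa>) * d1 - (1 - \<pi>) * d2"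
      unfolding Beq q_def d1_def d2_def bwd_mean_def \<pi>_def[symmetric] \<kappa>_def[symmetric] S_def[symmetric]
      by (simp add: power2_eq_square algebra_simps)
    moreover have "\<bar>\<pi> * d2\<bar> \<le> e2" "\<bar>\<kappa> * d1\<bar> \<le> e2" "\<bar>(1 - \<kappa>) * d1\<bar> \<le> e2" "\<bar>(1 - \<pi>) * d2\<bar> \<le> e2"
    proof -
      have "\<bar>x * d\<bar> \<le> e2" if "0 \<le> x" "x \<le> 1" "\<bar>d\<bar> \<le> e2" for x d
        using mult_mono[OF that(2,3)] that(1) by (simp add: abs_mult)
      then show "\<bar>\<pi> * d2\<bar> \<le> e2" "\<bar>\<kappa> * d1\<bar> \<le> e2" "\<bar>(1 - \<kappa>) * d1\<bar> \<le> e2" "\<bar>(1 - \<pi>) * d2\<bar> \<le> e2"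
        using \<pi>01 \<kappa>01 d1 d2 by simp_all
    qed
    moreover have "switch_error * C = e1 + e3 + 4 * e2"
      by (simp add: switch_error_def e1_def e2_def e3_def algebra_simps)
    moreover have "0 \<le> e2" "0 \<le> e3" using d1 d3 by linarith+
    moreover have "\<bar>- a - b - c - d\<bar> \<le> A + B + D + E"
      if "\<bar>a\<bar> \<le> A" "\<bar>b\<bar> \<le> B" "\<bar>c\<bar> \<le> D" "\<bar>d\<bar> \<le> E" for a b c d A B D E :: real
      using that by linarith
    note this[OF d3 q, of "\<pi> * d2" e2 "\<kappa> * d1" e2]
    moreover have "\<bar>a - b - c\<bar> \<le> A + B + D" if "\<bar>a\<bar> \<le> A" "\<bar>b\<bar> \<le> B" "\<bar>c\<bar> \<le> D" for a b c A B D :: real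
      using that by linarith
    note this[OF q, of "(1 - \<kappa>) * d1" e2 "(1 - \<pi>) * d2" e2]
    ultimately show ?thesis by simp
  qed
  then show "\<bar>(\<Sum>G\<in>?\<Omega>. fwd_switches G i k) - real (card ?\<Omega>) * fwd_mean H i k\<bar> \<le> switch_error * real (card ?\<Omega>)"
    "\<bar>(\<Sum>G\<in>?\<Omega>. bwd_switches G i k) - real (card ?\<Omega>) * bwd_mean H i k\<bar> \<le> switch_error * real (card ?\<Omega>)"
    by (simp_all add: F_def B_def C_def)
qed

lemma blockclass_ratio:
  assumes ik: "i < J" "k < J" "i \<noteq> k" and H: "(i, k) \<notin> H"
  defines "H' \<equiv> insert (i, k) H"
  shows "real (card (blockclass n s J H)) * (fwd_mean H i k - switch_error)
      \<le> real (card (blockclass n s J H')) * (bwd_mean H' i k + switch_error)"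
    and "real (card (blockclass n s J H')) * (bwd_mean H' i k - switch_error)
      \<le> real (card (blockclass n s J H)) * (fwd_mean H i k + switch_error)"
  using fwd_switches_mean[OF ik(1,2), of H] bwd_switches_mean[OF ik(1,2), of H']
    switch_double_count[OF ik H]
  unfolding H'_def[symmetric] by (auto simp: algebra_simps abs_le_iff)

end

section \<open>Expansion of the ratio\<close>

text \<open>The derivative of the remainder is y^2/(1 + y), at most 2x^2 on the interval in
  question.\<close>

lemma ln_one_plus_third_order:
  fixes x :: real
  assumes x: "\<bar>x\<bar> \<le> 1/2"
  shows "\<bar>ln (1 + x) - x + x\<^sup>2 / 2\<bar> \<le> 2 * \<bar>x\<bar> ^ 3"
proof -
  define f where "f = (\<lambda>y::real. ln (1 + y) - y + y\<^sup>2 / 2)"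
  let ?S = "{- \<bar>x\<bar>..\<bar>x\<bar>}"
  have der: "(f has_field_derivative y\<^sup>2 / (1 + y)) (at y within ?S)" if "y \<in> ?S" for y
  proof -
    have "1 + y > 0" using that x by simp
    then show ?thesis
      unfolding f_def by (auto intro!: derivative_eq_intros simp: field_simps power2_eq_square)
  qed
  have "norm (f x - f 0) \<le> (2 * x\<^sup>2) * norm (x - 0)"
  proof (rule field_differentiable_bound[OF _ der])
    fix y assume y: "y \<in> ?S"
    then have y1: "1 + y \<ge> 1/2" using x by simp
    have "y\<^sup>2 \<le> x\<^sup>2" using y by (intro abs_le_square_iff[THEN iffD1]) auto
    then have "y\<^sup>2 / (1 + y) \<le> x\<^sup>2 / (1/2)" using y1 by (intro frac_le) auto
    then show "norm (y\<^sup>2 / (1 + y)) \<le> 2 * x\<^sup>2" using y1 by simp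
  qed auto
  then show ?thesis
    by (simp add: f_def power3_eq_cube power2_eq_square mult.assoc flip: abs_mult)
qed

text \<open>The degree deviations \<open>a1\<close>, ..., \<open>b2\<close> have first order in J/n
  and need their squares; \<open>z1\<close> and \<open>z2\<close> are already of second order, so a
  linear expansion of them suffices.\<close>

lemma ln_product_expansion:
  fixes a1 a2 b1 b2 z1 z2 t w :: real
  assumes a: "\<bar>a1\<bar> \<le> t" "\<bar>a2\<bar> \<le> t" "\<bar>b1\<bar> \<le> t" "\<bar>b2\<bar> \<le> t" and z: "\<bar>z1\<bar> \<le> w" "\<bar>z2\<bar> \<le> w"
    and t: "t \<le> 1/2" and w: "w \<le> 1/2"
  shows "\<bar>ln ((1 - a1) * (1 - b1) * (1 + z1)) - ln ((1 + a2) * (1 + b2) * (1 + z2))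
     - (- (a1 + a2 + b1 + b2) - (a1\<^sup>2 - a2\<^sup>2 + b1\<^sup>2 - b2\<^sup>2) / 2 + z1 - z2)\<bar> \<le> 8 * t ^ 3 + 4 * w\<^sup>2"
proof -
  have third: "\<bar>ln (1 + x) - x + x\<^sup>2 / 2\<bar> \<le> 2 * t ^ 3" if "\<bar>x\<bar> \<le> t" for x
  proof -
    have "\<bar>ln (1 + x) - x + x\<^sup>2 / 2\<bar> \<le> 2 * \<bar>x\<bar> ^ 3"
      using that t by (intro ln_one_plus_third_order) simp
    also have "\<dots> \<le> 2 * t ^ 3" using that by (simp add: power_mono)
    finally show ?thesis .
  qed
  have second: "\<bar>ln (1 + x) - x\<bar> \<le> 2 * w\<^sup>2" if "\<bar>x\<bar> \<le> w" for x
  proof -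
    have "\<bar>ln (1 + x) - x\<bar> \<le> 2 * x\<^sup>2"
      using that w by (intro abs_ln_one_plus_x_minus_x_bound) simp
    also have "\<dots> \<le> 2 * w\<^sup>2" using that by (metis abs_ge_zero mult_left_mono power2_abs power_mono zero_le_numeral)
    finally show ?thesis .
  qed
  have pos: "1 - a1 > 0" "1 - b1 > 0" "1 + z1 > 0" "1 + a2 > 0" "1 + b2 > 0" "1 + z2 > 0"
    using assms by linarith+
  have "ln ((1 - a1) * (1 - b1) * (1 + z1)) = ln (1 - a1) + ln (1 - b1) + ln (1 + z1)"
    "ln ((1 + a2) * (1 + b2) * (1 + z2)) = ln (1 + a2) + ln (1 + b2) + ln (1 + z2)"
    using pos by (simp_all add: ln_mult)
  moreover have "\<bar>ln (1 - a1) + a1 + a1\<^sup>2 / 2\<bar> \<le> 2 * t ^ 3" "\<bar>ln (1 - b1) + b1 + b1\<^sup>2 / 2\<bar> \<le> 2 * t ^ 3"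
    using third[of "- a1"] third[of "- b1"] a by simp_all
  moreover note third[OF a(2)] third[OF a(4)] second[OF z(1)] second[OF z(2)]
  ultimately show ?thesis by (simp add: field_simps abs_le_iff)
qed

lemma abs_mult_bound: "\<bar>x\<bar> \<le> a \<Longrightarrow> \<bar>y\<bar> \<le> b \<Longrightarrow> \<bar>x * y\<bar> \<le> a * b" for x y a b :: real
  unfolding abs_mult by (rule mult_mono) auto

text \<open>In units where \<open>n = 1\<close>: \<open>u\<close>, \<open>v\<close> are the degree deviations, \<open>c\<close> the deviation of the
  number of arcs, \<open>j = J / n\<close> and \<open>e = 1 / n\<close>.\<close>

lemma exponent_increment:
  fixes u v c j e p q l R :: real
  assumes uv: "\<bar>u\<bar> \<le> j" "\<bar>v\<bar> \<le> j" and c: "\<bar>c\<bar> \<le> j\<^sup>2" and e: "0 < e" "e \<le> j" and j: "j \<le> 1/2"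
    and pq: "q = 1 - p" "p - l = p * e" and R: "R \<ge> 2"
    and lower: "1 / R \<le> p" "1 / R \<le> q" "1 / R \<le> l" "1 / R \<le> 1 - l"
  defines "\<mu> \<equiv> 1 - j" and "sg \<equiv> l * (1 - l)"
  shows "\<bar>(- (u / (p * \<mu>) + (u + e) / (q * \<mu>) + v / (p * \<mu>) + (v + e) / (q * \<mu>))
      - ((u / (p * \<mu>))\<^sup>2 - ((u + e) / (q * \<mu>))\<^sup>2 + (v / (p * \<mu>))\<^sup>2 - ((v + e) / (q * \<mu>))\<^sup>2) / 2
      + (e / \<mu> - c / (q * \<mu>\<^sup>2) + (u + v) * e / (q * \<mu>\<^sup>2))
      - (e / \<mu> + (c - e\<^sup>2 - (u + v) * e) / (p * \<mu>\<^sup>2)))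
      - ((1 - 2 * l) * e / sg - c / sg - e\<^sup>2 / (2 * sg) - (1 + j) * (u + v + e) / sg
         - (1 - 2 * l) * (3 * u\<^sup>2 + 3 * u * e + e\<^sup>2 + 3 * v\<^sup>2 + 3 * v * e + e\<^sup>2) / (6 * sg\<^sup>2))\<bar>
    \<le> 70 * R ^ 6 * (j * e + j ^ 3)" (is "\<bar>?L - ?D\<bar> \<le> _")
proof -
  define P where "P = 1 / p"
  define Q where "Q = 1 / q"
  define M where "M = 1 / \<mu>"
  define S where "S = 1 / sg"
  define X where "X = j * e + j ^ 3"
  have Rp: "1 / R > 0" using R by simp
  have pos: "p > 0" "q > 0" "l > 0" "1 - l > 0" using lower Rp by linarith+
  have le1: "p \<le> 1" "q \<le> 1" "l \<le> 1" using pos pq by linarith+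
  have j0: "j > 0" using e by linarith
  have \<mu>: "\<mu> \<ge> 1/2" "\<mu> \<le> 1" using j j0 by (simp_all add: \<mu>_def)
  have P: "0 \<le> P" "P \<le> R" and Q: "0 \<le> Q" "Q \<le> R" and L1: "1 / (1 - l) \<le> R" and L2: "1 / l \<le> R"
    using lower pos R by (auto simp: P_def Q_def field_simps)
  have sg: "sg > 0" using pos by (simp add: sg_def)
  have S: "0 \<le> S" "S \<le> R\<^sup>2"
  proof -
    show "0 \<le> S" using sg by (simp add: S_def)
    have "1 / l * (1 / (1 - l)) \<le> R * R" using L1 L2 pos R by (intro mult_mono) auto
    then show "S \<le> R\<^sup>2" by (simp add: S_def sg_def power2_eq_square)
  qed
  \<comment> \<open>Since p + q = 1. The sum merges the coefficients of the linear terms, and the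
    product of both identities gives 1/p^2 - 1/q^2, the coefficient of the squares.\<close>
  have PQ: "P + Q = P * Q" "P - Q = (1 - 2 * p) * (P * Q)"
    using pos pq(1) by (simp_all add: P_def Q_def field_simps)
  have PQR: "0 \<le> P * Q" "P * Q \<le> R\<^sup>2"
    using P Q R by (simp_all add: power2_eq_square mult_mono)
  have M: "0 \<le> M" "M \<le> 2" using \<mu> by (simp_all add: M_def field_simps)
  have M1: "1 - M = - j * M" "1 + j - M = - (j\<^sup>2) * M"
    using \<mu> by (simp_all add: M_def \<mu>_def field_simps power2_eq_square)
  have R2: "R \<le> R\<^sup>2" using R by (simp add: power2_eq_square)
  have R26: "R ^ 2 \<le> R ^ 6" and R46: "R ^ 4 \<le> R ^ 6" and R06: "0 \<le> R ^ 6" "1 \<le> R ^ 6" "R \<le> R ^ 6"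
    using R by (auto intro: power_increasing self_le_power one_le_power)
  have je: "0 \<le> j * e" "e\<^sup>2 \<le> j * e" "0 \<le> j ^ 3" "j * e \<le> X" "j ^ 3 \<le> X" "0 \<le> X"
    using e j0 by (simp_all add: X_def power2_eq_square mult_right_mono)
  have j2e: "j\<^sup>2 * e \<le> j * e" using j j0 e by (simp add: power2_eq_square mult_right_mono mult_left_le_one_le)
  have Sdiff: "\<bar>S - P * Q\<bar> \<le> e * R ^ 4"
  proof -
    have "S - P * Q = (p * q - sg) * (S * (P * Q))"
      using pos sg by (simp add: S_def P_def Q_def field_simps)
    also have "p * q - sg = (p - l) * (1 - p - l)" by (simp add: sg_def pq(1) algebra_simps)
    finally have "\<bar>S - P * Q\<bar> = \<bar>p * e * (1 - p - l)\<bar> * (S * (P * Q))"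
      using S P Q by (simp add: abs_mult pq(2))
    also have "\<dots> \<le> (1 * e * 1) * (R\<^sup>2 * R\<^sup>2)"
    proof (rule mult_mono)
      have "\<bar>1 - p - l\<bar> \<le> 1" using pos le1 by linarith
      moreover have "\<bar>p * e\<bar> \<le> 1 * e" using pos le1 e by (simp add: abs_mult)
      ultimately show "\<bar>p * e * (1 - p - l)\<bar> \<le> 1 * e * 1" by (rule abs_mult_bound[rotated])
      show "S * (P * Q) \<le> R\<^sup>2 * R\<^sup>2" using S PQR by (intro mult_mono) auto
    qed (use e S PQR in auto)
    finally show ?thesis by (simp flip: power_add)
  qed
  have M2: "\<bar>1 - M\<^sup>2\<bar> \<le> 6 * j"
  proof -
    have "1 - M\<^sup>2 = (1 - M) * (1 + M)" by (simp add: power2_eq_square algebra_simps)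
    also have "\<bar>\<dots>\<bar> \<le> (j * 2) * 3"
    proof (rule abs_mult_bound)
      show "\<bar>1 - M\<bar> \<le> j * 2" unfolding M1 using M j0 by (simp add: abs_mult)
    qed (use M in auto)
    finally show ?thesis by simp
  qed
  \<comment> \<open>The difference is sorted by monomials. \<open>D1\<close>, \<open>D2\<close>,
    \<open>D3\<close> and \<open>D5\<close> pair a coefficient in \<open>p\<close> and
    \<open>\<mu>\<close> with its counterpart in \<open>l\<close>. These nearly agree, because
    \<open>P * Q\<close> is close to \<open>S\<close> and \<open>M\<close> is close to 1, in
    \<open>D1\<close> even to 1 + j up to O(j^2). The remaining four are of order j * e
    already.\<close>
  define D1 where "D1 = (u + v) * ((1 + j) * S - P * Q * M)"
  define D2 where "D2 = c * (S - P * Q * M\<^sup>2)"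
  define D3 where "D3 = e * ((2 * l + j) * S - 2 * Q * M)"
  define D4 where "D4 = e\<^sup>2 / 2 * S"
  define D5 where "D5 = (u\<^sup>2 + v\<^sup>2) / 2 * ((1 - 2 * l) * S\<^sup>2 - (1 - 2 * p) * (P * Q)\<^sup>2 * M\<^sup>2)"
  define D6 where "D6 = ((1 - 2 * l) * S\<^sup>2) * ((3 * (u + v) * e + 2 * e\<^sup>2) / 6)"
  define D7 where "D7 = ((u + v) * e + e\<^sup>2) * (Q\<^sup>2 * M\<^sup>2)"
  define D8 where "D8 = ((u + v) * e * Q + (e\<^sup>2 + (u + v) * e) * P) * M\<^sup>2"
  have uv2: "\<bar>u + v\<bar> \<le> 2 * j" using uv by linarith
  have M4: "0 \<le> M\<^sup>2" "M\<^sup>2 \<le> 4" using M power_mono[of M 2 2] by auto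
  have uve: "\<bar>(u + v) * e\<bar> \<le> 2 * (j * e)"
    using abs_mult_bound[OF uv2, of e e] e by (simp add: mult_ac)
  have eq: "?L - ?D = D1 + D2 + D3 + D4 + D5 + D6 + D7 + D8"
  proof -
    have L: "?L = - (u * P * M + (u + e) * Q * M + v * P * M + (v + e) * Q * M)
      - ((u * P * M)\<^sup>2 - ((u + e) * Q * M)\<^sup>2 + (v * P * M)\<^sup>2 - ((v + e) * Q * M)\<^sup>2) / 2
      + (e * M - c * Q * M\<^sup>2 + (u + v) * e * Q * M\<^sup>2) - (e * M + (c - e\<^sup>2 - (u + v) * e) * P * M\<^sup>2)"
      by (simp add: P_def Q_def M_def power_divide)
    have D: "?D = (1 - 2 * l) * e * S - c * S - e\<^sup>2 / 2 * S - (1 + j) * (u + v + e) * S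
         - (1 - 2 * l) * (3 * u\<^sup>2 + 3 * u * e + e\<^sup>2 + 3 * v\<^sup>2 + 3 * v * e + e\<^sup>2) / 6 * S\<^sup>2"
      by (simp add: S_def power_divide)
    have sq: "(1 - 2 * p) * (P * Q)\<^sup>2 = P\<^sup>2 - Q\<^sup>2"
    proof -
      have "P\<^sup>2 - Q\<^sup>2 = (P - Q) * (P + Q)" by (simp add: power2_eq_square algebra_simps)
      also have "\<dots> = (1 - 2 * p) * (P * Q) * (P * Q)" by (simp only: PQ)
      finally show ?thesis by (simp add: power2_eq_square mult.assoc)
    qed
    show ?thesis
      unfolding L D D1_def D2_def D3_def D4_def D5_def D6_def D7_def D8_def
      unfolding sq unfolding PQ(1)[symmetric]
      by (simp add: power2_eq_square algebra_simps add_divide_distrib diff_divide_distrib)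
  qed
  have b1: "\<bar>D1\<bar> \<le> 4 * R ^ 6 * X"
  proof -
    have "(1 + j) * S - P * Q * M = (1 + j) * (S - P * Q) + P * Q * (1 + j - M)"
      by (simp add: algebra_simps)
    moreover have "\<bar>(1 + j) * (S - P * Q)\<bar> \<le> (3/2) * (e * R ^ 4)"
      using j j0 by (intro abs_mult_bound Sdiff) auto
    moreover have "\<bar>P * Q * (1 + j - M)\<bar> \<le> R\<^sup>2 * (j\<^sup>2 * 2)"
      using PQR M unfolding M1 by - (rule abs_mult_bound; auto simp: abs_mult mult_left_mono)
    ultimately have "\<bar>(1 + j) * S - P * Q * M\<bar> \<le> (3/2) * (e * R ^ 4) + R\<^sup>2 * (j\<^sup>2 * 2)"
      by linarith
    then have "\<bar>D1\<bar> \<le> (2 * j) * ((3/2) * (e * R ^ 4) + R\<^sup>2 * (j\<^sup>2 * 2))"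
      unfolding D1_def by (rule abs_mult_bound[OF uv2])
    also have "\<dots> = 3 * (R ^ 4 * (j * e)) + 4 * (R ^ 2 * j ^ 3)"
      by (simp add: power2_eq_square power3_eq_cube algebra_simps)
    also have "\<dots> \<le> 4 * (R ^ 6 * (j * e)) + 4 * (R ^ 6 * j ^ 3)"
      using R26 R46 je e j0 R by (intro add_mono mult_mono) auto
    finally show ?thesis by (simp add: X_def algebra_simps)
  qed
  have b2: "\<bar>D2\<bar> \<le> 6 * R ^ 6 * X"
  proof -
    have "S - P * Q * M\<^sup>2 = (S - P * Q) + P * Q * (1 - M\<^sup>2)" by (simp add: algebra_simps)
    moreover have "\<bar>P * Q * (1 - M\<^sup>2)\<bar> \<le> R\<^sup>2 * (6 * j)"
      using PQR by (intro abs_mult_bound M2) auto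
    ultimately have "\<bar>S - P * Q * M\<^sup>2\<bar> \<le> e * R ^ 4 + R\<^sup>2 * (6 * j)" using Sdiff by linarith
    then have "\<bar>D2\<bar> \<le> j\<^sup>2 * (e * R ^ 4 + R\<^sup>2 * (6 * j))"
      unfolding D2_def by (rule abs_mult_bound[OF c])
    also have "\<dots> = (j\<^sup>2 * e) * R ^ 4 + 6 * (j ^ 3 * R ^ 2)"
      by (simp add: power2_eq_square power3_eq_cube algebra_simps)
    also have "\<dots> \<le> 6 * (j * e * R ^ 6) + 6 * (j ^ 3 * R ^ 6)"
    proof (rule add_mono)
      have "j\<^sup>2 * e * R ^ 4 \<le> j * e * R ^ 6" using j2e R46 je R e j0 by (intro mult_mono) auto
      then show "j\<^sup>2 * e * R ^ 4 \<le> 6 * (j * e * R ^ 6)"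
        using je R06 by (smt (verit) mult_nonneg_nonneg)
      show "6 * (j ^ 3 * R ^ 2) \<le> 6 * (j ^ 3 * R ^ 6)" using R26 je by (intro mult_left_mono) auto
    qed
    finally show ?thesis by (simp add: X_def algebra_simps)
  qed
  have b3: "\<bar>D3\<bar> \<le> 7 * R ^ 6 * X"
  proof -
    \<comment> \<open>The coefficient of \<open>e\<close> arises from 1/l - 1/(1 - l), which is why
      1/(1 - l) has to be compared with 1/q.\<close>
    have lS: "l * S = 1 / (1 - l)" using pos by (simp add: S_def sg_def)
    have "1 / (1 - l) - Q = (q - (1 - l)) * (Q * (1 / (1 - l)))"
      using pos by (simp add: Q_def field_simps)
    also have "q - (1 - l) = - (p * e)" using pq by simp
    finally have "\<bar>l * S - Q\<bar> = p * e * (Q * (1 / (1 - l)))"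
      using pos e Q by (simp add: lS abs_mult)
    also have "\<dots> \<le> (1 * j) * (R * R)"
      using pos le1 e Q L1 R by (intro mult_mono) auto
    finally have 1: "\<bar>l * S - Q\<bar> \<le> j * R\<^sup>2" by (simp add: power2_eq_square)
    have 2: "\<bar>Q * (1 - M)\<bar> \<le> R * (j * 2)"
      using Q M j0 unfolding M1 by - (rule abs_mult_bound; auto simp: abs_mult)
    have 3: "\<bar>j * S\<bar> \<le> j * R\<^sup>2" using S j0 by (simp add: abs_mult)
    have "(2 * l + j) * S - 2 * Q * M = 2 * (l * S - Q) + j * S + 2 * (Q * (1 - M))"
      by (simp add: algebra_simps)
    moreover have "\<bar>2 * x + y + 2 * z\<bar> \<le> 2 * a + b + 2 * c"
      if "\<bar>x\<bar> \<le> a" "\<bar>y\<bar> \<le> b" "\<bar>z\<bar> \<le> c" for x y z a b c :: real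
      using that by linarith
    from this[OF 1 3 2] have "\<bar>2 * (l * S - Q) + j * S + 2 * (Q * (1 - M))\<bar> \<le> 3 * (j * R\<^sup>2) + 4 * (R * j)"
      by simp
    ultimately have "\<bar>(2 * l + j) * S - 2 * Q * M\<bar> \<le> 3 * (j * R\<^sup>2) + 4 * (R * j)" by simp
    also have "\<dots> \<le> 7 * (j * R\<^sup>2)" using R2 j0 by (simp add: mult_ac mult_left_mono)
    finally have "\<bar>D3\<bar> \<le> e * (7 * (j * R\<^sup>2))"
      unfolding D3_def using e by - (rule abs_mult_bound; auto)
    also have "\<dots> = 7 * R\<^sup>2 * (j * e)" by simp
    also have "\<dots> \<le> 7 * R ^ 6 * X" using R26 je e j0 R by (intro mult_mono) auto
    finally show ?thesis .
  qed
  have b4: "\<bar>D4\<bar> \<le> 1 * R ^ 6 * X"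
  proof -
    have "\<bar>D4\<bar> \<le> (j * e) * R ^ 6"
      unfolding D4_def using je S R26 by - (rule abs_mult_bound; auto)
    also have "\<dots> \<le> X * R ^ 6" using je R06 by (intro mult_right_mono) auto
    finally show ?thesis by (simp add: mult.commute)
  qed
  have b5: "\<bar>D5\<bar> \<le> 10 * R ^ 6 * X"
  proof -
    have p12: "\<bar>1 - 2 * p\<bar> \<le> 1" using pos le1 by linarith
    have PQ4: "\<bar>(P * Q)\<^sup>2\<bar> \<le> R ^ 4"
      using abs_mult_bound[of "P * Q" "R\<^sup>2" "P * Q" "R\<^sup>2"] PQR by (simp add: power2_eq_square[of "P * Q"] flip: power_add)
    have S4: "\<bar>S\<^sup>2\<bar> \<le> R ^ 4"
      using abs_mult_bound[of S "R\<^sup>2" S "R\<^sup>2"] S by (simp add: power2_eq_square[of S] flip: power_add)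
    have "\<bar>2 * (p - l)\<bar> \<le> 2 * e" unfolding pq(2) using pos le1 e by (simp add: abs_mult)
    then have 1: "\<bar>2 * (p - l) * S\<^sup>2\<bar> \<le> 2 * e * R ^ 4" by (rule abs_mult_bound[OF _ S4])
    have "\<bar>S + P * Q\<bar> \<le> 2 * R\<^sup>2" using S PQR by linarith
    then have "\<bar>(S - P * Q) * (S + P * Q)\<bar> \<le> (e * R ^ 4) * (2 * R\<^sup>2)" by (rule abs_mult_bound[OF Sdiff])
    then have 2: "\<bar>(1 - 2 * p) * ((S - P * Q) * (S + P * Q))\<bar> \<le> 1 * ((e * R ^ 4) * (2 * R\<^sup>2))"
      by (rule abs_mult_bound[OF p12])
    have 3: "\<bar>(1 - 2 * p) * ((P * Q)\<^sup>2 * (1 - M\<^sup>2))\<bar> \<le> 1 * (R ^ 4 * (6 * j))"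
      by (intro abs_mult_bound p12 PQ4 M2)
    have "(1 - 2 * l) * S\<^sup>2 - (1 - 2 * p) * (P * Q)\<^sup>2 * M\<^sup>2 =
       2 * (p - l) * S\<^sup>2 + (1 - 2 * p) * ((S - P * Q) * (S + P * Q)) + (1 - 2 * p) * ((P * Q)\<^sup>2 * (1 - M\<^sup>2))"
      by (simp add: power2_eq_square algebra_simps)
    then have "\<bar>(1 - 2 * l) * S\<^sup>2 - (1 - 2 * p) * (P * Q)\<^sup>2 * M\<^sup>2\<bar>
      \<le> 2 * e * R ^ 4 + (e * R ^ 4) * (2 * R\<^sup>2) + R ^ 4 * (6 * j)"
      using 1 2 3 by linarith
    also have "\<dots> = 2 * e * R ^ 4 + 2 * e * R ^ 6 + 6 * j * R ^ 4"
      by (simp flip: power_add)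
    also have "\<dots> \<le> 2 * e * R ^ 6 + 2 * e * R ^ 6 + 6 * j * R ^ 6"
      using R46 e j0 by (intro add_mono mult_left_mono) auto
    finally have 4: "\<bar>(1 - 2 * l) * S\<^sup>2 - (1 - 2 * p) * (P * Q)\<^sup>2 * M\<^sup>2\<bar> \<le> (4 * e + 6 * j) * R ^ 6"
      by (simp add: algebra_simps)
    have "u\<^sup>2 \<le> j\<^sup>2" "v\<^sup>2 \<le> j\<^sup>2" using power_mono[OF uv(1), of 2] power_mono[OF uv(2), of 2] by simp_all
    then have "\<bar>(u\<^sup>2 + v\<^sup>2) / 2\<bar> \<le> j\<^sup>2" by simp
    then have "\<bar>D5\<bar> \<le> j\<^sup>2 * ((4 * e + 6 * j) * R ^ 6)"
      unfolding D5_def using 4 by (rule abs_mult_bound)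
    also have "\<dots> = (4 * (j\<^sup>2 * e) + 6 * j ^ 3) * R ^ 6"
      by (simp add: power2_eq_square power3_eq_cube algebra_simps)
    also have "\<dots> \<le> (10 * X) * R ^ 6"
    proof (rule mult_right_mono)
      have "4 * a + 6 * b \<le> 10 * (c + b)" if "a \<le> c" "0 \<le> c" "0 \<le> b" for a b c :: real
        using that by argo
      from this[OF j2e je(1,3)] show "4 * (j\<^sup>2 * e) + 6 * j ^ 3 \<le> 10 * X" by (simp only: X_def)
    qed (rule R06)
    finally show ?thesis by (simp add: mult_ac)
  qed
  have b6: "\<bar>D6\<bar> \<le> 2 * R ^ 6 * X"
  proof -
    have S4: "\<bar>S\<^sup>2\<bar> \<le> R ^ 6"
      using abs_mult_bound[of S "R\<^sup>2" S "R\<^sup>2"] S R46 by (simp add: power2_eq_square[of S] flip: power_add)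
    have "\<bar>1 - 2 * l\<bar> \<le> 1" using pos by linarith
    then have 1: "\<bar>(1 - 2 * l) * S\<^sup>2\<bar> \<le> 1 * R ^ 6" by (rule abs_mult_bound[OF _ S4])
    have 2: "\<bar>(3 * (u + v) * e + 2 * e\<^sup>2) / 6\<bar> \<le> 2 * X"
    proof -
      have "\<bar>3 * ((u + v) * e) + 2 * e\<^sup>2\<bar> \<le> 3 * (2 * (j * e)) + 2 * (j * e)"
        using uve je(2) zero_le_power2[of e] by linarith
      moreover have "(3 * (u + v) * e + 2 * e\<^sup>2) / 6 = (3 * ((u + v) * e) + 2 * e\<^sup>2) / 6" by simp
      moreover have "\<bar>y / 6\<bar> \<le> 2 * X" if "\<bar>y\<bar> \<le> 3 * (2 * (j * e)) + 2 * (j * e)" for y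
        using that je(1,4) by (simp add: mult.commute[of e j])
      ultimately show ?thesis by metis
    qed
    show ?thesis unfolding D6_def using abs_mult_bound[OF 1 2] by simp
  qed
  have b7: "\<bar>D7\<bar> \<le> 12 * R ^ 6 * X"
  proof -
    have "\<bar>(u + v) * e + e\<^sup>2\<bar> \<le> 3 * (j * e)" using uve je(2) zero_le_power2[of e] by linarith
    moreover have "\<bar>Q\<^sup>2 * M\<^sup>2\<bar> \<le> R\<^sup>2 * 4"
      using Q M4 power_mono[of Q R 2] by - (rule abs_mult_bound; auto)
    ultimately have "\<bar>D7\<bar> \<le> 3 * (j * e) * (R\<^sup>2 * 4)" unfolding D7_def by (rule abs_mult_bound)
    also have "\<dots> \<le> 3 * X * (R ^ 6 * 4)" using R26 je e j0 R by (intro mult_mono) auto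
    finally show ?thesis by (simp add: mult_ac)
  qed
  have b8: "\<bar>D8\<bar> \<le> 20 * R ^ 6 * X"
  proof -
    have 1: "\<bar>(u + v) * e * Q\<bar> \<le> 2 * (j * e) * R" using uve Q by - (rule abs_mult_bound; auto)
    have "\<bar>e\<^sup>2 + (u + v) * e\<bar> \<le> 3 * (j * e)" using uve je(2) zero_le_power2[of e] by linarith
    then have 2: "\<bar>(e\<^sup>2 + (u + v) * e) * P\<bar> \<le> 3 * (j * e) * R" using P by - (rule abs_mult_bound; auto)
    have "\<bar>(u + v) * e * Q + (e\<^sup>2 + (u + v) * e) * P\<bar> \<le> 5 * (j * e) * R"
      using 1 2 by linarith
    then have "\<bar>D8\<bar> \<le> (5 * (j * e) * R) * 4" unfolding D8_def using M4 by - (rule abs_mult_bound; auto)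
    also have "\<dots> = 20 * (R * (j * e))" by simp
    also have "\<dots> \<le> 20 * (R ^ 6 * X)" using R06 je R e j0 by (intro mult_left_mono mult_mono) auto
    finally show ?thesis by simp
  qed
  have "\<bar>?L - ?D\<bar> \<le> 4 * R ^ 6 * X + 6 * R ^ 6 * X + 7 * R ^ 6 * X + 1 * R ^ 6 * X
      + 10 * R ^ 6 * X + 2 * R ^ 6 * X + 12 * R ^ 6 * X + 20 * R ^ 6 * X"
    unfolding eq by (intro abs_triangle_ineq[THEN order_trans] add_mono b1 b2 b3 b4 b5 b6 b7 b8)
  also have "\<dots> = 62 * R ^ 6 * X" by simp
  also have "\<dots> \<le> 70 * R ^ 6 * X" using R06 je by (intro mult_right_mono) auto
  finally show ?thesis by (simp only: X_def)
qed

text \<open>Positivity of \<open>C'\<close> is a conclusion because nonemptiness of a class is to be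
  inferred from that of its neighbour; the hypotheses are symmetric enough to infer it in either
  direction. Relative errors of at most 1/2 keep ln (1 - x) above -2x.\<close>

lemma ln_ratio_bound:
  fixes C C' F B E :: real
  assumes C: "C > 0" and F: "F > 0" and B: "B > 0" and E: "0 \<le> E" "E \<le> F / 2" "E \<le> B / 2"
    and le: "C * (F - E) \<le> C' * (B + E)" "C' * (B - E) \<le> C * (F + E)"
  shows "C' > 0" and "\<bar>ln C' - ln C - (ln F - ln B)\<bar> \<le> 2 * (E / F) + 2 * (E / B)"
proof -
  have "0 < C * (F - E)" using C E F by simp
  then have "0 < C' * (B + E)" using le(1) by linarith
  then show C': "C' > 0" using B E by (simp add: zero_less_mult_iff)
  have lower: "ln X - 2 * (E / X) \<le> ln (X - E)" if X: "X > 0" "E \<le> X / 2" for X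
  proof -
    have x: "0 \<le> E / X" "E / X \<le> 1 / 2" using X E by (auto simp: field_simps)
    have "- (E / X) - 2 * (E / X)\<^sup>2 \<le> ln (1 - E / X)"
      using x by (intro ln_one_minus_pos_lower_bound)
    moreover have "2 * (E / X)\<^sup>2 \<le> E / X"
      using mult_right_mono[OF x(2,1)] by (simp add: power2_eq_square)
    moreover have "ln (X - E) = ln X + ln (1 - E / X)"
    proof -
      have "X - E = X * (1 - E / X)" using X by (simp add: field_simps)
      moreover have "1 - E / X > 0" using x by linarith
      ultimately show ?thesis using X by (metis ln_mult_pos)
    qed
    ultimately show ?thesis by linarith
  qed
  have upper: "ln (X + E) \<le> ln X + E / X" if X: "X > 0" for X
  proof -
    have "X + E = X * (1 + E / X)" using X by (simp add: field_simps)
    then have "ln (X + E) = ln X + ln (1 + E / X)" using X E by (metis ln_mult_pos add_pos_nonneg divide_nonneg_pos zero_less_one)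
    then show ?thesis using ln_add_one_self_le_self[of "E / X"] X E by simp
  qed
  have pos: "F - E > 0" "B - E > 0" "F + E > 0" "B + E > 0" using E F B by linarith+
  have "ln C + ln (F - E) \<le> ln C' + ln (B + E)"
    using le(1) C C' pos by (simp flip: ln_mult_pos)
  moreover have "ln C' + ln (B - E) \<le> ln C + ln (F + E)"
    using le(2) C C' pos by (simp flip: ln_mult_pos)
  moreover have "0 \<le> E / F" "0 \<le> E / B" using E F B by simp_all
  ultimately show "\<bar>ln C' - ln C - (ln F - ln B)\<bar> \<le> 2 * (E / F) + 2 * (E / B)"
    using lower[OF F E(2)] lower[OF B E(3)] upper[OF F] upper[OF B] by (simp add: abs_le_iff)
qed

section \<open>The exponent and its change under one arc\<close>

definition expo :: "nat \<Rightarrow> nat \<Rightarrow> nat \<Rightarrow> (nat \<times> nat) set \<Rightarrow> real" where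
  "expo n s J H = real J ^ 2 / real n
     + (1 - 2 * lam n s) * chi n s J H 1 / (2 * AA n s * real n)
     - (chi n s J H 1)^2 / (4 * AA n s * (real n)^2)
     - (real n + real J) * (chi n s J H 2 + chi' n s J H 2) / (4 * AA n s * (real n)^2)
     - (1 - 2 * lam n s) * (chi n s J H 3 + chi' n s J H 3) / (24 * (AA n s)^2 * (real n)^2)"

lemma chi_insert:
  assumes "(i, k) \<notin> H" "finite H" "i < J"
  shows "chi n s J (insert (i, k) H) l = chi n s J H l
     + ((real (outdeg H i) - pp n s * (real J - 1) + 1) ^ l - (real (outdeg H i) - pp n s * (real J - 1)) ^ l)"
proof -
  have "(\<Sum>j\<in>{..<J} - {i}. (real (outdeg (insert (i, k) H) j) - pp n s * (real J - 1)) ^ l) =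
     (\<Sum>j\<in>{..<J} - {i}. (real (outdeg H j) - pp n s * (real J - 1)) ^ l)"
    using assms by (intro sum.cong) (auto simp: outdeg_insert)
  then show ?thesis
    unfolding chi_def using assms
    by (simp add: sum.remove[of "{..<J}" i] outdeg_insert algebra_simps)
qed

lemma chi'_converse: "chi' n s J H l = chi n s J (H\<inverse>) l"
  by (simp add: chi'_def chi_def outdeg_converse)

lemma chi'_insert:
  assumes "(i, k) \<notin> H" "finite H" "k < J"
  shows "chi' n s J (insert (i, k) H) l = chi' n s J H l
     + ((real (indeg H k) - pp n s * (real J - 1) + 1) ^ l - (real (indeg H k) - pp n s * (real J - 1)) ^ l)"
proof -
  have "(insert (i, k) H)\<inverse> = insert (k, i) (H\<inverse>)" by auto
  then show ?thesis
    using chi_insert[of k i "H\<inverse>" J n s l] assms by (simp add: chi'_converse outdeg_converse)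
qed

lemma outdeg_le:
  assumes "H \<subseteq> {0..<J} \<times> {0..<J}"
  shows "outdeg H i \<le> J"
proof -
  have "{w. (i, w) \<in> H} \<subseteq> {0..<J}" using assms by auto
  then show ?thesis using card_mono[of "{0..<J}" "{w. (i, w) \<in> H}"] by (simp add: outdeg_def)
qed

lemma indeg_le: "H \<subseteq> {0..<J} \<times> {0..<J} \<Longrightarrow> indeg H i \<le> J"
  using outdeg_le[of "H\<inverse>" J i] by (auto simp: outdeg_converse)

text \<open>A new arc raises one out-degree and one in-degree by 1, so squares grow by 2x + 1 and
  cubes by 3x^2 + 3x + 1. The result is written in the normalised units of
  \<open>exponent_increment\<close>, to be compared with the switching ratio.\<close>

lemma expo_insert:
  fixes n s J :: nat
  assumes ik: "(i, k) \<notin> H" "finite H" "i < J" "k < J" and n: "n > 0"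
  defines "u \<equiv> (real (outdeg H i) - pp n s * (real J - 1)) / real n"
    and "v \<equiv> (real (indeg H k) - pp n s * (real J - 1)) / real n"
    and "c \<equiv> chi n s J H 1 / (real n)\<^sup>2" and "j \<equiv> real J / real n" and "e \<equiv> 1 / real n"
    and "l \<equiv> lam n s"
  shows "expo n s J (insert (i, k) H) - expo n s J H =
    (1 - 2 * l) * e / (l * (1 - l)) - c / (l * (1 - l)) - e\<^sup>2 / (2 * (l * (1 - l)))
      - (1 + j) * (u + v + e) / (l * (1 - l))
      - (1 - 2 * l) * (3 * u\<^sup>2 + 3 * u * e + e\<^sup>2 + 3 * v\<^sup>2 + 3 * v * e + e\<^sup>2) / (6 * (l * (1 - l))\<^sup>2)"
proof -
  define a where "a = real (outdeg H i) - pp n s * (real J - 1)"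
  define b where "b = real (indeg H k) - pp n s * (real J - 1)"
  define S where "S = 1 / (l * (1 - l))"
  define N where "N = 1 / real n"
  have inv: "x / (2 * AA n s * real n) = x * S * N" "x / (4 * AA n s * (real n)^2) = x * S * N\<^sup>2 / 2"
    "x / (24 * (AA n s)^2 * (real n)^2) = x * S\<^sup>2 * N\<^sup>2 / 6" for x
    by (simp_all add: AA_def S_def N_def l_def[symmetric] power2_eq_square)
  have nN: "real n * N = 1" using n by (simp add: N_def)
  have c1: "chi n s J (insert (i, k) H) 1 = chi n s J H 1 + 1"
    and c2: "chi n s J (insert (i, k) H) 2 = chi n s J H 2 + (2 * a + 1)"
    and c3: "chi n s J (insert (i, k) H) 3 = chi n s J H 3 + (3 * a\<^sup>2 + 3 * a + 1)"
    and d2: "chi' n s J (insert (i, k) H) 2 = chi' n s J H 2 + (2 * b + 1)"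
    and d3: "chi' n s J (insert (i, k) H) 3 = chi' n s J H 3 + (3 * b\<^sup>2 + 3 * b + 1)"
    unfolding chi_insert[OF ik(1-3)] chi'_insert[OF ik(1,2,4)] a_def[symmetric] b_def[symmetric]
    by (simp_all add: power2_eq_square power3_eq_cube algebra_simps)
  have red: "u = a * N" "v = b * N" "c = chi n s J H 1 * N\<^sup>2" "j = real J * N" "e = N"
    by (simp_all add: u_def v_def c_def j_def e_def a_def b_def N_def power_divide)
  have rhs: "x / (l * (1 - l)) = x * S" "x / (2 * (l * (1 - l))) = x * S / 2" "x / (6 * (l * (1 - l))\<^sup>2) = x * S\<^sup>2 / 6" for x
    by (simp_all add: S_def power_divide)
  have "expo n s J (insert (i, k) H) - expo n s J H = (1 - 2 * l) * S * N
      - (2 * chi n s J H 1 + 1) * S * N\<^sup>2 / 2 - (real n + real J) * (2 * a + 2 * b + 2) * S * N\<^sup>2 / 2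
      - (1 - 2 * l) * (3 * a\<^sup>2 + 3 * a + 1 + 3 * b\<^sup>2 + 3 * b + 1) * S\<^sup>2 * N\<^sup>2 / 6"
    unfolding expo_def inv c1 c2 c3 d2 d3 l_def[symmetric]
    by (simp add: power2_eq_square algebra_simps add_divide_distrib diff_divide_distrib)
  also have "(real n + real J) * (2 * a + 2 * b + 2) * S * N\<^sup>2 / 2 =
      (real n * N + real J * N) * (a * N + b * N + N) * S"
    by (simp add: power2_eq_square algebra_simps)
  finally show ?thesis
    unfolding rhs red nN by (simp add: power2_eq_square algebra_simps add_divide_distrib diff_divide_distrib)
qed

text \<open>\<open>R\<close> bounds the inverse densities and will be of logarithmic order. Both
  \<open>pp\<close> and \<open>lam\<close> are bounded because arcs have probability
  \<open>pp\<close> while the exponent is written with \<open>lam\<close>. The condition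
  \<open>small\<close> keeps the relative error of each switching step below 1/2.\<close>

locale regular_block =
  fixes n s J :: nat and R :: real
  assumes J_ge: "J \<ge> 1" and R_ge: "R \<ge> 2"
    and p_lower: "1 / R \<le> pp n s" and q_lower: "1 / R \<le> 1 - pp n s"
    and l_lower: "1 / R \<le> lam n s" and l_upper: "1 / R \<le> 1 - lam n s"
    and small: "10 ^ 10 * R ^ 7 * real J \<le> real n"
begin

lemma R_powers: "1 \<le> R ^ k" "R \<le> R ^ 7"
  using R_ge by (auto intro: one_le_power self_le_power)

lemma RJ_small: "10 ^ 10 * R * real J \<le> real n"
proof -
  have "10 ^ 10 * R * real J \<le> 10 ^ 10 * R ^ 7 * real J"
    using R_powers by (intro mult_right_mono mult_left_mono) auto
  then show ?thesis using small by linarith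
qed

lemma n_large: "10 ^ 10 \<le> real n"
proof -
  have "10 ^ 10 * 1 * 1 \<le> 10 ^ 10 * R * real J"
    using R_ge J_ge by (intro mult_mono) auto
  then show ?thesis using RJ_small by linarith
qed

text \<open>Arcs and non-arcs both have density at least 1/R; half of this pays for the
  \<open>J + 3\<close> columns given away in \<open>dense\<close> and
  \<open>codense\<close>.\<close>

sublocale dense_block n s J "1 / (2 * R)"
proof
  have n0: "real n > 0" using n_large by simp
  show "8 \<le> n" using n_large by simp
  have "real J \<le> real n" using RJ_small R_ge
    by (smt (verit) mult_less_cancel_right2 mult_nonneg_nonneg of_nat_0_le_iff power_one_over one_le_power mult_le_cancel_right1 one_le_numeral)
  then show "J \<le> n" by simp
  show "1 / (2 * R) > 0" using R_ge by simp
  have J4: "real J + 3 \<le> real n / (2 * R)"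
  proof -
    have "(real J + 3) * (2 * R) \<le> (4 * real J) * (2 * R)"
      using J_ge R_ge by (intro mult_right_mono) auto
    also have "\<dots> = 8 * (R * real J)" by simp
    also have "\<dots> \<le> 10 ^ 10 * (R * real J)" using R_ge by (intro mult_right_mono) auto
    also have "\<dots> \<le> real n" using RJ_small by (simp add: mult.assoc)
    finally show ?thesis using R_ge by (simp add: field_simps)
  qed
  have half: "1 / (2 * R) * real n = real n / R - real n / (2 * R)" by (simp add: field_simps)
  have "real n / R \<le> real s"
    using mult_right_mono[OF l_lower, of "real n"] n0 by (simp add: lam_def)
  then show "1 / (2 * R) * real n \<le> real s - real J - 3" using J4 half by linarith
  have "real n / R \<le> real n - real s"
    using mult_right_mono[OF l_upper, of "real n"] n0 by (simp add: lam_def algebra_simps)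
  then show "1 / (2 * R) * real n \<le> real n - real s - real J - 3" using J4 half by linarith
qed

abbreviation p where "p \<equiv> pp n s"
abbreviation q where "q \<equiv> 1 - pp n s"

lemma n0: "real n > 0" using n_large by simp

lemma pos: "p > 0" "q > 0" "lam n s > 0" "1 - lam n s > 0"
proof -
  have "1 / R > 0" using R_ge by simp
  then show "p > 0" "q > 0" "lam n s > 0" "1 - lam n s > 0"
    using p_lower q_lower l_lower l_upper by linarith+
qed

lemma p_n: "p * (real n - 1) = real s"
  using n_large by (simp add: pp_def)

text \<open>From \<open>p * (n - 1) = s\<close> one gets \<open>s - p * (J - 1) = p * m\<close>.
  Hence the centring \<open>p * (J - 1)\<close> makes the deviation of the outer density from
  \<open>p\<close> exactly proportional to the degree deviation.\<close>

lemma outprob_eq: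
  "outprob H i = p - (real (outdeg H i) - p * (real J - 1)) / m"
  using m_pos p_n by (simp add: outprob_def m_def field_simps)

lemma inprob_eq:
  "inprob H i = p - (real (indeg H i) - p * (real J - 1)) / m"
  using outprob_eq[of "H\<inverse>" i] by (simp add: inprob_converse outdeg_converse)

lemma chi_1:
  assumes "H \<subseteq> {0..<J} \<times> {0..<J}"
  shows "chi n s J H 1 = real (card H) - p * real J * (real J - 1)"
  using assms by (simp add: chi_def sum_subtractf outdeg_ent card_ent mult_ac)

lemma arcs_out_eq:
  assumes "H \<subseteq> {0..<J} \<times> {0..<J}"
  shows "arcs_out H = p * m * (m - 1) + chi n s J H 1"
  unfolding arcs_out_def chi_1[OF assms] p_n[symmetric] by (simp add: m_def algebra_simps)

lemma deviation_bounds: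
  assumes H: "H \<subseteq> {0..<J} \<times> {0..<J}"
  shows "\<bar>real (outdeg H i) - p * (real J - 1)\<bar> \<le> real J" "\<bar>real (indeg H i) - p * (real J - 1)\<bar> \<le> real J"
    "\<bar>chi n s J H 1\<bar> \<le> (real J)\<^sup>2"
proof -
  have "p * (real J - 1) \<le> 1 * (real J - 1)" using pos J_ge by (intro mult_right_mono) auto
  moreover have "0 \<le> p * (real J - 1)" using pos J_ge by simp
  ultimately show out: "\<bar>real (outdeg H i) - p * (real J - 1)\<bar> \<le> real J"
    and "\<bar>real (indeg H i) - p * (real J - 1)\<bar> \<le> real J" for i
    using outdeg_le[OF H, of i] indeg_le[OF H, of i] by auto
  have "\<bar>chi n s J H 1\<bar> \<le> (\<Sum>j<J. real J)"
    unfolding chi_def power_one_right by (rule order_trans[OF sum_abs]) (intro sum_mono out)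
  then show "\<bar>chi n s J H 1\<bar> \<le> (real J)\<^sup>2" by (simp add: power2_eq_square)
qed

end

lemma abs_add_bound: "\<bar>x\<bar> \<le> a \<Longrightarrow> \<bar>y\<bar> \<le> b \<Longrightarrow> \<bar>x + y\<bar> \<le> a + b" for x y a b :: real
  by linarith

text \<open>Returns from units with n = 1 to the brackets in the switching means; \<open>y\<close>
  stands for \<open>q\<close> here and for \<open>p\<close> in the backward version.\<close>

lemma rescale_fwd:
  fixes n \<mu> y c a b :: real
  assumes "n \<noteq> 0" "\<mu> \<noteq> 0" "y \<noteq> 0"
  shows "(n * \<mu>)\<^sup>2 * y * (1 + (1 / n / \<mu> - c / n\<^sup>2 / (y * \<mu>\<^sup>2) + (a / n + b / n) * (1 / n) / (y * \<mu>\<^sup>2)))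
    = (n * \<mu>)\<^sup>2 * y + n * \<mu> * y - c + (a + b)"
  using assms by (simp add: field_simps power2_eq_square)

lemma rescale_bwd:
  fixes n \<mu> y c a b :: real
  assumes "n \<noteq> 0" "\<mu> \<noteq> 0" "y \<noteq> 0"
  shows "(n * \<mu>)\<^sup>2 * y * (1 + (1 / n / \<mu> + (c / n\<^sup>2 - (1 / n)\<^sup>2 - (a / n + b / n) * (1 / n)) / (y * \<mu>\<^sup>2)))
    = (n * \<mu>)\<^sup>2 * y + n * \<mu> * y + c - 1 - a - b"
  using assms by (simp add: field_simps power2_eq_square)

context regular_block
begin

text \<open>The first summand covers the switching error, of order J against counts of order n^2;
  together they cover the Taylor remainders. After summation over J^2 arcs the total is J^3/n^2 +
  J^5/n^3, up to the factor in \<open>R\<close>.\<close>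

definition step_error :: real where
  "step_error = 10 ^ 10 * R ^ 7 * (real J / real n * (1 / real n) + (real J / real n) ^ 3)"

lemma switch_error_bound: "switch_error \<le> 3 * 10 ^ 7 * real J * R ^ 4"
proof -
  have md: "m * \<delta> \<le> 1856 * R\<^sup>2"
  proof -
    \<comment> \<open>Here \<open>\<tau>\<close> is 1/(2R), and 1856 = 4 * 464.\<close>
    have "\<delta> = 1856 * R\<^sup>2 / real n" unfolding \<delta>_def using R_ge by (simp add: power_divide field_simps)
    moreover have "m * (1856 * R\<^sup>2 / real n) \<le> real n * (1856 * R\<^sup>2 / real n)"
      using m_le_n by (intro mult_right_mono) auto
    ultimately show ?thesis using n0 by simp
  qed
  have md0: "0 \<le> m * \<delta>" using m_pos \<delta>_nonneg by simp
  have J1: "1 \<le> real J" using J_ge by simp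
  have "(m * \<delta>)\<^sup>2 \<le> (1856 * R\<^sup>2)\<^sup>2" using md md0 by (rule power_mono)
  also have "\<dots> = 3444736 * R ^ 4" by (simp add: power_mult_distrib flip: power_mult)
  also have "\<dots> \<le> 3444736 * (real J * R ^ 4)"
    using J1 mult_right_mono[OF J1, of "R ^ 4"] by simp
  finally have 1: "(m * \<delta>)\<^sup>2 \<le> 3444736 * (real J * R ^ 4)" .
  have R24: "R\<^sup>2 \<le> R ^ 4" using R_ge by (intro power_increasing) auto
  have 2: "m * \<delta> \<le> 1856 * (real J * R ^ 4)"
  proof -
    have "1856 * R\<^sup>2 \<le> 1856 * R ^ 4" using R24 by simp
    also have "\<dots> \<le> 1856 * (real J * R ^ 4)" using mult_right_mono[OF J1, of "R ^ 4"] by simp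
    finally show ?thesis using md by linarith
  qed
  have 3: "real J * (m * \<delta>) \<le> 1856 * (real J * R ^ 4)"
  proof -
    have "real J * (m * \<delta>) \<le> real J * (1856 * R ^ 4)"
      using md R24 by (intro mult_left_mono) auto
    then show ?thesis by simp
  qed
  have "switch_error = 8 * (m * \<delta>)\<^sup>2 + 10 * (m * \<delta>) + 8 * (real J * (m * \<delta>))"
    by (simp add: switch_error_def power_mult_distrib)
  also have "\<dots> \<le> 8 * (3444736 * (real J * R ^ 4)) + 10 * (1856 * (real J * R ^ 4)) + 8 * (1856 * (real J * R ^ 4))"
    using 1 2 3 by (intro add_mono mult_left_mono) auto
  also have "\<dots> = 27591296 * (real J * R ^ 4)" by simp
  also have "\<dots> \<le> 3 * 10 ^ 7 * (real J * R ^ 4)" using J1 R_ge by (intro mult_right_mono) auto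
  finally show ?thesis by simp
qed

text \<open>Both the log of the switching ratio and the increment of \<open>expo\<close> are
  compared with the same polynomial in the normalised deviations. The equivalence of emptiness
  guarantees that the logarithms are taken of positive numbers.\<close>

lemma arc_step:
  assumes ik: "i < J" "k < J" "i \<noteq> k" "(i, k) \<notin> H" and H: "H \<subseteq> {0..<J} \<times> {0..<J}"
  defines "H' \<equiv> insert (i, k) H"
  shows "blockclass n s J H = {} \<longleftrightarrow> blockclass n s J H' = {}"
    and "blockclass n s J H \<noteq> {} \<Longrightarrow>
      \<bar>ln (real (card (blockclass n s J H'))) - ln (real (card (blockclass n s J H)))
         - (ln p - ln q) - (expo n s J H' - expo n s J H)\<bar> \<le> step_error"
proof -
  define C where "C = real (card (blockclass n s J H))"
  define C' where "C' = real (card (blockclass n s J H'))"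
  define \<alpha> where "\<alpha> = real (outdeg H i) - p * (real J - 1)"
  define \<beta> where "\<beta> = real (indeg H k) - p * (real J - 1)"
  define ch where "ch = chi n s J H 1"
  define u where "u = \<alpha> / real n"
  define v where "v = \<beta> / real n"
  define c where "c = ch / (real n)\<^sup>2"
  define j where "j = real J / real n"
  define e where "e = 1 / real n"
  define \<mu> where "\<mu> = 1 - j"
  define X where "X = j * e + j ^ 3"
  \<comment> \<open>Relative deviations of the factors of the means:
    \<open>outprob H i = p * (1 - a1)\<close> before and
    \<open>1 - outprob H' i = q * (1 + a2)\<close> after the insertion, which accounts for
    \<open>u + e\<close> in \<open>a2\<close>; \<open>b1\<close> and \<open>b2\<close> do the same
    for in-degrees.\<close>
  define a1 where "a1 = u / (p * \<mu>)"
  define a2 where "a2 = (u + e) / (q * \<mu>)"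
  define b1 where "b1 = v / (p * \<mu>)"
  define b2 where "b2 = (v + e) / (q * \<mu>)"
  define z1 where "z1 = e / \<mu> - c / (q * \<mu>\<^sup>2) + (u + v) * e / (q * \<mu>\<^sup>2)"
  define z2 where "z2 = e / \<mu> + (c - e\<^sup>2 - (u + v) * e) / (p * \<mu>\<^sup>2)"
  \<comment> \<open>The deviations are at most 2j, 1/p and 1/q at most \<open>R\<close>, and 1/\<mu>
    at most 2, which gives \<open>t\<close>. For \<open>w\<close>, the larger bound
    \<open>2 * e + (j\<^sup>2 + 3 * e) * (R * 4)\<close> is used, with 2e at most R * e.\<close>
  define t where "t = 4 * (R * j)"
  define w where "w = 13 * (R * (e + j\<^sup>2))"
  define Fh where "Fh = (1 - a1) * (1 - b1) * (1 + z1)"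
  define Bh where "Bh = (1 + a2) * (1 + b2) * (1 + z2)"
  define E where "E = switch_error"
  have finH: "finite H" using H by (rule finite_subset) simp
  have H': "H' \<subseteq> {0..<J} \<times> {0..<J}" using H ik by (auto simp: H'_def)
  have e0: "0 < e" and ej: "e \<le> j" using n0 J_ge by (auto simp: e_def j_def divide_right_mono)
  have j0: "0 < j" using e0 ej by linarith
  have Rj7: "R ^ 7 * j \<le> 1 / 10 ^ 10"
    using small n0 by (simp add: j_def field_simps)
  have Rj: "R * j \<le> 1 / 10 ^ 10"
    using mult_right_mono[OF R_powers(2), of j] j0 Rj7 by linarith
  have j_small: "j \<le> 1 / 10 ^ 10"
    using mult_right_mono[of 1 R j] R_ge j0 Rj by linarith
  have e1: "e \<le> 1" "j \<le> 1" using ej j_small by auto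
  have mu: "1/2 \<le> \<mu>" "\<mu> \<le> 1" "0 < \<mu>" using j_small j0 by (auto simp: \<mu>_def)
  have m_eq: "m = real n * \<mu>" using n0 by (simp add: m_def \<mu>_def j_def field_simps)
  have uv: "\<bar>u\<bar> \<le> j" "\<bar>v\<bar> \<le> j" and cb: "\<bar>c\<bar> \<le> j\<^sup>2"
    using deviation_bounds(1)[OF H, of i] deviation_bounds(2)[OF H, of k] deviation_bounds(3)[OF H] n0
    by (simp_all add: u_def v_def c_def j_def \<alpha>_def \<beta>_def ch_def power_divide divide_right_mono)
  have P: "0 < 1 / p" "1 / p \<le> R" and Q: "0 < 1 / q" "1 / q \<le> R"
    using p_lower q_lower pos R_ge by (auto simp: field_simps)
  have M: "0 < 1 / \<mu>" "1 / \<mu> \<le> 2" using mu by (auto simp: field_simps)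
  have M2: "0 < 1 / \<mu>\<^sup>2" "1 / \<mu>\<^sup>2 \<le> 4"
  proof -
    show "0 < 1 / \<mu>\<^sup>2" using mu by simp
    have "(1 / \<mu>)\<^sup>2 \<le> 2\<^sup>2" using M by (intro power_mono) auto
    then show "1 / \<mu>\<^sup>2 \<le> 4" by (simp add: power_divide)
  qed
  have je0: "0 \<le> j * e" "j * e \<le> e" "e\<^sup>2 \<le> j * e" "e\<^sup>2 \<le> e" "j * e \<le> X" "j ^ 3 \<le> X" "0 \<le> X"
    using e0 j0 ej e1 by (auto simp: X_def power2_eq_square mult_right_mono mult_left_le_one_le)
  have PM: "\<bar>1 / (p * \<mu>)\<bar> \<le> R * 2" and QM: "\<bar>1 / (q * \<mu>)\<bar> \<le> R * 2"
    and PM2: "\<bar>1 / (p * \<mu>\<^sup>2)\<bar> \<le> R * 4" and QM2: "\<bar>1 / (q * \<mu>\<^sup>2)\<bar> \<le> R * 4"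
    using abs_mult_bound[of "1 / p" R "1 / \<mu>" 2] abs_mult_bound[of "1 / q" R "1 / \<mu>" 2]
      abs_mult_bound[of "1 / p" R "1 / \<mu>\<^sup>2" 4] abs_mult_bound[of "1 / q" R "1 / \<mu>\<^sup>2" 4] P Q M M2
    by simp_all
  have "\<bar>u * (1 / (p * \<mu>))\<bar> \<le> j * (R * 2)" "\<bar>v * (1 / (p * \<mu>))\<bar> \<le> j * (R * 2)"
    by (rule abs_mult_bound[OF uv(1) PM], rule abs_mult_bound[OF uv(2) PM])
  moreover have "0 \<le> R * j" "j * (R * 2) = 2 * (R * j)" using j0 R_ge by auto
  moreover have "a1 = u * (1 / (p * \<mu>))" "b1 = v * (1 / (p * \<mu>))" by (simp_all add: a1_def b1_def)
  ultimately have ab1: "\<bar>a1\<bar> \<le> t" "\<bar>b1\<bar> \<le> t" unfolding t_def by linarith+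
  have "\<bar>u + e\<bar> \<le> 2 * j" "\<bar>v + e\<bar> \<le> 2 * j" using uv e0 ej by linarith+
  then have "\<bar>(u + e) * (1 / (q * \<mu>))\<bar> \<le> 2 * j * (R * 2)" "\<bar>(v + e) * (1 / (q * \<mu>))\<bar> \<le> 2 * j * (R * 2)"
    using abs_mult_bound[OF _ QM] by blast+
  then have ab2: "\<bar>a2\<bar> \<le> t" "\<bar>b2\<bar> \<le> t" by (auto simp: a2_def b2_def t_def mult_ac)
  have uv2: "\<bar>u + v\<bar> \<le> 2 * j" using uv by linarith
  have uve: "\<bar>(u + v) * e\<bar> \<le> 2 * e"
  proof -
    have "\<bar>(u + v) * e\<bar> \<le> 2 * j * e" using e0 by (intro abs_mult_bound[OF uv2]) auto
    then show ?thesis using je0(2) by linarith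
  qed
  have Re: "2 * e \<le> R * e" using R_ge e0 by (intro mult_right_mono) auto
  have emu: "\<bar>e / \<mu>\<bar> \<le> 2 * e"
    using abs_mult_bound[of e e "1 / \<mu>" 2] e0 M by simp
  have "\<bar>- c + (u + v) * e\<bar> \<le> j\<^sup>2 + 2 * e" using cb uve by linarith
  from abs_mult_bound[OF this QM2] have "\<bar>(- c + (u + v) * e) / (q * \<mu>\<^sup>2)\<bar> \<le> (j\<^sup>2 + 2 * e) * (R * 4)" by simp
  note abs_add_bound[OF emu this]
  moreover have "z1 = e / \<mu> + (- c + (u + v) * e) / (q * \<mu>\<^sup>2)"
    by (simp add: z1_def add_divide_distrib diff_divide_distrib)
  ultimately have "\<bar>z1\<bar> \<le> 2 * e + (j\<^sup>2 + 2 * e) * (R * 4)" by simp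
  moreover have "\<bar>c - e\<^sup>2 - (u + v) * e\<bar> \<le> j\<^sup>2 + 3 * e"
    using cb uve je0(4) zero_le_power2[of e] by linarith
  from abs_mult_bound[OF this PM2] have "\<bar>(c - e\<^sup>2 - (u + v) * e) / (p * \<mu>\<^sup>2)\<bar> \<le> (j\<^sup>2 + 3 * e) * (R * 4)" by simp
  from abs_add_bound[OF emu this] have "\<bar>z2\<bar> \<le> 2 * e + (j\<^sup>2 + 3 * e) * (R * 4)" unfolding z2_def .
  moreover have "2 * e + (j\<^sup>2 + 3 * e) * (R * 4) \<le> w" "2 * e + (j\<^sup>2 + 2 * e) * (R * 4) \<le> w"
  proof -
    define x where "x = R * j\<^sup>2"
    define y where "y = R * e"
    have xy: "0 \<le> x" "0 \<le> y" "2 * e \<le> y" using R_ge e0 Re by (auto simp: x_def y_def)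
    have eqs: "(j\<^sup>2 + 3 * e) * (R * 4) = 4 * x + 12 * y"
      "(j\<^sup>2 + 2 * e) * (R * 4) = 4 * x + 8 * y"
      "w = 13 * y + 13 * x"
      by (simp_all add: w_def x_def y_def algebra_simps)
    show "2 * e + (j\<^sup>2 + 3 * e) * (R * 4) \<le> w" "2 * e + (j\<^sup>2 + 2 * e) * (R * 4) \<le> w"
      unfolding eqs using xy by linarith+
  qed
  ultimately have zb: "\<bar>z1\<bar> \<le> w" "\<bar>z2\<bar> \<le> w" by linarith+
  have t_small: "t \<le> 1/2" using Rj by (simp add: t_def)
  have w_small: "w \<le> 1/2"
  proof -
    have "j\<^sup>2 \<le> j" using j0 e1 by (simp add: power2_eq_square mult_left_le_one_le)
    then have "R * (e + j\<^sup>2) \<le> R * (2 * j)" using R_ge ej by (intro mult_left_mono) auto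
    then show ?thesis using Rj unfolding w_def by simp
  qed
  have ge: "1/2 \<le> 1 - a1" "1/2 \<le> 1 - b1" "1/2 \<le> 1 + z1" "1/2 \<le> 1 + a2" "1/2 \<le> 1 + b2" "1/2 \<le> 1 + z2"
    using ab1 ab2 zb t_small w_small by linarith+
  have Fh8: "1/8 \<le> Fh"
  proof -
    have "(1/2) * (1/2) * (1/2) \<le> Fh" unfolding Fh_def using ge by (intro mult_mono) auto
    then show ?thesis by simp
  qed
  have Bh8: "1/8 \<le> Bh"
  proof -
    have "(1/2) * (1/2) * (1/2) \<le> Bh" unfolding Bh_def using ge by (intro mult_mono) auto
    then show ?thesis by simp
  qed
  have op: "outprob H i = p * (1 - a1)" "inprob H k = p * (1 - b1)"
    unfolding outprob_eq inprob_eq \<alpha>_def[symmetric] \<beta>_def[symmetric] using pos mu n0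
    by (simp_all add: a1_def b1_def u_def v_def m_eq field_simps)
  have od: "real (outdeg H' i) = real (outdeg H i) + 1" "real (indeg H' k) = real (indeg H k) + 1"
    "real (card H') = real (card H) + 1"
    using ik finH by (simp_all add: H'_def outdeg_insert indeg_insert)
  have op': "1 - outprob H' i = q * (1 + a2)" "1 - inprob H' k = q * (1 + b2)"
  proof -
    have "outprob H' i = p - (\<alpha> + 1) / m" "inprob H' k = p - (\<beta> + 1) / m"
      unfolding outprob_eq inprob_eq od by (simp_all add: \<alpha>_def \<beta>_def algebra_simps)
    moreover have "q * a2 = (\<alpha> + 1) / m" "q * b2 = (\<beta> + 1) / m"
    proof -
      have "y * ((x / real n + 1 / real n) / (y * \<mu>)) = (x + 1) / (real n * \<mu>)" if "y \<noteq> 0" for x y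
        using that by (simp add: add_divide_distrib[symmetric])
      then show "q * a2 = (\<alpha> + 1) / m" "q * b2 = (\<beta> + 1) / m"
        using pos unfolding a2_def b2_def u_def v_def e_def m_eq by (metis less_irrefl)+
    qed
    ultimately show "1 - outprob H' i = q * (1 + a2)" "1 - inprob H' k = q * (1 + b2)"
      unfolding distrib_left by simp_all
  qed
  have chi': "chi n s J H' 1 = ch + 1"
    unfolding chi_1[OF H'] od ch_def chi_1[OF H] by simp
  have mdev: "m * outprob H i = m * p - \<alpha>" "m * inprob H k = m * p - \<beta>"
    "m * outprob H' i = m * p - \<alpha> - 1" "m * inprob H' k = m * p - \<beta> - 1"
    unfolding outprob_eq inprob_eq od using m_pos by (simp_all add: \<alpha>_def \<beta>_def field_simps)
  have br1: "m\<^sup>2 - m - arcs_out H + m * (1 - outprob H i) + m * (1 - inprob H k) = m\<^sup>2 * q * (1 + z1)"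
  proof -
    have "m\<^sup>2 * q * (1 + z1) = m\<^sup>2 * q + m * q - ch + (\<alpha> + \<beta>)"
      unfolding z1_def u_def v_def c_def e_def m_eq by (rule rescale_fwd) (use pos mu n0 in auto)
    then show ?thesis
      unfolding arcs_out_eq[OF H] right_diff_distrib mdev by (simp add: ch_def power2_eq_square algebra_simps)
  qed
  have br2: "arcs_out H' + m * outprob H' i + m * inprob H' k = m\<^sup>2 * p * (1 + z2)"
  proof -
    have "m\<^sup>2 * p * (1 + z2) = m\<^sup>2 * p + m * p + ch - 1 - \<alpha> - \<beta>"
      unfolding z2_def u_def v_def c_def e_def m_eq by (rule rescale_bwd) (use pos mu n0 in auto)
    then show ?thesis
      unfolding arcs_out_eq[OF H'] mdev chi' by (simp add: power2_eq_square algebra_simps)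
  qed
  \<comment> \<open>The prefactors m^2 p^2 q here and m^2 p q^2 in \<open>B\<close> have quotient
    p/q, the odds under independent arcs. All corrections are in \<open>Fh\<close> and
    \<open>Bh\<close>.\<close>
  have F: "fwd_mean H i k = m\<^sup>2 * (p * p * q) * Fh"
    unfolding fwd_mean_def br1 unfolding op by (simp add: Fh_def)
  have B: "bwd_mean H' i k = m\<^sup>2 * (p * q * q) * Bh"
    unfolding bwd_mean_def br2 unfolding op' by (simp add: Bh_def)
  have m2: "(real n)\<^sup>2 / 4 \<le> m\<^sup>2"
  proof -
    have "(real n / 2)\<^sup>2 \<le> m\<^sup>2" using mu n0 unfolding m_eq by (intro power_mono) auto
    then show ?thesis by (simp add: power_divide)
  qed
  have big: "(real n)\<^sup>2 / (32 * R ^ 3) \<le> m\<^sup>2 * y * z" if "1 / R * (1 / R) * (1 / R) \<le> y" "1/8 \<le> z" for y z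
  proof -
    have "(real n)\<^sup>2 / 4 * (1 / R * (1 / R) * (1 / R)) * (1/8) \<le> m\<^sup>2 * y * z"
    proof (intro mult_mono m2 that)
      show "0 \<le> m\<^sup>2 * y" using that(1) R_ge
        by (intro mult_nonneg_nonneg order_trans[OF _ that(1)]) auto
    qed (use R_ge in auto)
    then show ?thesis by (simp add: power3_eq_cube)
  qed
  have Rq: "0 < 1 / R" using R_ge by simp
  have Fbig: "(real n)\<^sup>2 / (32 * R ^ 3) \<le> fwd_mean H i k"
    unfolding F using p_lower q_lower Rq pos by (intro big Fh8 mult_mono) auto
  have Bbig: "(real n)\<^sup>2 / (32 * R ^ 3) \<le> bwd_mean H' i k"
    unfolding B using p_lower q_lower Rq pos by (intro big Bh8 mult_mono) auto
  have base: "0 < (real n)\<^sup>2 / (32 * R ^ 3)" using n0 R_ge by simp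
  \<comment> \<open>The switching error O(J R^4) is divided by a count of at least n^2/(32 R^3);
    this is where the seventh power of \<open>R\<close> arises.\<close>
  have Erel: "E / ((real n)\<^sup>2 / (32 * R ^ 3)) \<le> 10 ^ 9 * R ^ 7 * (j * e)"
  proof -
    have "E / ((real n)\<^sup>2 / (32 * R ^ 3)) \<le> 3 * 10 ^ 7 * real J * R ^ 4 / ((real n)\<^sup>2 / (32 * R ^ 3))"
      using switch_error_bound base unfolding E_def by (intro divide_right_mono) auto
    also have "\<dots> = 96 * 10 ^ 7 * (R ^ 4 * R ^ 3) * (j * e)"
      using n0 R_ge by (simp add: j_def e_def power2_eq_square field_simps)
    also have "\<dots> \<le> 10 ^ 9 * R ^ 7 * (j * e)"
      unfolding power_add[symmetric] using je0(1) R_ge by (intro mult_right_mono) auto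
    finally show ?thesis .
  qed
  have E0: "0 \<le> E" unfolding E_def by (rule switch_error_nonneg)
  have rel: "E / y \<le> 10 ^ 9 * R ^ 7 * (j * e)" "E \<le> y / 2" "y > 0"
    if "(real n)\<^sup>2 / (32 * R ^ 3) \<le> y" for y
  proof -
    show y: "y > 0" using base that by linarith
    have "E / y \<le> E / ((real n)\<^sup>2 / (32 * R ^ 3))" using base that E0 y by (intro divide_left_mono mult_pos_pos)
    then show r: "E / y \<le> 10 ^ 9 * R ^ 7 * (j * e)" using Erel by linarith
    have "10 ^ 9 * R ^ 7 * (j * e) = 10 ^ 9 * ((R ^ 7 * j) * e)" by simp
    also have "\<dots> \<le> 10 ^ 9 * ((1 / 10 ^ 10) * 1)" using Rj7 e0 e1 by (intro mult_left_mono mult_mono) auto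
    finally have "E / y \<le> 1/2" using r by simp
    then show "E \<le> y / 2" using y by (simp add: field_simps)
  qed
  note ratio = blockclass_ratio[OF ik(1-4), folded H'_def, folded C_def C'_def E_def]
  have CC: "C \<ge> 0" "C' \<ge> 0" by (simp_all add: C_def C'_def)
  have ln1: "C' > 0" "\<bar>ln C' - ln C - (ln (fwd_mean H i k) - ln (bwd_mean H' i k))\<bar>
      \<le> 2 * (E / fwd_mean H i k) + 2 * (E / bwd_mean H' i k)" if "C > 0"
    using ln_ratio_bound[OF that rel(3)[OF Fbig] rel(3)[OF Bbig] E0 rel(2)[OF Fbig] rel(2)[OF Bbig] ratio] by auto
  \<comment> \<open>The same lemma with the roles of the two classes exchanged yields the other
    direction of the equivalence.\<close>
  have C_pos: "C > 0" if "C' > 0"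
    using ln_ratio_bound(1)[OF that rel(3)[OF Bbig] rel(3)[OF Fbig] E0 rel(2)[OF Bbig] rel(2)[OF Fbig] ratio(2,1)] .
  have C_iff: "C > 0 \<longleftrightarrow> blockclass n s J H \<noteq> {}" "C' > 0 \<longleftrightarrow> blockclass n s J H' \<noteq> {}"
    by (auto simp: C_def C'_def card_gt_0_iff)
  show "blockclass n s J H = {} \<longleftrightarrow> blockclass n s J H' = {}"
    using ln1(1) C_pos C_iff by blast
  show "\<bar>ln (real (card (blockclass n s J H'))) - ln (real (card (blockclass n s J H)))
         - (ln p - ln q) - (expo n s J H' - expo n s J H)\<bar> \<le> step_error" if ne: "blockclass n s J H \<noteq> {}"
  proof -
    have C0: "C > 0" using ne C_iff by simp
    define \<Delta> where "\<Delta> = expo n s J H' - expo n s J H"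
    define L where "L = - (a1 + a2 + b1 + b2) - (a1\<^sup>2 - a2\<^sup>2 + b1\<^sup>2 - b2\<^sup>2) / 2 + z1 - z2"
    have 1: "\<bar>ln C' - ln C - (ln (fwd_mean H i k) - ln (bwd_mean H' i k))\<bar> \<le> 4 * (10 ^ 9 * R ^ 7 * (j * e))"
      using ln1(2)[OF C0] rel(1)[OF Fbig] rel(1)[OF Bbig] by linarith
    have 2: "ln (fwd_mean H i k) - ln (bwd_mean H' i k) = ln p - ln q + (ln Fh - ln Bh)"
    proof -
      have "ln (fwd_mean H i k) = ln (m\<^sup>2) + (ln p + ln p + ln q) + ln Fh"
        unfolding F using pos m_pos Fh8 by (simp add: ln_mult_pos del: ln_powr)
      moreover have "ln (bwd_mean H' i k) = ln (m\<^sup>2) + (ln p + ln q + ln q) + ln Bh"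
        unfolding B using pos m_pos Bh8 by (simp add: ln_mult_pos)
      ultimately show ?thesis by simp
    qed
    have 3: "\<bar>ln Fh - ln Bh - L\<bar> \<le> 8 * t ^ 3 + 4 * w\<^sup>2"
      unfolding Fh_def Bh_def L_def
      by (rule ln_product_expansion[OF ab1(1) ab2(1) ab1(2) ab2(2) zb t_small w_small])
    have 4: "\<bar>L - \<Delta>\<bar> \<le> 70 * R ^ 6 * X"
    proof -
      have nn: "n > 0" using n0 by simp
      have \<Delta>: "\<Delta> = (1 - 2 * lam n s) * e / (lam n s * (1 - lam n s)) - c / (lam n s * (1 - lam n s))
        - e\<^sup>2 / (2 * (lam n s * (1 - lam n s))) - (1 + j) * (u + v + e) / (lam n s * (1 - lam n s))
        - (1 - 2 * lam n s) * (3 * u\<^sup>2 + 3 * u * e + e\<^sup>2 + 3 * v\<^sup>2 + 3 * v * e + e\<^sup>2) / (6 * (lam n s * (1 - lam n s))\<^sup>2)"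
        unfolding \<Delta>_def H'_def
        by (subst expo_insert[OF ik(4) finH ik(1,2) nn])
           (simp only: u_def v_def c_def j_def e_def \<alpha>_def \<beta>_def ch_def)
      have pl: "p - lam n s = p * e"
        using n_large by (simp add: pp_def lam_def e_def field_simps)
      show ?thesis
        unfolding L_def \<Delta> a1_def a2_def b1_def b2_def z1_def z2_def X_def \<mu>_def
        by (rule exponent_increment[OF uv cb e0 ej _ _ pl R_ge p_lower q_lower l_lower l_upper])
           (use j_small in auto)
    qed
    have R6: "1 \<le> R ^ 6" "R ^ 3 \<le> R ^ 6" "R ^ 2 \<le> R ^ 6" "R ^ 6 \<le> R ^ 7"
      using R_ge by (auto intro: power_increasing one_le_power)
    have 5: "8 * t ^ 3 \<le> 512 * (R ^ 6 * X)"
    proof -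
      have "8 * t ^ 3 = 512 * (R ^ 3 * j ^ 3)" by (simp add: t_def power_mult_distrib)
      also have "\<dots> \<le> 512 * (R ^ 6 * X)" using R6 je0 j0 R_ge by (intro mult_left_mono mult_mono) auto
      finally show ?thesis .
    qed
    have 6: "4 * w\<^sup>2 \<le> 1352 * (R ^ 6 * X)"
    proof -
      have "(e + j\<^sup>2)\<^sup>2 \<le> 2 * (e\<^sup>2 + (j\<^sup>2)\<^sup>2)"
        using sum_squares_bound[of e "j\<^sup>2"] by (simp add: power2_sum)
      moreover have "(j\<^sup>2)\<^sup>2 \<le> j ^ 3"
        using j0 e1 by (simp flip: power_mult) (rule power_decreasing; simp)
      ultimately have "(e + j\<^sup>2)\<^sup>2 \<le> 2 * X" using je0(3) unfolding X_def by argo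
      then have "R\<^sup>2 * (e + j\<^sup>2)\<^sup>2 \<le> R\<^sup>2 * (2 * X)" by (rule mult_left_mono) simp
      moreover have "4 * w\<^sup>2 = 676 * (R\<^sup>2 * (e + j\<^sup>2)\<^sup>2)" by (simp add: w_def power_mult_distrib)
      ultimately have "4 * w\<^sup>2 \<le> 676 * (R\<^sup>2 * (2 * X))" by linarith
      also have "\<dots> \<le> 676 * (R ^ 6 * (2 * X))" using R6 je0 by (intro mult_left_mono mult_right_mono) auto
      finally show ?thesis by simp
    qed
    have "\<bar>ln C' - ln C - (ln p - ln q) - \<Delta>\<bar> \<le> 4 * (10 ^ 9 * R ^ 7 * (j * e)) + (8 * t ^ 3 + 4 * w\<^sup>2) + 70 * R ^ 6 * X"
    proof -
      have "\<bar>d - k - \<Delta>'\<bar> \<le> x1 + x2 + x3"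
        if "\<bar>d - (k + f)\<bar> \<le> x1" "\<bar>f - l\<bar> \<le> x2" "\<bar>l - \<Delta>'\<bar> \<le> x3" for d k \<Delta>' f l x1 x2 x3 :: real
        using that by linarith
      from this[OF 1[unfolded 2] 3 4] show ?thesis .
    qed
    also have "\<dots> \<le> 4 * (10 ^ 9 * (R ^ 7 * X)) + (512 * (R ^ 7 * X) + 1352 * (R ^ 7 * X)) + 70 * (R ^ 7 * X)"
    proof (intro add_mono)
      have RX: "R ^ 6 * X \<le> R ^ 7 * X" using R6 je0 by (intro mult_right_mono) auto
      show "8 * t ^ 3 \<le> 512 * (R ^ 7 * X)" "4 * w\<^sup>2 \<le> 1352 * (R ^ 7 * X)" "70 * R ^ 6 * X \<le> 70 * (R ^ 7 * X)"
        using 5 6 RX by linarith+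
      have "R ^ 7 * (j * e) \<le> R ^ 7 * X" using je0 R_ge by (intro mult_left_mono) auto
      then show "4 * (10 ^ 9 * R ^ 7 * (j * e)) \<le> 4 * (10 ^ 9 * (R ^ 7 * X))" by simp
    qed
    also have "\<dots> \<le> 10 ^ 10 * (R ^ 7 * X)"
    proof -
      have "0 \<le> R ^ 7 * X" using je0 R_ge by simp
      then show ?thesis by (simp add: mult.commute)
    qed
    finally show ?thesis
      by (simp add: step_error_def C_def C'_def \<Delta>_def X_def j_def e_def)
  qed
qed

end

section \<open>Moments of the degree deviations\<close>

text \<open>The witness is the circulant digraph with arcs from \<open>a\<close> to a + 1, ..., a +
  s modulo n; \<open>s < n\<close> prevents loops.\<close>

lemma regular_digraphs_nonempty:
  assumes "s < n"
  shows "regular_digraphs n s \<noteq> {}"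
proof -
  define G where "G = {(a, b). a < n \<and> (\<exists>d\<in>{1..s}. b = (a + d) mod n)}"
  have n: "n > 0" using assms by simp
  have inj: "inj_on (\<lambda>d. (a + d) mod n) {1..s}" for a
  proof (rule linorder_inj_onI')
    fix d d' assume d: "d \<in> {1..s}" "d' \<in> {1..s}" "d < d'"
    then have "\<not> n dvd d' - d" using assms by (auto dest: dvd_imp_le)
    then have "(a + d') mod n \<noteq> (a + d) mod n" using d mod_eq_dvd_iff_nat[of "a + d" "a + d'" n] by simp
    then show "(a + d) mod n \<noteq> (a + d') mod n" by simp
  qed
  have "outdeg G a = s" if "a < n" for a
  proof -
    have "{w. (a, w) \<in> G} = (\<lambda>d. (a + d) mod n) ` {1..s}" using that by (auto simp: G_def)
    then have "outdeg G a = card {1..s}" unfolding outdeg_def by (simp only: card_image[OF inj])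
    then show ?thesis by simp
  qed
  moreover have "indeg G b = s" if b: "b < n" for b
  proof -
    \<comment> \<open>The in-neighbours of \<open>b\<close> are b - d modulo n; adding
      \<open>n\<close> avoids truncated subtraction.\<close>
    have "bij_betw (\<lambda>d. (b + n - d) mod n) {1..s} {u. (u, b) \<in> G}"
      unfolding bij_betw_def
    proof
      show "inj_on (\<lambda>d. (b + n - d) mod n) {1..s}"
      proof (rule inj_onI)
        fix d d' assume d: "d \<in> {1..s}" "d' \<in> {1..s}" and eq: "(b + n - d) mod n = (b + n - d') mod n"
        have ret: "((b + n - x) mod n + x) mod n = b" if "x \<in> {1..s}" for x
        proof -
          have "((b + n - x) mod n + x) mod n = (b + n - x + x) mod n" by (rule mod_add_left_eq)
          then show ?thesis using that assms b by simp
        qed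
        have "((b + n - d) mod n + d) mod n = ((b + n - d) mod n + d') mod n"
          using ret[OF d(1)] ret[OF d(2)] eq by simp
        then show "d = d'" using d by (rule inj_onD[OF inj])
      qed
      show "(\<lambda>d. (b + n - d) mod n) ` {1..s} = {u. (u, b) \<in> G}"
      proof (intro equalityI subsetI)
        fix u assume "u \<in> (\<lambda>d. (b + n - d) mod n) ` {1..s}"
        then obtain d where d: "d \<in> {1..s}" "u = (b + n - d) mod n" by blast
        have "(u + d) mod n = (b + n - d + d) mod n" unfolding d(2) by (rule mod_add_left_eq)
        then have "b = (u + d) mod n" using d assms b by simp
        moreover have "u < n" using d n by simp
        ultimately show "u \<in> {u. (u, b) \<in> G}" using d(1) by (auto simp only: G_def)
      next
        fix u assume "u \<in> {u. (u, b) \<in> G}"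
        then obtain d where d: "u < n" "d \<in> {1..s}" "b = (u + d) mod n" by (auto simp: G_def)
        have "(b + n - d) mod n = (b + (n - d)) mod n" using d assms by simp
        also have "\<dots> = (u + d + (n - d)) mod n" unfolding d(3) by (rule mod_add_left_eq)
        also have "\<dots> = u" using d assms by simp
        finally show "u \<in> (\<lambda>d. (b + n - d) mod n) ` {1..s}" using d(2) by (intro image_eqI) auto
      qed
    qed
    from bij_betw_same_card[OF this] show ?thesis by (simp add: indeg_def)
  qed
  moreover have "simple_digraph n G"
  proof -
    have "(a + d) mod n \<noteq> a" if "a < n" "d \<in> {1..s}" for a d
      using that assms by (cases "a + d < n") (auto simp: mod_if)
    then have "a \<noteq> b" if "(a, b) \<in> G" for a b using that unfolding G_def by (simp only: mem_Collect_eq case_prod_conv) metis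
    moreover have "G \<subseteq> {0..<n} \<times> {0..<n}" using n by (auto simp: G_def)
    ultimately show ?thesis by (auto simp only: simple_digraph_def)
  qed
  ultimately have "G \<in> regular_digraphs n s" by (simp add: regular_digraphs_def)
  then show ?thesis by blast
qed

section \<open>Symmetry of the random regular digraph\<close>

definition relabel :: "(nat \<Rightarrow> nat) \<Rightarrow> (nat \<times> nat) set \<Rightarrow> (nat \<times> nat) set" where
  "relabel t G = {(a, b). (t a, t b) \<in> G}"

lemma ent_relabel: "ent (relabel t G) a b = ent G (t a) (t b)"
  by (simp add: ent_def relabel_def)

lemma relabel_regular:
  assumes k: "k < n" "k' < n" and G: "G \<in> regular_digraphs n s"
  shows "relabel (Transposition.transpose k k') G \<in> regular_digraphs n s"
proof -
  let ?t = "Transposition.transpose k k'"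
  have bij: "bij_betw ?t {..<n} {..<n}"
    using k by (intro permutes_imp_bij permutes_swap_id) auto
  then have lt: "?t a < n \<longleftrightarrow> a < n" for a
    using k by (auto simp: Transposition.transpose_def)
  have "simple_digraph n (relabel ?t G)"
    using G lt by (fastforce simp: regular_digraphs_def simple_digraph_def relabel_def)
  moreover have "(\<Sum>c<n. ent G (?t v) (?t c)) = (\<Sum>c<n. ent G (?t v) c)"
    "(\<Sum>c<n. ent G (?t c) (?t v)) = (\<Sum>c<n. ent G c (?t v))" for v
    by (rule sum.reindex_bij_betw[OF bij])+
  ultimately show ?thesis using G lt by (simp add: regular_iff_ent ent_relabel)
qed

text \<open>The uniform law is invariant under exchanging two vertex names. Prescribing the block
  generally destroys this symmetry, so it serves only the overall normalisation.\<close>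

lemma sum_regular_relabel:
  assumes k: "k < n" "k' < n"
  shows "(\<Sum>G\<in>regular_digraphs n s. f (relabel (Transposition.transpose k k') G)) = (\<Sum>G\<in>regular_digraphs n s. f G)"
  by (rule sum.reindex_bij_witness[of _ "relabel (Transposition.transpose k k')" "relabel (Transposition.transpose k k')"])
     (use relabel_regular[OF k] in \<open>auto simp: relabel_def\<close>)

lemma regular_arc_mean:
  assumes ab: "a < n" "b < n" "a \<noteq> b"
  shows "(\<Sum>G\<in>regular_digraphs n s. ent G a b) = pp n s * real (card (regular_digraphs n s))"
proof -
  let ?T = "regular_digraphs n s"
  have sym: "(\<Sum>G\<in>?T. ent G a k) = (\<Sum>G\<in>?T. ent G a b)" if "k \<in> {..<n} - {a}" for k
    using sum_regular_relabel[of k n b "\<lambda>G. ent G a b" s] that ab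
    by (simp add: ent_relabel Transposition.transpose_def)
  have "(\<Sum>G\<in>?T. real s) = (\<Sum>G\<in>?T. \<Sum>k\<in>{..<n} - {a}. ent G a k)"
  proof (rule sum.cong)
    fix G assume "G \<in> ?T"
    then have "(\<Sum>k<n. ent G a k) = real s" "ent G a a = 0"
      using ab by (auto simp: regular_iff_ent simple_digraph_def ent_def)
    then show "real s = (\<Sum>k\<in>{..<n} - {a}. ent G a k)" using ab by (simp add: sum_diff1)
  qed simp
  also have "\<dots> = (\<Sum>k\<in>{..<n} - {a}. \<Sum>G\<in>?T. ent G a b)"
    by (subst sum.swap) (intro sum.cong refl sym)
  also have "\<dots> = (real n - 1) * (\<Sum>G\<in>?T. ent G a b)"
    using ab by (simp add: of_nat_diff)
  finally show ?thesis using ab by (simp add: pp_def field_simps)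
qed

text \<open>Given the arc (a, c), row \<open>a\<close> has \<open>s - 1\<close> further arcs, which
  by symmetry are spread evenly over the \<open>n - 2\<close> other vertices.\<close>

lemma regular_two_arcs_mean:
  assumes ab: "a < n" "b < n" "c < n" "a \<noteq> b" "a \<noteq> c" "b \<noteq> c"
  shows "(\<Sum>G\<in>regular_digraphs n s. ent G a b * ent G a c) =
    pp n s * ((real s - 1) / (real n - 2)) * real (card (regular_digraphs n s))"
proof -
  let ?T = "regular_digraphs n s"
  have sym: "(\<Sum>G\<in>?T. ent G a k * ent G a c) = (\<Sum>G\<in>?T. ent G a b * ent G a c)" if "k \<in> {..<n} - {a, c}" for k
    using sum_regular_relabel[of k n b "\<lambda>G. ent G a b * ent G a c" s] that ab
    by (simp add: ent_relabel Transposition.transpose_def)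
  have "(real s - 1) * (\<Sum>G\<in>?T. ent G a c) = (\<Sum>G\<in>?T. \<Sum>k\<in>{..<n} - {a, c}. ent G a k * ent G a c)"
    unfolding sum_distrib_left
  proof (rule sum.cong)
    fix G assume "G \<in> ?T"
    then have "(\<Sum>k<n. ent G a k) = real s" "ent G a a = 0"
      using ab by (auto simp: regular_iff_ent simple_digraph_def ent_def)
    then have "(\<Sum>k\<in>{..<n} - {a, c}. ent G a k) = real s - ent G a c"
      using ab sum.subset_diff[of "{a, c}" "{..<n}" "\<lambda>k. ent G a k"] by simp
    then have "(\<Sum>k\<in>{..<n} - {a, c}. ent G a k * ent G a c) = (real s - ent G a c) * ent G a c"
      by (simp flip: sum_distrib_right)
    then show "(real s - 1) * ent G a c = (\<Sum>k\<in>{..<n} - {a, c}. ent G a k * ent G a c)"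
      by (simp add: left_diff_distrib)
  qed simp
  also have "\<dots> = (\<Sum>k\<in>{..<n} - {a, c}. \<Sum>G\<in>?T. ent G a b * ent G a c)"
    by (subst sum.swap) (intro sum.cong refl sym)
  also have "\<dots> = (real n - 2) * (\<Sum>G\<in>?T. ent G a b * ent G a c)"
    using ab by (simp add: card_Diff_subset of_nat_diff)
  finally have eq: "(real n - 2) * (\<Sum>G\<in>?T. ent G a b * ent G a c)
      = (real s - 1) * (pp n s * real (card ?T))"
    using regular_arc_mean[of a n c s] ab by simp
  have "card {a, b, c} \<le> card {..<n}" using ab by (intro card_mono) auto
  then have "real n - 2 > 0" using ab by simp
  then show ?thesis using eq by (simp add: field_simps)
qed

text \<open>The weights are those of independent arcs. In the product of the factors p + (1 - p),
  the summand 1 - p is replaced by 0 on \<open>A\<close>, so that the expansion keeps exactly the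
  supersets of \<open>A\<close>.\<close>

lemma sum_Pow_bernoulli:
  fixes p :: real
  assumes "finite E" "A \<subseteq> E"
  shows "(\<Sum>H\<in>Pow E. p ^ card H * (1 - p) ^ (card E - card H) * of_bool (A \<subseteq> H)) = p ^ card A"
proof -
  have "(\<Prod>x\<in>E. p + (if x \<in> A then 0 else 1 - p)) =
    (\<Sum>H\<in>Pow E. (\<Prod>x\<in>H. p) * (\<Prod>x\<in>E - H. if x \<in> A then 0 else 1 - p))"
    by (rule prod_add) (rule assms(1))
  also have "\<dots> = (\<Sum>H\<in>Pow E. p ^ card H * (1 - p) ^ (card E - card H) * of_bool (A \<subseteq> H))"
  proof (rule sum.cong)
    fix H assume H: "H \<in> Pow E"
    then have fH: "finite H" using assms finite_subset by blast
    have "(\<Prod>x\<in>E - H. if x \<in> A then 0 else 1 - p) = (1 - p) ^ (card E - card H) * of_bool (A \<subseteq> H)"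
    proof (cases "A \<subseteq> H")
      case True
      then have "(\<Prod>x\<in>E - H. if x \<in> A then 0 else 1 - p) = (\<Prod>x\<in>E - H. 1 - p)"
        by (intro prod.cong) auto
      then show ?thesis using True H fH by (simp add: card_Diff_subset)
    next
      case False
      then obtain x where "x \<in> A" "x \<notin> H" by blast
      then have "(\<Prod>x\<in>E - H. if x \<in> A then 0 else 1 - p) = 0"
        using assms by (intro prod_zero) auto
      then show ?thesis using False by simp
    qed
    then show "(\<Prod>x\<in>H. p) * (\<Prod>x\<in>E - H. if x \<in> A then 0 else 1 - p) =
      p ^ card H * (1 - p) ^ (card E - card H) * of_bool (A \<subseteq> H)" by simp
  qed simp
  also have "(\<Prod>x\<in>E. p + (if x \<in> A then 0 else 1 - p)) = (\<Prod>x\<in>A. p)"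
    using assms by (intro prod.mono_neutral_cong_right) auto
  finally show ?thesis by simp
qed

definition offdiag :: "nat \<Rightarrow> (nat \<times> nat) set" where
  "offdiag J = {(a, b). a < J \<and> b < J \<and> a \<noteq> b}"

lemma finite_offdiag [simp]: "finite (offdiag J)"
  by (rule finite_subset[of _ "{..<J} \<times> {..<J}"]) (auto simp: offdiag_def)

lemma card_offdiag: "card (offdiag J) = J * (J - 1)"
proof -
  have "offdiag J = (SIGMA a:{..<J}. {..<J} - {a})" by (auto simp: offdiag_def)
  then show ?thesis by simp
qed

text \<open>Only the total mass and the means of single arcs and of pairs with a common tail enter,
  so the same computation serves the independent weights and the true law. \<open>V\<close> is the
  variance of an out-degree inside the block.\<close>

lemma chi_moments:
  fixes w :: "(nat \<times> nat) set \<Rightarrow> real"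
  assumes total: "(\<Sum>H\<in>Pow (offdiag J). w H) = 1"
    and single: "\<And>a b. a < J \<Longrightarrow> b < J \<Longrightarrow> a \<noteq> b \<Longrightarrow> (\<Sum>H\<in>Pow (offdiag J). w H * ent H a b) = pp n s"
    and double: "\<And>a b c. a < J \<Longrightarrow> b < J \<Longrightarrow> c < J \<Longrightarrow> a \<noteq> b \<Longrightarrow> a \<noteq> c \<Longrightarrow> b \<noteq> c \<Longrightarrow>
      (\<Sum>H\<in>Pow (offdiag J). w H * (ent H a b * ent H a c)) = d"
  defines "V \<equiv> (real J - 1) * pp n s + (real J - 1) * (real J - 2) * d - (pp n s * (real J - 1))\<^sup>2"
  shows "(\<Sum>H\<in>Pow (offdiag J). w H * chi n s J H 1) = 0"
    and "(\<Sum>H\<in>Pow (offdiag J). w H * chi n s J H 2) = real J * V"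
proof -
  let ?P = "Pow (offdiag J)"
  define \<mu> where "\<mu> = pp n s * (real J - 1)"
  have od: "real (outdeg H a) = (\<Sum>b\<in>{..<J} - {a}. ent H a b)" if "H \<in> ?P" "a < J" for H a
  proof -
    have "H \<subseteq> {0..<J} \<times> {0..<J}" "ent H a a = 0" using that by (auto simp: offdiag_def ent_def)
    then show ?thesis using that by (simp add: outdeg_ent sum_diff1)
  qed
  have cJ: "real (card ({..<J} - {a})) = real J - 1" if "a < J" for a
    using that by (simp add: of_nat_diff)
  have E1: "(\<Sum>H\<in>?P. w H * real (outdeg H a)) = \<mu>" if a: "a < J" for a
  proof -
    have "(\<Sum>H\<in>?P. w H * real (outdeg H a)) = (\<Sum>H\<in>?P. \<Sum>b\<in>{..<J} - {a}. w H * ent H a b)"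
      using a by (intro sum.cong refl) (simp add: od sum_distrib_left)
    also have "\<dots> = (\<Sum>b\<in>{..<J} - {a}. \<Sum>H\<in>?P. w H * ent H a b)" by (rule sum.swap)
    also have "\<dots> = (\<Sum>b\<in>{..<J} - {a}. pp n s)" using a by (intro sum.cong refl single) auto
    finally show ?thesis using cJ[OF a] unfolding sum_constant by (simp add: \<mu>_def)
  qed
  have E2: "(\<Sum>H\<in>?P. w H * (real (outdeg H a))\<^sup>2) = (real J - 1) * pp n s + (real J - 1) * (real J - 2) * d"
    if a: "a < J" for a
  proof -
    let ?B = "{..<J} - {a}"
    have "(\<Sum>H\<in>?P. w H * (real (outdeg H a))\<^sup>2) = (\<Sum>H\<in>?P. \<Sum>b\<in>?B. \<Sum>c\<in>?B. w H * (ent H a b * ent H a c))"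
    proof (rule sum.cong)
      fix H assume H: "H \<in> ?P"
      show "w H * (real (outdeg H a))\<^sup>2 = (\<Sum>b\<in>?B. \<Sum>c\<in>?B. w H * (ent H a b * ent H a c))"
        unfolding od[OF H a] power2_eq_square sum_product by (simp only: sum_distrib_left)
    qed simp
    also have "\<dots> = (\<Sum>b\<in>?B. \<Sum>c\<in>?B. \<Sum>H\<in>?P. w H * (ent H a b * ent H a c))"
      by (subst sum.swap, rule sum.cong, simp, rule sum.swap)
    also have "\<dots> = (\<Sum>b\<in>?B. \<Sum>c\<in>?B. if b = c then pp n s else d)"
      using a by (intro sum.cong refl) (auto simp: single double)
    also have "\<dots> = (\<Sum>b\<in>?B. pp n s + (real J - 2) * d)"
    proof (rule sum.cong)
      fix b assume b: "b \<in> ?B"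
      have "(\<Sum>c\<in>?B. if b = c then pp n s else d) = pp n s + (\<Sum>c\<in>?B - {b}. d)"
        using b by (subst sum.remove[of _ b]) auto
      moreover have "real (card (?B - {b})) = real J - 2"
        using b a by (simp add: of_nat_diff)
      ultimately show "(\<Sum>c\<in>?B. if b = c then pp n s else d) = pp n s + (real J - 2) * d" by simp
    qed simp
    finally show ?thesis using cJ[OF a] unfolding sum_constant by (simp add: algebra_simps)
  qed
  have "(\<Sum>H\<in>?P. w H * chi n s J H 1) = (\<Sum>H\<in>?P. \<Sum>a<J. w H * real (outdeg H a) - \<mu> * w H)"
    by (intro sum.cong refl) (simp add: chi_def \<mu>_def sum_distrib_left algebra_simps)
  also have "\<dots> = (\<Sum>a<J. (\<Sum>H\<in>?P. w H * real (outdeg H a)) - \<mu> * (\<Sum>H\<in>?P. w H))"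
    by (subst sum.swap) (simp add: sum_subtractf sum_distrib_left)
  also have "\<dots> = 0" using E1 total by simp
  finally show "(\<Sum>H\<in>?P. w H * chi n s J H 1) = 0" .
  have "(\<Sum>H\<in>?P. w H * chi n s J H 2) = (\<Sum>H\<in>?P. \<Sum>a<J. w H * (real (outdeg H a))\<^sup>2
      - 2 * \<mu> * (w H * real (outdeg H a)) + \<mu>\<^sup>2 * w H)"
  proof (intro sum.cong refl)
    fix H
    have "w H * (x - \<mu>)\<^sup>2 = w H * x\<^sup>2 - 2 * \<mu> * (w H * x) + \<mu>\<^sup>2 * w H" for x :: real
      by (simp add: power2_eq_square algebra_simps)
    then show "w H * chi n s J H 2 = (\<Sum>a<J. w H * (real (outdeg H a))\<^sup>2
      - 2 * \<mu> * (w H * real (outdeg H a)) + \<mu>\<^sup>2 * w H)"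
      unfolding chi_def \<mu>_def[symmetric] sum_distrib_left by simp
  qed
  also have "\<dots> = (\<Sum>a<J. (\<Sum>H\<in>?P. w H * (real (outdeg H a))\<^sup>2)
      - 2 * \<mu> * (\<Sum>H\<in>?P. w H * real (outdeg H a)) + \<mu>\<^sup>2 * (\<Sum>H\<in>?P. w H))"
    by (subst sum.swap) (simp add: sum_subtractf sum.distrib sum_distrib_left)
  also have "\<dots> = (\<Sum>a<J. V)"
    using E1 E2 total by (intro sum.cong refl) (simp add: V_def \<mu>_def[symmetric] power2_eq_square)
  finally show "(\<Sum>H\<in>?P. w H * chi n s J H 2) = real J * V" by simp
qed

lemma sum_blockclasses:
  fixes f :: "(nat \<times> nat) set \<Rightarrow> real"
  shows "(\<Sum>H\<in>Pow (offdiag J). \<Sum>G\<in>blockclass n s J H. f G) = (\<Sum>G\<in>regular_digraphs n s. f G)"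
proof -
  have "induced G J \<in> Pow (offdiag J)" if "G \<in> regular_digraphs n s" for G
    using that by (auto simp: regular_digraphs_def simple_digraph_def induced_def offdiag_def)
  then show ?thesis
    unfolding blockclass_def
    by (intro sum.group) (auto simp: finite_regular)
qed

text \<open>Cauchy-Schwarz and the trivial bound \<open>J\<close> on deviations reduce the quadratic
  and cubic terms of the exponent to second moments, the only ones known exactly.\<close>

lemma chi_2_bounds:
  assumes "\<And>i. \<bar>real (outdeg H i) - pp n s * (real J - 1)\<bar> \<le> real J"
  shows "0 \<le> chi n s J H 2" "(chi n s J H 1)\<^sup>2 \<le> real J * chi n s J H 2"
    "\<bar>chi n s J H 3\<bar> \<le> real J * chi n s J H 2"
proof -
  let ?d = "\<lambda>i. real (outdeg H i) - pp n s * (real J - 1)"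
  show "0 \<le> chi n s J H 2" by (simp add: chi_def sum_nonneg)
  show "(chi n s J H 1)\<^sup>2 \<le> real J * chi n s J H 2"
    using sum_squared_le_sum_of_squares[of ?d "{..<J}"] by (simp add: chi_def mult.commute)
  have "\<bar>chi n s J H 3\<bar> \<le> (\<Sum>i<J. \<bar>?d i ^ 3\<bar>)" unfolding chi_def by (rule sum_abs)
  also have "\<dots> \<le> (\<Sum>i<J. real J * (?d i)\<^sup>2)"
  proof (rule sum_mono)
    fix i
    have "\<bar>?d i ^ 3\<bar> = \<bar>?d i\<bar> * (?d i)\<^sup>2" by (simp add: power3_eq_cube power2_eq_square abs_mult)
    also have "\<dots> \<le> real J * (?d i)\<^sup>2" by (intro mult_right_mono assms) simp
    finally show "\<bar>?d i ^ 3\<bar> \<le> real J * (?d i)\<^sup>2" .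
  qed
  also have "\<dots> = real J * chi n s J H 2" by (simp add: chi_def sum_distrib_left)
  finally show "\<bar>chi n s J H 3\<bar> \<le> real J * chi n s J H 2" .
qed

context regular_block
begin

definition \<mu> :: "(nat \<times> nat) set \<Rightarrow> real" where
  "\<mu> H = p ^ card H * q ^ (J * (J - 1) - card H)"

definition T :: real where "T = real (card (regular_digraphs n s))"

definition P :: "(nat \<times> nat) set \<Rightarrow> real" where
  "P H = real (card (blockclass n s J H)) / T"

lemma s_less: "s < n"
proof -
  have "lam n s < 1" using pos by simp
  then show ?thesis using n0 by (simp add: lam_def)
qed

lemma T_pos: "T > 0"
  using regular_digraphs_nonempty[OF s_less] by (simp add: T_def card_gt_0_iff finite_regular)

lemma offdiag_block: "H \<in> Pow (offdiag J) \<Longrightarrow> H \<subseteq> {0..<J} \<times> {0..<J}"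
  by (auto simp: offdiag_def)

lemma sum_P_class:
  assumes "\<And>G H. G \<in> blockclass n s J H \<Longrightarrow> f H = g G"
  shows "(\<Sum>H\<in>Pow (offdiag J). P H * f H) = (\<Sum>G\<in>regular_digraphs n s. g G) / T"
proof -
  have "P H * f H = (\<Sum>G\<in>blockclass n s J H. g G) / T" for H
  proof -
    have "(\<Sum>G\<in>blockclass n s J H. g G) = (\<Sum>G\<in>blockclass n s J H. f H)"
      using assms by (intro sum.cong) auto
    then show ?thesis by (simp add: P_def)
  qed
  then show ?thesis
    by (simp add: sum_blockclasses flip: sum_divide_distrib)
qed

lemma sum_P: "(\<Sum>H\<in>Pow (offdiag J). P H) = 1"
  using sum_P_class[of "\<lambda>_. 1" "\<lambda>_. 1"] T_pos by (simp add: T_def)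

lemma sum_\<mu>_subset:
  assumes "A \<subseteq> offdiag J"
  shows "(\<Sum>H\<in>Pow (offdiag J). \<mu> H * of_bool (A \<subseteq> H)) = p ^ card A"
  unfolding \<mu>_def card_offdiag[symmetric] by (rule sum_Pow_bernoulli) (use assms in auto)

lemma sum_\<mu>: "(\<Sum>H\<in>Pow (offdiag J). \<mu> H) = 1"
  using sum_\<mu>_subset[of "{}"] by simp

lemma \<mu>_single:
  assumes "a < J" "b < J" "a \<noteq> b"
  shows "(\<Sum>H\<in>Pow (offdiag J). \<mu> H * ent H a b) = p"
  using sum_\<mu>_subset[of "{(a, b)}"] assms by (simp add: offdiag_def ent_def del: sum_mult_of_bool_eq)

lemma \<mu>_double:
  assumes "(a, b) \<in> offdiag J" "(a', b') \<in> offdiag J" "(a, b) \<noteq> (a', b')"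
  shows "(\<Sum>H\<in>Pow (offdiag J). \<mu> H * (ent H a b * ent H a' b')) = p\<^sup>2"
proof -
  have "card {(a, b), (a', b')} = 2" using assms(3) by simp
  moreover have "ent H a b * ent H a' b' = of_bool ({(a, b), (a', b')} \<subseteq> H)" for H
    by (simp add: ent_def)
  ultimately show ?thesis
    using sum_\<mu>_subset[of "{(a, b), (a', b')}"] assms by (simp del: sum_mult_of_bool_eq)
qed

lemma sum_Pow_converse:
  "(\<Sum>H\<in>Pow (offdiag J). f (H\<inverse>)) = (\<Sum>H\<in>Pow (offdiag J). f H)" for f :: "_ \<Rightarrow> real"
  by (rule sum.reindex_bij_witness[of _ converse converse]) (auto simp: offdiag_def)

lemma chi'_moments:
  assumes conv: "\<And>H. w (H\<inverse>) = w H"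
    and "(\<Sum>H\<in>Pow (offdiag J). w H * chi n s J H 2) = x"
  shows "(\<Sum>H\<in>Pow (offdiag J). w H * chi' n s J H 2) = x"
  using sum_Pow_converse[of "\<lambda>H. w H * chi n s J H 2"] assms by (simp add: chi'_converse)

lemma \<mu>_moments:
  "(\<Sum>H\<in>Pow (offdiag J). \<mu> H * chi n s J H 1) = 0"
  "(\<Sum>H\<in>Pow (offdiag J). \<mu> H * chi n s J H 2) = real J * ((real J - 1) * (p * q))"
  "(\<Sum>H\<in>Pow (offdiag J). \<mu> H * chi' n s J H 2) = real J * ((real J - 1) * (p * q))"
proof -
  have d: "(\<Sum>H\<in>Pow (offdiag J). \<mu> H * (ent H a b * ent H a c)) = p\<^sup>2"
    if "a < J" "b < J" "c < J" "a \<noteq> b" "a \<noteq> c" "b \<noteq> c" for a b c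
    using that by (intro \<mu>_double) (auto simp: offdiag_def)
  note mom = chi_moments[where w = \<mu>, OF sum_\<mu> \<mu>_single d]
  show "(\<Sum>H\<in>Pow (offdiag J). \<mu> H * chi n s J H 1) = 0" by (rule mom(1))
  show 2: "(\<Sum>H\<in>Pow (offdiag J). \<mu> H * chi n s J H 2) = real J * ((real J - 1) * (p * q))"
    by (subst mom(2)) (simp_all add: power2_eq_square algebra_simps)
  show "(\<Sum>H\<in>Pow (offdiag J). \<mu> H * chi' n s J H 2) = real J * ((real J - 1) * (p * q))"
    by (rule chi'_moments[OF _ 2]) (simp add: \<mu>_def card_inverse)
qed

text \<open>An out-degree inside the block has the variance of a hypergeometric variable:
  \<open>s\<close> arcs placed on \<open>n - 1\<close> vertices, \<open>J - 1\<close> of them in the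
  block. The factor (n - J)/(n - 2) is the finite population correction.\<close>

lemma P_moments:
  "(\<Sum>H\<in>Pow (offdiag J). P H * chi n s J H 1) = 0"
  "(\<Sum>H\<in>Pow (offdiag J). P H * chi n s J H 2) = real J * ((real J - 1) * (p * q) * ((real n - real J) / (real n - 2)))"
  "(\<Sum>H\<in>Pow (offdiag J). P H * chi' n s J H 2) = real J * ((real J - 1) * (p * q) * ((real n - real J) / (real n - 2)))"
proof -
  define c where "c = p * ((real s - 1) / (real n - 2))"
  have s1: "(\<Sum>H\<in>Pow (offdiag J). P H * ent H a b) = p" if "a < J" "b < J" "a \<noteq> b" for a b
  proof -
    have "(\<Sum>H\<in>Pow (offdiag J). P H * ent H a b) = (\<Sum>G\<in>regular_digraphs n s. ent G a b) / T"
      by (rule sum_P_class) (use that ent_block in metis)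
    then show ?thesis using regular_arc_mean[of a n b s] that J_le T_pos by (simp add: T_def)
  qed
  have d: "(\<Sum>H\<in>Pow (offdiag J). P H * (ent H a b * ent H a e)) = c"
    if "a < J" "b < J" "e < J" "a \<noteq> b" "a \<noteq> e" "b \<noteq> e" for a b e
  proof -
    have "(\<Sum>H\<in>Pow (offdiag J). P H * (ent H a b * ent H a e)) = (\<Sum>G\<in>regular_digraphs n s. ent G a b * ent G a e) / T"
      by (rule sum_P_class) (use that ent_block in metis)
    then show ?thesis using regular_two_arcs_mean[of a n b e s] that J_le T_pos by (simp add: T_def c_def)
  qed
  note mom = chi_moments[where w = P, OF sum_P s1 d]
  show "(\<Sum>H\<in>Pow (offdiag J). P H * chi n s J H 1) = 0" by (rule mom(1))
  have n2: "real n - 2 > 0" using n_large by simp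
  have V: "(real J - 1) * p + (real J - 1) * (real J - 2) * c - (p * (real J - 1))\<^sup>2
      = (real J - 1) * (p * q) * ((real n - real J) / (real n - 2))"
  proof -
    have "((real J - 1) * p + (real J - 1) * (real J - 2) * c - (p * (real J - 1))\<^sup>2) * (real n - 2)
      = (real J - 1) * p * (real n - 2) + (real J - 1) * (real J - 2) * (c * (real n - 2)) - (p * (real J - 1))\<^sup>2 * (real n - 2)"
      by (simp add: algebra_simps)
    also have "c * (real n - 2) = p * (p * (real n - 1) - 1)"
      using n2 p_n by (simp add: c_def)
    also have "(real J - 1) * p * (real n - 2) + (real J - 1) * (real J - 2) * (p * (p * (real n - 1) - 1))
       - (p * (real J - 1))\<^sup>2 * (real n - 2) = (real J - 1) * (p * q) * (real n - real J)"
      by (simp add: power2_eq_square algebra_simps)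
    finally show ?thesis using n2 by (simp add: field_simps)
  qed
  show 2: "(\<Sum>H\<in>Pow (offdiag J). P H * chi n s J H 2) = real J * ((real J - 1) * (p * q) * ((real n - real J) / (real n - 2)))"
    unfolding V[symmetric] by (rule mom(2))
  show "(\<Sum>H\<in>Pow (offdiag J). P H * chi' n s J H 2) = real J * ((real J - 1) * (p * q) * ((real n - real J) / (real n - 2)))"
    by (rule chi'_moments[OF _ 2]) (simp add: P_def card_blockclass_converse)
qed

definition \<sigma> :: real where "\<sigma> = lam n s * (1 - lam n s)"

lemma \<sigma>_pos: "\<sigma> > 0" using pos by (simp add: \<sigma>_def)

lemma inv_\<sigma>: "1 / \<sigma> \<le> R\<^sup>2" "1 / \<sigma>\<^sup>2 \<le> R ^ 4"
proof -
  have "1 / lam n s \<le> R" "1 / (1 - lam n s) \<le> R"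
    using l_lower l_upper pos R_ge by (auto simp: field_simps)
  then have "1 / lam n s * (1 / (1 - lam n s)) \<le> R * R" using pos R_ge by (intro mult_mono) auto
  then show 1: "1 / \<sigma> \<le> R\<^sup>2" by (simp add: \<sigma>_def power2_eq_square)
  have "(1 / \<sigma>)\<^sup>2 \<le> (R\<^sup>2)\<^sup>2" using 1 \<sigma>_pos by (intro power_mono) auto
  then show "1 / \<sigma>\<^sup>2 \<le> R ^ 4" by (simp add: power_divide flip: power_mult)
qed

lemma pq_\<sigma>: "\<bar>p * q / \<sigma> - 1\<bar> \<le> R\<^sup>2 / real n"
proof -
  have pl: "p - lam n s = p / real n"
    using n_large by (simp add: pp_def lam_def field_simps)
  have "p * q - \<sigma> = (p - lam n s) * (1 - p - lam n s)" by (simp add: \<sigma>_def algebra_simps)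
  then have "\<bar>p * q - \<sigma>\<bar> = p / real n * \<bar>1 - p - lam n s\<bar>"
    using pos n0 by (simp add: pl abs_mult)
  also have "\<dots> \<le> 1 / real n * 1"
    using pos n0 by (intro mult_mono divide_right_mono) auto
  finally have "\<bar>p * q - \<sigma>\<bar> \<le> 1 / real n" by simp
  then have "\<bar>p * q - \<sigma>\<bar> * (1 / \<sigma>) \<le> 1 / real n * R\<^sup>2"
    using inv_\<sigma> \<sigma>_pos n0 by (intro mult_mono) auto
  moreover have "p * q / \<sigma> - 1 = (p * q - \<sigma>) * (1 / \<sigma>)" using \<sigma>_pos by (simp add: field_simps)
  ultimately show ?thesis using \<sigma>_pos by (simp add: abs_mult)
qed

lemma expo_\<sigma>:
  "expo n s J H = real J ^ 2 / real n + (1 - 2 * lam n s) * chi n s J H 1 / (\<sigma> * real n)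
     - (chi n s J H 1)^2 / (2 * \<sigma> * (real n)^2)
     - (real n + real J) * (chi n s J H 2 + chi' n s J H 2) / (2 * \<sigma> * (real n)^2)
     - (1 - 2 * lam n s) * (chi n s J H 3 + chi' n s J H 3) / (6 * \<sigma>^2 * (real n)^2)"
proof -
  have A: "AA n s = \<sigma> / 2" by (simp add: AA_def \<sigma>_def)
  show ?thesis unfolding expo_def A by (simp add: power_divide)
qed

text \<open>Leaves only terms affine in \<open>chi\<close> of orders 1 and 2, whose means are
  available. The squared term has a definite sign and hence costs something in the lower bound
  alone.\<close>

lemma expo_bounds:
  assumes "H \<in> Pow (offdiag J)"
  defines "Y \<equiv> chi n s J H 2 + chi' n s J H 2"
  defines "B \<equiv> real J ^ 2 / real n + (1 - 2 * lam n s) / (\<sigma> * real n) * chi n s J H 1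
      - (real n + real J) / (2 * \<sigma> * (real n)^2) * Y"
  shows "B - real J / (2 * \<sigma> * (real n)^2) * Y - real J / (6 * \<sigma>^2 * (real n)^2) * Y \<le> expo n s J H"
    and "expo n s J H \<le> B + real J / (6 * \<sigma>^2 * (real n)^2) * Y"
proof -
  have H: "H \<subseteq> {0..<J} \<times> {0..<J}" using assms(1) by (rule offdiag_block)
  have H': "H\<inverse> \<subseteq> {0..<J} \<times> {0..<J}" using H by auto
  note c = chi_2_bounds[OF deviation_bounds(1)[OF H]]
  note c' = chi_2_bounds[OF deviation_bounds(1)[OF H'], folded chi'_converse]
  have Y: "0 \<le> chi' n s J H 2" "chi n s J H 2 \<le> Y" using c c' by (auto simp: Y_def)
  have sq: "(chi n s J H 1)\<^sup>2 \<le> real J * Y"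
    using c(2) mult_left_mono[OF Y(2), of "real J"] by simp
  have "\<bar>chi n s J H 3 + chi' n s J H 3\<bar> \<le> real J * Y"
    using c(3) c'(3) by (simp add: Y_def distrib_left abs_le_iff)
  moreover have "\<bar>1 - 2 * lam n s\<bar> \<le> 1" using pos by auto
  ultimately have cub: "\<bar>(1 - 2 * lam n s) * (chi n s J H 3 + chi' n s J H 3)\<bar> \<le> 1 * (real J * Y)"
    by (rule abs_mult_bound[rotated])
  have cub': "\<bar>(1 - 2 * lam n s) * (chi n s J H 3 + chi' n s J H 3) / (6 * \<sigma>^2 * (real n)^2)\<bar>
      \<le> real J / (6 * \<sigma>^2 * (real n)^2) * Y"
    using divide_right_mono[OF cub, of "6 * \<sigma>^2 * (real n)^2"] by simp
  have sq': "(chi n s J H 1)\<^sup>2 / (2 * \<sigma> * (real n)^2) \<le> real J / (2 * \<sigma> * (real n)^2) * Y"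
    using divide_right_mono[OF sq, of "2 * \<sigma> * (real n)^2"] \<sigma>_pos by simp
  have sq0: "0 \<le> (chi n s J H 1)\<^sup>2 / (2 * \<sigma> * (real n)^2)" using \<sigma>_pos by simp
  have B: "expo n s J H = B - (chi n s J H 1)\<^sup>2 / (2 * \<sigma> * (real n)^2)
     - (1 - 2 * lam n s) * (chi n s J H 3 + chi' n s J H 3) / (6 * \<sigma>^2 * (real n)^2)"
    unfolding expo_\<sigma> B_def Y_def by simp
  show "B - real J / (2 * \<sigma> * (real n)^2) * Y - real J / (6 * \<sigma>^2 * (real n)^2) * Y \<le> expo n s J H"
    "expo n s J H \<le> B + real J / (6 * \<sigma>^2 * (real n)^2) * Y"
    unfolding B using cub' sq' sq0 by linarith+
qed

lemma weighted_affine: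
  fixes w :: "(nat \<times> nat) set \<Rightarrow> real"
  assumes "(\<Sum>H\<in>Pow (offdiag J). w H) = 1" "(\<Sum>H\<in>Pow (offdiag J). w H * chi n s J H 1) = 0"
    and "(\<Sum>H\<in>Pow (offdiag J). w H * chi n s J H 2) = V" "(\<Sum>H\<in>Pow (offdiag J). w H * chi' n s J H 2) = V"
  shows "(\<Sum>H\<in>Pow (offdiag J). w H * (a + b * chi n s J H 1 - c * (chi n s J H 2 + chi' n s J H 2))) = a - 2 * c * V"
proof -
  have "(\<Sum>H\<in>Pow (offdiag J). w H * (a + b * chi n s J H 1 - c * (chi n s J H 2 + chi' n s J H 2))) =
    (\<Sum>H\<in>Pow (offdiag J). a * w H + b * (w H * chi n s J H 1) - c * (w H * chi n s J H 2) - c * (w H * chi' n s J H 2))"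
    by (intro sum.cong refl) (simp add: algebra_simps)
  also have "\<dots> = a - 2 * c * V"
    using assms by (simp add: sum.distrib sum_subtractf flip: sum_distrib_left)
  finally show ?thesis .
qed

text \<open>The scale of everything beyond J^2/n and J/n in the mean exponents; of order
  n^(3\<epsilon> - 1/2) when J has order n^(1/2 + \<epsilon>).\<close>

abbreviation \<theta> :: real where "\<theta> \<equiv> real J ^ 3 / (real n)\<^sup>2"

lemma \<theta>_bounds: "0 \<le> \<theta>" "(real J)\<^sup>2 / (real n)\<^sup>2 \<le> \<theta>" "real J ^ 4 / real n ^ 3 \<le> \<theta>"
proof -
  have J1: "1 \<le> real J" "real J \<le> real n" using J_ge J_le by auto
  show "0 \<le> \<theta>" by simp
  have "(real J)\<^sup>2 \<le> real J ^ 3" using J1 by (intro power_increasing) auto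
  then show "(real J)\<^sup>2 / (real n)\<^sup>2 \<le> \<theta>" by (intro divide_right_mono) auto
  have "real J ^ 4 / real n ^ 3 = \<theta> * (real J / real n)"
    using n0 by (simp add: power2_eq_square power3_eq_cube power4_eq_xxxx)
  also have "\<dots> \<le> \<theta> * 1" using J1 n0 by (intro mult_left_mono) auto
  finally show "real J ^ 4 / real n ^ 3 \<le> \<theta>" by simp
qed

lemma R_quartic: "1 \<le> R ^ 4" "R\<^sup>2 \<le> R ^ 4" "0 \<le> R ^ 4"
  using R_ge by (auto intro: one_le_power power_increasing)

text \<open>The second moments contribute about - J^2 p q/(n \<sigma>), and \<open>p * q\<close> is
  close to \<open>\<sigma>\<close>; this cancels the term J^2/n of the exponent. The factor n + J in
  place of n costs one further \<open>\<theta>\<close>.\<close>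

lemma mean_expo_\<mu>: "- (6 * R ^ 4 * \<theta>) \<le> (\<Sum>H\<in>Pow (offdiag J). \<mu> H * expo n s J H)"
proof -
  define V where "V = real J * ((real J - 1) * (p * q))"
  define c where "c = (real n + real J) / (2 * \<sigma> * (real n)^2) + real J / (2 * \<sigma> * (real n)^2) + real J / (6 * \<sigma>^2 * (real n)^2)"
  have \<mu>0: "0 \<le> \<mu> H" for H using pos by (simp add: \<mu>_def)
  have "real J ^ 2 / real n - 2 * c * V = (\<Sum>H\<in>Pow (offdiag J). \<mu> H *
      (real J ^ 2 / real n + (1 - 2 * lam n s) / (\<sigma> * real n) * chi n s J H 1 - c * (chi n s J H 2 + chi' n s J H 2)))"
    by (rule weighted_affine[symmetric]) (use sum_\<mu> \<mu>_moments in \<open>auto simp: V_def\<close>)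
  also have "\<dots> \<le> (\<Sum>H\<in>Pow (offdiag J). \<mu> H * expo n s J H)"
  proof (intro sum_mono mult_left_mono \<mu>0)
    fix H assume "H \<in> Pow (offdiag J)"
    from expo_bounds(1)[OF this]
    show "real J ^ 2 / real n + (1 - 2 * lam n s) / (\<sigma> * real n) * chi n s J H 1
        - c * (chi n s J H 2 + chi' n s J H 2) \<le> expo n s J H"
      unfolding c_def by (simp add: algebra_simps)
  qed
  finally have low: "real J ^ 2 / real n - 2 * c * V \<le> (\<Sum>H\<in>Pow (offdiag J). \<mu> H * expo n s J H)" .
  have J1: "1 \<le> real J" using J_ge by simp
  have V: "0 \<le> V" "V \<le> (real J)\<^sup>2 * (p * q)" "V \<le> (real J)\<^sup>2"
  proof -
    show "0 \<le> V" using pos J1 by (simp add: V_def)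
    have "real J * (real J - 1) * (p * q) \<le> real J * real J * (p * q)"
      using pos J1 by (intro mult_right_mono mult_left_mono) auto
    then show 1: "V \<le> (real J)\<^sup>2 * (p * q)" by (simp add: V_def power2_eq_square)
    have "p * q \<le> 1 * 1" using pos by (intro mult_mono) auto
    then have "(real J)\<^sup>2 * (p * q) \<le> (real J)\<^sup>2 * 1" by (intro mult_left_mono) auto
    then show "V \<le> (real J)\<^sup>2" using 1 by simp
  qed
  have t1: "(real n + real J) / (\<sigma> * (real n)^2) * V \<le> real J ^ 2 / real n + 3 * (R ^ 4 * \<theta>)"
  proof -
    have "(real n + real J) / (\<sigma> * (real n)^2) * V \<le> (real n + real J) / (\<sigma> * (real n)^2) * ((real J)\<^sup>2 * (p * q))"
      using V \<sigma>_pos by (intro mult_left_mono) auto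
    also have "\<dots> = (real n + real J) * (real J)\<^sup>2 / (real n)\<^sup>2 * (p * q / \<sigma>)"
      by (simp add: field_simps)
    also have "\<dots> \<le> (real n + real J) * (real J)\<^sup>2 / (real n)\<^sup>2 * (1 + R\<^sup>2 / real n)"
      using pq_\<sigma> by (intro mult_left_mono) auto
    also have "\<dots> = real J ^ 2 / real n + \<theta> + R\<^sup>2 * ((real J)\<^sup>2 / (real n)\<^sup>2) + R\<^sup>2 * (\<theta> * (1 / real n))"
      using n0 by (simp add: power2_eq_square power3_eq_cube field_simps)
    also have "\<dots> \<le> real J ^ 2 / real n + R ^ 4 * \<theta> + R ^ 4 * \<theta> + R ^ 4 * \<theta>"
    proof (intro add_mono order_refl)
      show "\<theta> \<le> R ^ 4 * \<theta>" using mult_right_mono[OF R_quartic(1) \<theta>_bounds(1)] by simp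
      show "R\<^sup>2 * ((real J)\<^sup>2 / (real n)\<^sup>2) \<le> R ^ 4 * \<theta>"
        using R_quartic \<theta>_bounds by (intro mult_mono) auto
      have "\<theta> * (1 / real n) \<le> \<theta> * 1" using n_large by (intro mult_left_mono) auto
      then show "R\<^sup>2 * (\<theta> * (1 / real n)) \<le> R ^ 4 * \<theta>"
        using R_quartic \<theta>_bounds n0 by (intro mult_mono) auto
    qed
    finally show ?thesis by simp
  qed
  have t2: "real J / (\<sigma> * (real n)^2) * V \<le> R ^ 4 * \<theta>"
  proof -
    have "real J / (\<sigma> * (real n)^2) * V \<le> real J / (\<sigma> * (real n)^2) * (real J)\<^sup>2"
      using V \<sigma>_pos by (intro mult_left_mono) auto
    also have "\<dots> = (1 / \<sigma>) * \<theta>" by (simp add: power2_eq_square power3_eq_cube)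
    also have "\<dots> \<le> R ^ 4 * \<theta>" using inv_\<sigma> R_quartic \<theta>_bounds by (intro mult_right_mono) auto
    finally show ?thesis .
  qed
  have t3: "real J / (\<sigma>^2 * (real n)^2) * V \<le> R ^ 4 * \<theta>"
  proof -
    have "real J / (\<sigma>^2 * (real n)^2) * V \<le> real J / (\<sigma>^2 * (real n)^2) * (real J)\<^sup>2"
      using V by (intro mult_left_mono) auto
    also have "\<dots> = (1 / \<sigma>^2) * \<theta>" by (simp add: power2_eq_square power3_eq_cube)
    also have "\<dots> \<le> R ^ 4 * \<theta>" using inv_\<sigma> \<theta>_bounds by (intro mult_right_mono) auto
    finally show ?thesis .
  qed
  have "2 * c * V = (real n + real J) / (\<sigma> * (real n)^2) * V + real J / (\<sigma> * (real n)^2) * V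
      + (real J / (\<sigma>^2 * (real n)^2) * V) / 3"
    by (simp add: c_def algebra_simps add_divide_distrib)
  moreover have "0 \<le> R ^ 4 * \<theta>" using R_quartic \<theta>_bounds by simp
  moreover have "- (6 * z) \<le> e" if "y = a + b + d / 3" "0 \<le> z" "x - y \<le> e" "a \<le> x + 3 * z" "b \<le> z" "d \<le> z"
    for a b d e x y z :: real using that by linarith
  note this[OF _ _ low t1 t2 t3]
  ultimately show ?thesis by (simp only: mult.assoc)
qed

text \<open>Under the true law the variance carries n - J, and (n + J)(n - J) = n^2 - J^2, so J^2/n
  cancels up to J^4/n^3. The remainder J/n stems from J(J - 1) in place of J^2.\<close>

lemma mean_expo_P: "(\<Sum>H\<in>Pow (offdiag J). P H * expo n s J H) \<le> real J / real n + 4 * R ^ 4 * \<theta>"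
proof -
  define V where "V = real J * ((real J - 1) * (p * q) * ((real n - real J) / (real n - 2)))"
  define c where "c = (real n + real J) / (2 * \<sigma> * (real n)^2) - real J / (6 * \<sigma>^2 * (real n)^2)"
  have P0: "0 \<le> P H" for H using T_pos by (simp add: P_def)
  have "(\<Sum>H\<in>Pow (offdiag J). P H * expo n s J H) \<le> (\<Sum>H\<in>Pow (offdiag J). P H *
      (real J ^ 2 / real n + (1 - 2 * lam n s) / (\<sigma> * real n) * chi n s J H 1 - c * (chi n s J H 2 + chi' n s J H 2)))"
  proof (intro sum_mono mult_left_mono P0)
    fix H assume "H \<in> Pow (offdiag J)"
    from expo_bounds(2)[OF this]
    show "expo n s J H \<le> real J ^ 2 / real n + (1 - 2 * lam n s) / (\<sigma> * real n) * chi n s J H 1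
        - c * (chi n s J H 2 + chi' n s J H 2)"
      unfolding c_def by (simp add: algebra_simps)
  qed
  also have "\<dots> = real J ^ 2 / real n - 2 * c * V"
    by (rule weighted_affine) (use sum_P P_moments in \<open>auto simp: V_def\<close>)
  finally have up: "(\<Sum>H\<in>Pow (offdiag J). P H * expo n s J H) \<le> real J ^ 2 / real n - 2 * c * V" .
  have J1: "1 \<le> real J" "real J \<le> real n" using J_ge J_le by auto
  have n2: "real n - 2 > 0" using n_large by simp
  \<comment> \<open>The second moment without \<open>p * q\<close> and with the denominator n - 2
    lowered in size to 1/n; this bounds \<open>V\<close> from below and makes the product with n + J
    explicit.\<close>
  define W where "W = real J * (real J - 1) * ((real n - real J) / real n)"
  have W0: "0 \<le> W" using J1 n0 by (simp add: W_def)
  have frac: "(real n - real J) / real n \<le> (real n - real J) / (real n - 2)" "(real n - real J) / (real n - 2) \<le> 2"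
  proof -
    show "(real n - real J) / real n \<le> (real n - real J) / (real n - 2)"
      using J1 n2 by (intro divide_left_mono) auto
    have "real n - real J \<le> 2 * (real n - 2)" using J1 n_large by simp
    then show "(real n - real J) / (real n - 2) \<le> 2" using n2 by (simp add: field_simps)
  qed
  have V1: "W * (p * q) \<le> V"
  proof -
    have "real J * ((real J - 1) * (p * q)) * ((real n - real J) / real n)
       \<le> real J * ((real J - 1) * (p * q)) * ((real n - real J) / (real n - 2))"
      using frac J1 pos by (intro mult_left_mono) auto
    then show ?thesis by (simp add: V_def W_def mult_ac)
  qed
  have V2: "V \<le> 2 * (real J)\<^sup>2"
  proof -
    have "p * q \<le> 1 * 1" using pos by (intro mult_mono) auto
    then have "real J * ((real J - 1) * (p * q) * ((real n - real J) / (real n - 2))) \<le> real J * (real J * 1 * 2)"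
      using frac J1 pos n2 by (intro mult_left_mono mult_mono) auto
    then show ?thesis by (simp add: V_def power2_eq_square)
  qed
  have t1: "real J ^ 2 / real n - real J / real n - 2 * (R ^ 4 * \<theta>) \<le> (real n + real J) / (\<sigma> * (real n)^2) * V"
  proof -
    have Wn: "(real n + real J) * W / (real n)\<^sup>2 = (real J)\<^sup>2 / real n - real J / real n - real J ^ 4 / real n ^ 3 + real J ^ 3 / real n ^ 3"
    proof -
      have "(real n + real J) * W / (real n)\<^sup>2 = ((real n)\<^sup>2 - (real J)\<^sup>2) * ((real J)\<^sup>2 - real J) / real n ^ 3"
        using n0 by (simp add: W_def power2_eq_square power3_eq_cube field_simps)
      also have "\<dots> = (real J)\<^sup>2 / real n - real J / real n - real J ^ 4 / real n ^ 3 + real J ^ 3 / real n ^ 3"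
        using n0 by (simp add: power2_eq_square power3_eq_cube power4_eq_xxxx field_simps)
      finally show ?thesis .
    qed
    have Wle: "(real n + real J) * W / (real n)\<^sup>2 \<le> 2 * (real J)\<^sup>2 / real n"
    proof -
      have "W \<le> real J * real J * 1" unfolding W_def using J1 n0 by (intro mult_mono) auto
      then have "(real n + real J) * W \<le> (2 * real n) * (real J)\<^sup>2"
        using J1 W0 by (intro mult_mono) (auto simp: power2_eq_square)
      then have "(real n + real J) * W / (real n)\<^sup>2 \<le> (2 * real n) * (real J)\<^sup>2 / (real n)\<^sup>2"
        by (intro divide_right_mono) auto
      then show ?thesis using n0 by (simp add: power2_eq_square)
    qed
    have W1: "0 \<le> (real n + real J) * W / (real n)\<^sup>2" using W0 by simp
    have "(real n + real J) * W / (real n)\<^sup>2 * (1 - R\<^sup>2 / real n) \<le> (real n + real J) * W / (real n)\<^sup>2 * (p * q / \<sigma>)"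
      using pq_\<sigma> by (intro mult_left_mono W1) auto
    also have "\<dots> = (real n + real J) / (\<sigma> * (real n)^2) * (W * (p * q))" by (simp add: mult_ac)
    also have "\<dots> \<le> (real n + real J) / (\<sigma> * (real n)^2) * V"
      using V1 \<sigma>_pos by (intro mult_left_mono) auto
    finally have 1: "(real n + real J) * W / (real n)\<^sup>2 - (real n + real J) * W / (real n)\<^sup>2 * (R\<^sup>2 / real n)
      \<le> (real n + real J) / (\<sigma> * (real n)^2) * V" by (simp add: right_diff_distrib)
    have "(real n + real J) * W / (real n)\<^sup>2 * (R\<^sup>2 / real n) \<le> 2 * (real J)\<^sup>2 / real n * (R\<^sup>2 / real n)"
      using Wle n0 by (intro mult_right_mono) auto
    also have "\<dots> = 2 * R\<^sup>2 * ((real J)\<^sup>2 / (real n)\<^sup>2)" by (simp add: power2_eq_square)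
    also have "\<dots> \<le> 2 * R\<^sup>2 * \<theta>" using \<theta>_bounds by (intro mult_left_mono) auto
    finally have 2: "(real n + real J) * W / (real n)\<^sup>2 * (R\<^sup>2 / real n) \<le> 2 * R\<^sup>2 * \<theta>" .
    have 3: "\<theta> + 2 * R\<^sup>2 * \<theta> \<le> 2 * (R ^ 4 * \<theta>)"
    proof -
      have "4 * R\<^sup>2 \<le> R\<^sup>2 * R\<^sup>2" using power_mono[of 2 R 2] R_ge by (intro mult_right_mono) auto
      then have "1 + 2 * R\<^sup>2 \<le> 2 * R ^ 4" using R_quartic by (simp flip: power_add)
      then have "(1 + 2 * R\<^sup>2) * \<theta> \<le> 2 * R ^ 4 * \<theta>" by (rule mult_right_mono) simp
      then show ?thesis by (simp only: distrib_right mult_1_left mult.assoc)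
    qed
    have "0 \<le> real J ^ 3 / real n ^ 3" by simp
    moreover have "a - b - y \<le> v" if "w - z \<le> v" "z \<le> z'" "t + z' \<le> y" "w = a - b - c + d" "c \<le> t" "0 \<le> d"
      for a b c d t v w y z z' :: real using that by linarith
    ultimately show ?thesis using 1 2 3 Wn \<theta>_bounds(3) by blast
  qed
  have t3: "real J / (\<sigma>^2 * (real n)^2) * V \<le> 2 * (R ^ 4 * \<theta>)"
  proof -
    have "real J / (\<sigma>^2 * (real n)^2) * V \<le> real J / (\<sigma>^2 * (real n)^2) * (2 * (real J)\<^sup>2)"
      using V2 by (intro mult_left_mono) auto
    also have "\<dots> = 2 * ((1 / \<sigma>^2) * \<theta>)" by (simp add: power2_eq_square power3_eq_cube)
    also have "\<dots> \<le> 2 * (R ^ 4 * \<theta>)" using inv_\<sigma> \<theta>_bounds by (intro mult_left_mono mult_right_mono) auto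
    finally show ?thesis .
  qed
  have "2 * c * V = (real n + real J) / (\<sigma> * (real n)^2) * V - (real J / (\<sigma>^2 * (real n)^2) * V) / 3"
    by (simp add: c_def algebra_simps add_divide_distrib)
  moreover have "0 \<le> R ^ 4 * \<theta>" using R_quartic \<theta>_bounds by simp
  moreover have "e \<le> r + 4 * z" if "y = a - d / 3" "0 \<le> z" "e \<le> x - y" "x - r - 2 * z \<le> a" "d \<le> 2 * z"
    for a d e r x y z :: real using that by linarith
  note this[OF _ _ up t1 t3]
  ultimately show ?thesis by (simp only: mult.assoc)
qed

end

section \<open>Normalisation and the theorem\<close>

context regular_block
begin

lemma step_error_nonneg: "0 \<le> step_error"
  using R_ge by (simp add: step_error_def)

text \<open>The arcs of \<open>H\<close> are inserted one by one, and the step errors add up.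
  Emptiness is carried along in the induction since each step speaks about logarithms only for
  nonempty classes.\<close>

lemma log_count:
  assumes "H \<subseteq> offdiag J"
  shows "(blockclass n s J H = {} \<longleftrightarrow> blockclass n s J {} = {}) \<and> (blockclass n s J {} \<noteq> {} \<longrightarrow>
    \<bar>ln (real (card (blockclass n s J H))) - ln (real (card (blockclass n s J {})))
      - real (card H) * (ln p - ln q) - (expo n s J H - expo n s J {})\<bar> \<le> real (card H) * step_error)"
proof -
  have "finite H" by (rule finite_subset[OF assms finite_offdiag])
  then show ?thesis using assms
  proof (induction H rule: finite_induct)
    case empty
    then show ?case by simp
  next
    case (insert x H)
    obtain i k where x: "x = (i, k)" by (cases x)
    have ik: "i < J" "k < J" "i \<noteq> k" "(i, k) \<notin> H" and Hs: "H \<subseteq> {0..<J} \<times> {0..<J}"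
      using insert.prems insert.hyps by (auto simp: x offdiag_def)
    have "H \<subseteq> offdiag J" using insert.prems by simp
    note IHH = insert.IH[OF this]
    have IH: "blockclass n s J H = {} \<longleftrightarrow> blockclass n s J {} = {}"
      "blockclass n s J {} \<noteq> {} \<Longrightarrow> \<bar>ln (real (card (blockclass n s J H))) - ln (real (card (blockclass n s J {})))
      - real (card H) * (ln p - ln q) - (expo n s J H - expo n s J {})\<bar> \<le> real (card H) * step_error"
      by (rule conjunct1[OF IHH], rule conjunct2[OF IHH, THEN mp])
    note step = arc_step[OF ik Hs]
    have card: "real (card (insert x H)) = real (card H) + 1" using insert.hyps by simp
    have tri: "\<bar>c - a - (m + 1) * l - (e'' - e)\<bar> \<le> (m + 1) * t"
      if "\<bar>c' - a - m * l - (e' - e)\<bar> \<le> m * t" "\<bar>c - c' - l - (e'' - e')\<bar> \<le> t"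
      for a c c' m l e e' e'' t :: real
    proof -
      have "c - a - (m + 1) * l - (e'' - e) = (c' - a - m * l - (e' - e)) + (c - c' - l - (e'' - e'))"
        by (simp add: distrib_right)
      then show ?thesis using abs_add_bound[OF that] by (simp add: distrib_right)
    qed
    show ?case
    proof (intro conjI impI)
      show "blockclass n s J (insert x H) = {} \<longleftrightarrow> blockclass n s J {} = {}"
        using step(1) IH(1) unfolding x by blast
      assume ne: "blockclass n s J {} \<noteq> {}"
      then have neH: "blockclass n s J H \<noteq> {}" using IH(1) by blast
      show "\<bar>ln (real (card (blockclass n s J (insert x H)))) - ln (real (card (blockclass n s J {})))
        - real (card (insert x H)) * (ln p - ln q) - (expo n s J (insert x H) - expo n s J {})\<bar>
        \<le> real (card (insert x H)) * step_error"
        unfolding card by (rule tri[OF IH(2)[OF ne] step(2)[OF neH, folded x]])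
    qed
  qed
qed

text \<open>Some regular digraph exists, so the class of the block it induces is nonempty. Passing
  through the empty block transfers this to every other block.\<close>

lemma blockclass_nonempty:
  assumes "H \<in> Pow (offdiag J)"
  shows "blockclass n s J H \<noteq> {}"
proof -
  obtain G where G: "G \<in> regular_digraphs n s" using regular_digraphs_nonempty[OF s_less] by blast
  then have "induced G J \<subseteq> offdiag J"
    by (auto simp: regular_digraphs_def simple_digraph_def induced_def offdiag_def)
  moreover have "G \<in> blockclass n s J (induced G J)" using G by (simp add: blockclass_def)
  ultimately have "blockclass n s J {} \<noteq> {}" using log_count by blast
  then show ?thesis using log_count assms by blast
qed

text \<open>The accumulated step error counts twice, once in the constant \<open>K\<close> and once
  in the error of the individual block; the rest bounds the mean exponents.\<close>

definition total_error :: real where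
  "total_error = 2 * ((real J)\<^sup>2 * step_error) + real J / real n + 6 * R ^ 4 * \<theta>"

text \<open>The constant relating the two distributions \<open>P\<close> and \<open>\<mu>\<close> is determined up to a small error by
  comparing total masses: since \<open>exp x \<ge> 1 + x\<close>, it is bounded from above by the mean of the exponent
  under \<open>\<mu>\<close> and from below by its mean under \<open>P\<close>.\<close>

lemma P_formula:
  assumes H: "H \<in> Pow (offdiag J)"
  shows "\<exists>d. \<bar>d\<bar> \<le> total_error \<and> P H = \<mu> H * exp (expo n s J H + d)"
proof -
  let ?E = "Pow (offdiag J)"
  define C where "C = (\<lambda>H. real (card (blockclass n s J H)))"
  define b where "b = (real J)\<^sup>2 * step_error"
  \<comment> \<open>\<open>K\<close> is the log of the unknown constant, read off from the empty
    block, and \<open>\<eta>\<close> the remaining error, controlled by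
    \<open>log_count\<close>.\<close>
  define K where "K = ln (C {}) - ln T - expo n s J {} - real (J * (J - 1)) * ln q"
  define \<eta> where "\<eta> = (\<lambda>H. ln (P H) - ln (\<mu> H) - expo n s J H - K)"
  have C0: "C H > 0" if "H \<in> ?E" for H
    using blockclass_nonempty[OF that] by (simp add: C_def card_gt_0_iff)
  have P0: "P H > 0" if "H \<in> ?E" for H using C0[OF that] T_pos by (simp add: P_def C_def)
  have \<mu>0: "\<mu> H > 0" for H using pos by (simp add: \<mu>_def)
  have form: "P H = \<mu> H * exp (K + expo n s J H + \<eta> H)" if "H \<in> ?E" for H
  proof -
    have "K + expo n s J H + \<eta> H = ln (P H) - ln (\<mu> H)" by (simp add: \<eta>_def)
    then show ?thesis using P0[OF that] \<mu>0[of H] by (simp add: exp_diff)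
  qed
  have card_le: "card H \<le> J * (J - 1)" if "H \<in> ?E" for H
    using that card_mono[of "offdiag J" H] by (simp add: card_offdiag)
  have \<eta>: "\<bar>\<eta> H\<bar> \<le> b" if H: "H \<in> ?E" for H
  proof -
    have "ln (P H) = ln (C H) - ln T" using C0[OF H] T_pos unfolding P_def C_def by (rule ln_divide_pos)
    moreover have "ln (\<mu> H) = real (card H) * ln p + (real (J * (J - 1)) - real (card H)) * ln q"
      using pos card_le[OF H] by (simp add: \<mu>_def ln_mult_pos ln_realpow of_nat_diff del: of_nat_mult)
    ultimately have "\<eta> H = ln (C H) - ln (C {}) - real (card H) * (ln p - ln q) - (expo n s J H - expo n s J {})"
      by (simp add: \<eta>_def K_def algebra_simps)
    also have "\<bar>\<dots>\<bar> \<le> real (card H) * step_error"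
      using log_count[of H] H blockclass_nonempty[of "{}"] by (simp add: C_def)
    also have "\<dots> \<le> b"
    proof -
      have "J * (J - 1) \<le> J * J" by simp
      then have "real (card H) \<le> real (J * J)" using card_le[OF H] by linarith
      then show ?thesis unfolding b_def using step_error_nonneg
        by (intro mult_right_mono) (auto simp: power2_eq_square)
    qed
    finally show ?thesis .
  qed
  have up: "K \<le> b + 6 * R ^ 4 * \<theta>"
  proof -
    have "(\<Sum>H\<in>?E. \<mu> H * (1 + (K - b) + expo n s J H)) \<le> (\<Sum>H\<in>?E. P H)"
    proof (rule sum_mono)
      fix H assume H: "H \<in> ?E"
      have "1 + (K - b) + expo n s J H \<le> 1 + (K + expo n s J H + \<eta> H)" using \<eta>[OF H] by simp
      also have "\<dots> \<le> exp (K + expo n s J H + \<eta> H)" by (rule exp_ge_add_one_self)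
      finally show "\<mu> H * (1 + (K - b) + expo n s J H) \<le> P H"
        unfolding form[OF H] using \<mu>0[of H] by (intro mult_left_mono) auto
    qed
    moreover have "(\<Sum>H\<in>?E. \<mu> H * (1 + (K - b) + expo n s J H)) =
      (1 + (K - b)) * (\<Sum>H\<in>?E. \<mu> H) + (\<Sum>H\<in>?E. \<mu> H * expo n s J H)"
      by (simp add: distrib_left sum.distrib sum_distrib_left mult.commute)
    ultimately show ?thesis using mean_expo_\<mu> unfolding sum_\<mu> sum_P mult_1_right by linarith
  qed
  have low: "- (b + real J / real n + 4 * R ^ 4 * \<theta>) \<le> K"
  proof -
    \<comment> \<open>For the opposite bound the relation is solved for \<open>\<mu>\<close>, so
      that the exponential inequality is applied to the negated exponent and averaged under
      \<open>P\<close>.\<close>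
    have "(\<Sum>H\<in>?E. P H * ((1 - K - b) - expo n s J H)) \<le> (\<Sum>H\<in>?E. \<mu> H)"
    proof (rule sum_mono)
      fix H assume H: "H \<in> ?E"
      have "(1 - K - b) - expo n s J H \<le> 1 + - (K + expo n s J H + \<eta> H)" using \<eta>[OF H] by simp
      also have "\<dots> \<le> exp (- (K + expo n s J H + \<eta> H))" by (rule exp_ge_add_one_self)
      finally have "P H * ((1 - K - b) - expo n s J H) \<le> P H * exp (- (K + expo n s J H + \<eta> H))"
        using P0[OF H] by (intro mult_left_mono) auto
      also have "\<dots> = \<mu> H" by (subst form[OF H]) (simp only: mult.assoc exp_add[symmetric], simp)
      finally show "P H * ((1 - K - b) - expo n s J H) \<le> \<mu> H" .
    qed
    moreover have "(\<Sum>H\<in>?E. P H * ((1 - K - b) - expo n s J H)) =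
      (1 - K - b) * (\<Sum>H\<in>?E. P H) - (\<Sum>H\<in>?E. P H * expo n s J H)"
      by (simp add: right_diff_distrib sum_subtractf sum_distrib_left mult.commute)
    ultimately show ?thesis using mean_expo_P unfolding sum_\<mu> sum_P mult_1_right by linarith
  qed
  have "\<bar>K + \<eta> H\<bar> \<le> total_error"
  proof -
    have r: "4 * R ^ 4 * \<theta> \<le> 6 * R ^ 4 * \<theta>" using R_quartic by (intro mult_right_mono) auto
    have j: "0 \<le> real J / real n" by simp
    have b: "0 \<le> b" unfolding b_def using step_error_nonneg by simp
    have "\<bar>K\<bar> \<le> b + real J / real n + 6 * R ^ 4 * \<theta>" using up low r j by linarith
    then show ?thesis using \<eta>[OF H] by (simp add: total_error_def b_def)
  qed
  moreover have "P H = \<mu> H * exp (expo n s J H + (K + \<eta> H))"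
    using form[OF H] by (simp add: add_ac)
  ultimately show ?thesis by blast
qed

lemma prob_induced_eq_P:
  assumes "H \<subseteq> {0..<J} \<times> {0..<J}"
  shows "prob_induced n s J H = P H"
proof -
  have ne: "regular_digraphs n s \<noteq> {}" by (rule regular_digraphs_nonempty[OF s_less])
  have "induced H J = H" using assms by (auto simp: induced_def)
  then have "regular_digraphs n s \<inter> {G. induced G J = induced H J} = blockclass n s J H"
    by (auto simp: blockclass_def)
  then show ?thesis
    unfolding prob_induced_def using ne finite_regular by (simp add: measure_pmf_of_set P_def T_def)
qed

text \<open>With J of order n^(1/2 + \<epsilon>) the largest power is J^5/n^3, of order
  n^(5\<epsilon> - 1/2). The sixth \<epsilon> absorbs the powers of \<open>R\<close>.\<close>

lemma total_error_bound:
  assumes J: "real J \<le> C * real n powr (1/2 + \<epsilon>)" and C: "C > 0" and \<epsilon>: "\<epsilon> > 0"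
    and R: "2 * 10 ^ 10 * R ^ 7 \<le> real n powr \<epsilon>"
  shows "total_error \<le> (2 * C ^ 3 + C ^ 5 + C) * real n powr (6 * \<epsilon> - 1/2)"
proof -
  define x where "x = real n"
  have x1: "x \<ge> 1" using n_large by (simp add: x_def)
  have x0: "x > 0" using x1 by simp
  have mono: "x powr a \<le> x powr b" if "a \<le> b" for a b using that x1 by (rule powr_mono)
  have Jk: "real J ^ k \<le> C ^ k * x powr ((1/2 + \<epsilon>) * real k)" for k
  proof -
    have "real J ^ k \<le> (C * x powr (1/2 + \<epsilon>)) ^ k" using J by (intro power_mono) (auto simp: x_def)
    then show ?thesis using x0 by (simp add: power_mult_distrib powr_power mult.commute)
  qed
  have xk: "x ^ k = x powr real k" for k using x0 by (simp add: powr_realpow)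
  have frac: "real J ^ k / x ^ l \<le> C ^ k * x powr ((1/2 + \<epsilon>) * real k - real l)" for k l
    using divide_right_mono[OF Jk[of k], of "x ^ l"] x0 by (simp add: xk powr_diff)
  have 3: "real J ^ 3 / x ^ 2 \<le> C ^ 3 * x powr (5 * \<epsilon> - 1/2)"
  proof -
    have "C ^ 3 * x powr ((1/2 + \<epsilon>) * real 3 - real 2) \<le> C ^ 3 * x powr (5 * \<epsilon> - 1/2)"
      using C \<epsilon> by (intro mult_left_mono mono) (auto simp: algebra_simps)
    then show ?thesis using frac[of 3 2] by linarith
  qed
  have 5: "real J ^ 5 / x ^ 3 \<le> C ^ 5 * x powr (5 * \<epsilon> - 1/2)"
  proof -
    have "C ^ 5 * x powr ((1/2 + \<epsilon>) * real 5 - real 3) \<le> C ^ 5 * x powr (5 * \<epsilon> - 1/2)"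
      using C \<epsilon> by (intro mult_left_mono mono) (auto simp: algebra_simps)
    then show ?thesis using frac[of 5 3] by linarith
  qed
  have 1: "real J / x \<le> C * x powr (6 * \<epsilon> - 1/2)"
  proof -
    have "C * x powr ((1/2 + \<epsilon>) * real 1 - real 1) \<le> C * x powr (6 * \<epsilon> - 1/2)"
      using C \<epsilon> by (intro mult_left_mono mono) (auto simp: algebra_simps)
    then show ?thesis using frac[of 1 1] by simp
  qed
  define y where "y = x powr (5 * \<epsilon> - 1/2)"
  have y0: "0 \<le> y" by (simp add: y_def)
  have xy: "x powr \<epsilon> * y = x powr (6 * \<epsilon> - 1/2)" by (simp add: y_def flip: powr_add)
  have R46: "6 * R ^ 4 \<le> x powr \<epsilon>"
  proof -
    have "R ^ 4 \<le> R ^ 7" using R_ge by (intro power_increasing) auto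
    then have "6 * R ^ 4 \<le> 6 * R ^ 7" by simp
    also have "\<dots> \<le> 2 * 10 ^ 10 * R ^ 7" using R_ge by (intro mult_right_mono) auto
    finally show ?thesis using R unfolding x_def by linarith
  qed
  have e1: "2 * ((real J)\<^sup>2 * step_error) = 2 * 10 ^ 10 * R ^ 7 * (real J ^ 3 / x ^ 2 + real J ^ 5 / x ^ 3)"
  proof -
    have "(real J)\<^sup>2 * (real J / x * (1 / x)) = real J ^ 3 / x ^ 2"
      by (simp add: power2_eq_square power3_eq_cube)
    moreover have "(real J)\<^sup>2 * (real J / x) ^ 3 = real J ^ 5 / x ^ 3"
      by (simp add: power_divide flip: power_add)
    moreover have "2 * ((real J)\<^sup>2 * step_error) = 2 * 10 ^ 10 * R ^ 7 *
        ((real J)\<^sup>2 * (real J / x * (1 / x)) + (real J)\<^sup>2 * (real J / x) ^ 3)"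
      unfolding step_error_def x_def[symmetric] distrib_left[symmetric] by (simp only: mult_ac)
    ultimately show ?thesis by (simp only:)
  qed
  have "2 * ((real J)\<^sup>2 * step_error) \<le> x powr \<epsilon> * (C ^ 3 * y + C ^ 5 * y)"
    unfolding e1 using 3 5 R x0 by (intro mult_mono add_mono) (auto simp: y_def x_def)
  also have "\<dots> = (C ^ 3 + C ^ 5) * x powr (6 * \<epsilon> - 1/2)" unfolding xy[symmetric] by (simp add: algebra_simps)
  finally have a: "2 * ((real J)\<^sup>2 * step_error) \<le> (C ^ 3 + C ^ 5) * x powr (6 * \<epsilon> - 1/2)" .
  have "6 * R ^ 4 * (real J ^ 3 / x ^ 2) \<le> x powr \<epsilon> * (C ^ 3 * y)"
    using R46 3 by (intro mult_mono) (auto simp: y_def)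
  also have "\<dots> = C ^ 3 * x powr (6 * \<epsilon> - 1/2)" unfolding xy[symmetric] by simp
  finally have b: "6 * R ^ 4 * (real J ^ 3 / x ^ 2) \<le> C ^ 3 * x powr (6 * \<epsilon> - 1/2)" .
  have "total_error \<le> (C ^ 3 + C ^ 5) * x powr (6 * \<epsilon> - 1/2) + C * x powr (6 * \<epsilon> - 1/2) + C ^ 3 * x powr (6 * \<epsilon> - 1/2)"
    unfolding total_error_def using a b 1 by (intro add_mono) (auto simp: x_def)
  then show ?thesis by (simp add: x_def algebra_simps)
qed

end

text \<open>With sg = \<lambda>(1 - \<lambda>) the left side of the density condition is 2/(3 sg) -
  8/3, so the condition says exactly that sg is at least 2/R. The surplus over 1/R pays for the
  passage from \<open>lam\<close> to \<open>pp\<close>, which differ by at most 1/n.\<close>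

lemma regular_block_from_density:
  fixes n s J :: nat and R :: real
  assumes R: "R \<ge> 2" "R \<le> real n" and J: "J \<ge> 1" and s: "0 < s" "s < n"
    and A: "(1 - 2 * lam n s)\<^sup>2 / (3 * AA n s) \<le> (R - 8) / 3"
    and small: "10 ^ 10 * R ^ 7 * real J \<le> real n"
  shows "regular_block n s J R"
proof
  define l where "l = lam n s"
  have n0: "real n > 0" "n \<ge> 2" using s by auto
  have l: "0 < l" "l < 1" using s by (auto simp: l_def lam_def)
  define sg where "sg = l * (1 - l)"
  have sg: "sg > 0" using l by (simp add: sg_def)
  have e1: "(1 - 2 * l)\<^sup>2 = 1 - 4 * sg" by (simp add: sg_def power2_eq_square algebra_simps)
  have e2: "AA n s = sg / 2" by (simp add: AA_def sg_def l_def)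
  have "(1 - 4 * sg) / (3 * (sg / 2)) \<le> (R - 8) / 3"
    using A unfolding l_def[symmetric] e1 e2 .
  then have "2 \<le> R * sg" using sg by (simp add: field_simps)
  then have sgR: "2 / R \<le> sg" using R by (simp add: field_simps)
  have "sg \<le> l" "sg \<le> 1 - l" using l by (simp_all add: sg_def mult_left_le mult_left_le_one_le)
  then have lb: "2 / R \<le> l" "2 / R \<le> 1 - l" using sgR by linarith+
  have R2: "1 / R \<le> 2 / R" using R by (simp add: divide_right_mono)
  show "1 / R \<le> lam n s" "1 / R \<le> 1 - lam n s" using lb R2 unfolding l_def by linarith+
  have p1: "pp n s \<le> 1" "0 \<le> pp n s"
  proof -
    have "real s \<le> real n - 1" using s by linarith
    then show "pp n s \<le> 1" "0 \<le> pp n s" using n0 by (auto simp: pp_def)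
  qed
  have pl: "pp n s = l + pp n s / real n"
    using n0 by (simp add: pp_def lam_def l_def field_simps)
  have "0 \<le> pp n s / real n" "pp n s / real n \<le> 1 / R"
  proof -
    show "0 \<le> pp n s / real n" using p1 by simp
    have "pp n s / real n \<le> 1 / real n" using p1 by (intro divide_right_mono) auto
    also have "\<dots> \<le> 1 / R" using R by (intro divide_left_mono) auto
    finally show "pp n s / real n \<le> 1 / R" .
  qed
  then show "1 / R \<le> pp n s" "1 / R \<le> 1 - pp n s" using pl lb R2 by linarith+
qed (use assms in auto)

theorem theorem3p3:
  fixes a b :: real
  assumes "a > 0" "b > 0" "a + b < 1/2"
  shows "\<exists>\<epsilon>0>0. \<forall>\<epsilon>. 0 < \<epsilon> \<and> \<epsilon> < \<epsilon>0 \<longrightarrow>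
    (\<forall>C>0. \<exists>C' N. \<forall>n s J H.
       n \<ge> N \<and> 0 < s \<and> s < n \<and> J \<le> n \<and>
       simple_digraph n H \<and> H \<subseteq> {0..<J} \<times> {0..<J} \<and>
       (\<forall>j<n. real (outdeg H j) \<le> C * real n powr (1/2 + \<epsilon>)
              \<and> real (indeg H j) \<le> C * real n powr (1/2 + \<epsilon>)) \<and>
       real (card H) \<le> C * real n powr (1 + 2*\<epsilon>) \<and>
       real J \<le> C * real n powr (1/2 + \<epsilon>) \<and>
       (1 - 2 * lam n s)^2 / (3 * AA n s) \<le> a * ln (real n)
       \<longrightarrow>
       (\<exists>\<delta>. \<bar>\<delta>\<bar> \<le> C' * real n powr (-b) \<and>
          prob_induced n s J H =
            pp n s ^ card H * (1 - pp n s) ^ (J * (J - 1) - card H) *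
            exp (real J ^ 2 / real n
                 + (1 - 2 * lam n s) * chi n s J H 1 / (2 * AA n s * real n)
                 - (chi n s J H 1)^2 / (4 * AA n s * (real n)^2)
                 - (real n + real J) * (chi n s J H 2 + chi' n s J H 2) / (4 * AA n s * (real n)^2)
                 - (1 - 2 * lam n s) * (chi n s J H 3 + chi' n s J H 3) / (24 * (AA n s)^2 * (real n)^2)
                 + \<delta>)))"
proof -
  \<comment> \<open>Chosen so that \<epsilon> < \<epsilon>0 gives 6\<epsilon> - 1/2 < -b, the
    exponent required of \<open>total_error_bound\<close>.\<close>
  define \<epsilon>0 where "\<epsilon>0 = (1/2 - b) / 6"
  have \<epsilon>0: "\<epsilon>0 > 0" using assms by (simp add: \<epsilon>0_def)
  have main: "\<exists>C' N. \<forall>n s J H.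
       n \<ge> N \<and> 0 < s \<and> s < n \<and> J \<le> n \<and>
       simple_digraph n H \<and> H \<subseteq> {0..<J} \<times> {0..<J} \<and>
       real J \<le> C * real n powr (1/2 + \<epsilon>) \<and>
       (1 - 2 * lam n s)^2 / (3 * AA n s) \<le> a * ln (real n) \<longrightarrow>
       (\<exists>\<delta>. \<bar>\<delta>\<bar> \<le> C' * real n powr (-b) \<and>
          prob_induced n s J H =
            pp n s ^ card H * (1 - pp n s) ^ (J * (J - 1) - card H) * exp (expo n s J H + \<delta>))"
    if \<epsilon>: "0 < \<epsilon>" "\<epsilon> < \<epsilon>0" and C: "C > 0" for \<epsilon> C
  proof -
    \<comment> \<open>Solves (R - 8)/3 = a ln x, as \<open>regular_block_from_density\<close>
      demands.\<close>
    define R where "R = (\<lambda>x::real. 3 * a * ln x + 8)"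
    have eps: "\<epsilon> < 1/12" using \<epsilon> assms by (simp add: \<epsilon>0_def)
    have "eventually (\<lambda>x. 2 * 10 ^ 10 * (R x) ^ 7 \<le> x powr \<epsilon>) at_top"
      unfolding R_def using assms(1) \<epsilon>(1) by real_asymp
    \<comment> \<open>With the preceding bound on the seventh power of \<open>R\<close> this yields
      the condition \<open>small\<close>; the exponent 1/2 + 2\<epsilon> is below 1 since \<epsilon>
      < 1/12.\<close>
    moreover have "eventually (\<lambda>x::real. x powr \<epsilon> * (C * x powr (1/2 + \<epsilon>)) \<le> x) at_top"
      using C \<epsilon>(1) eps by real_asymp
    moreover have "eventually (\<lambda>x. R x \<le> x) at_top"
      unfolding R_def using assms(1) by real_asymp
    moreover have "eventually (\<lambda>x::real. 1 \<le> x) at_top" by (rule eventually_ge_at_top)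
    ultimately have "eventually (\<lambda>x. 2 * 10 ^ 10 * (R x) ^ 7 \<le> x powr \<epsilon> \<and>
        x powr \<epsilon> * (C * x powr (1/2 + \<epsilon>)) \<le> x \<and> R x \<le> x \<and> 1 \<le> x) at_top"
      by eventually_elim auto
    then have "eventually (\<lambda>n. 2 * 10 ^ 10 * (R (real n)) ^ 7 \<le> real n powr \<epsilon> \<and>
        real n powr \<epsilon> * (C * real n powr (1/2 + \<epsilon>)) \<le> real n \<and> R (real n) \<le> real n \<and> 1 \<le> real n) sequentially"
      by (rule eventually_compose_filterlim[OF _ filterlim_real_sequentially])
    then obtain N where N: "\<And>n. n \<ge> N \<Longrightarrow> 2 * 10 ^ 10 * (R (real n)) ^ 7 \<le> real n powr \<epsilon> \<and>
        real n powr \<epsilon> * (C * real n powr (1/2 + \<epsilon>)) \<le> real n \<and> R (real n) \<le> real n \<and> 1 \<le> real n"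
      unfolding eventually_sequentially by blast
    define C' where "C' = 2 * C ^ 3 + C ^ 5 + C"
    have C': "C' \<ge> 0" using C by (simp add: C'_def)
    have "\<exists>\<delta>. \<bar>\<delta>\<bar> \<le> C' * real n powr (-b) \<and> prob_induced n s J H =
            pp n s ^ card H * (1 - pp n s) ^ (J * (J - 1) - card H) * exp (expo n s J H + \<delta>)"
      if n: "n \<ge> N" and s: "0 < s" "s < n" and H: "simple_digraph n H" "H \<subseteq> {0..<J} \<times> {0..<J}"
        and J: "real J \<le> C * real n powr (1/2 + \<epsilon>)"
        and A: "(1 - 2 * lam n s)^2 / (3 * AA n s) \<le> a * ln (real n)" for n s J H
    \<comment> \<open>The locale assumes a nonempty block. For \<open>J = 0\<close> the event is
      certain and the exponent is 0, so the formula holds without error.\<close>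
    proof (cases "J = 0")
      case True
      then have "H = {}" using H by simp
      moreover have "prob_induced n s 0 {} = 1"
        by (simp add: prob_induced_def induced_def)
      ultimately show ?thesis using True C'
        by (intro exI[of _ 0]) (simp add: expo_def chi_def chi'_def)
    next
      case False
      define r where "r = R (real n)"
      note Nn = N[OF n, folded r_def]
      have r8: "r \<ge> 8" using Nn assms(1) by (simp add: r_def R_def)
      have small: "10 ^ 10 * r ^ 7 * real J \<le> real n"
      proof -
        have "10 ^ 10 * r ^ 7 * real J \<le> real n powr \<epsilon> * (C * real n powr (1/2 + \<epsilon>))"
        proof (rule mult_mono[OF _ J])
          have "0 \<le> r ^ 7" using r8 by simp
          then show "10 ^ 10 * r ^ 7 \<le> real n powr \<epsilon>"
            by (intro order_trans[OF _ conjunct1[OF Nn]] mult_right_mono) auto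
        qed auto
        then show ?thesis using Nn by linarith
      qed
      interpret regular_block n s J r
      proof (rule regular_block_from_density)
        show "(1 - 2 * lam n s)\<^sup>2 / (3 * AA n s) \<le> (r - 8) / 3" using A by (simp add: r_def R_def)
      qed (use r8 Nn False s small in auto)
      have "H \<in> Pow (offdiag J)" using H by (auto simp: simple_digraph_def offdiag_def)
      then obtain d where d: "\<bar>d\<bar> \<le> total_error" "P H = \<mu> H * exp (expo n s J H + d)"
        using P_formula by blast
      have "total_error \<le> C' * real n powr (6 * \<epsilon> - 1/2)"
        unfolding C'_def by (rule total_error_bound[OF J C \<epsilon>(1)]) (use Nn in auto)
      also have "\<dots> \<le> C' * real n powr (- b)"
        using C' Nn \<epsilon> by (intro mult_left_mono powr_mono) (auto simp: \<epsilon>0_def)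
      finally have "\<bar>d\<bar> \<le> C' * real n powr (- b)" using d(1) by linarith
      then show ?thesis using d(2) prob_induced_eq_P[OF H(2)] by (auto simp: \<mu>_def)
    qed
    then show ?thesis by blast
  qed
  show ?thesis
  proof (rule exI[of _ \<epsilon>0], intro conjI allI impI \<epsilon>0)
    fix \<epsilon> C :: real assume e: "0 < \<epsilon> \<and> \<epsilon> < \<epsilon>0" and C: "0 < C"
    from main[of \<epsilon> C] e C obtain C' N where CN: "\<forall>n s J H.
       n \<ge> N \<and> 0 < s \<and> s < n \<and> J \<le> n \<and>
       simple_digraph n H \<and> H \<subseteq> {0..<J} \<times> {0..<J} \<and>
       real J \<le> C * real n powr (1/2 + \<epsilon>) \<and>
       (1 - 2 * lam n s)^2 / (3 * AA n s) \<le> a * ln (real n) \<longrightarrow>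
       (\<exists>\<delta>. \<bar>\<delta>\<bar> \<le> C' * real n powr (-b) \<and>
          prob_induced n s J H =
            pp n s ^ card H * (1 - pp n s) ^ (J * (J - 1) - card H) * exp (expo n s J H + \<delta>))"
      by auto
    show "\<exists>C' N. \<forall>n s J H.
       n \<ge> N \<and> 0 < s \<and> s < n \<and> J \<le> n \<and>
       simple_digraph n H \<and> H \<subseteq> {0..<J} \<times> {0..<J} \<and>
       (\<forall>j<n. real (outdeg H j) \<le> C * real n powr (1/2 + \<epsilon>)
              \<and> real (indeg H j) \<le> C * real n powr (1/2 + \<epsilon>)) \<and>
       real (card H) \<le> C * real n powr (1 + 2*\<epsilon>) \<and>
       real J \<le> C * real n powr (1/2 + \<epsilon>) \<and>
       (1 - 2 * lam n s)^2 / (3 * AA n s) \<le> a * ln (real n)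
       \<longrightarrow>
       (\<exists>\<delta>. \<bar>\<delta>\<bar> \<le> C' * real n powr (-b) \<and>
          prob_induced n s J H =
            pp n s ^ card H * (1 - pp n s) ^ (J * (J - 1) - card H) *
            exp (real J ^ 2 / real n
                 + (1 - 2 * lam n s) * chi n s J H 1 / (2 * AA n s * real n)
                 - (chi n s J H 1)^2 / (4 * AA n s * (real n)^2)
                 - (real n + real J) * (chi n s J H 2 + chi' n s J H 2) / (4 * AA n s * (real n)^2)
                 - (1 - 2 * lam n s) * (chi n s J H 3 + chi' n s J H 3) / (24 * (AA n s)^2 * (real n)^2)
                 + \<delta>))"
      unfolding expo_def[symmetric]
    proof (rule exI[of _ C'], rule exI[of _ N], intro allI impI, elim conjE)
      fix n s J H
      assume "N \<le> n" "0 < s" "s < n" "J \<le> n" "simple_digraph n H" "H \<subseteq> {0..<J} \<times> {0..<J}"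
        "real J \<le> C * real n powr (1/2 + \<epsilon>)" "(1 - 2 * lam n s)^2 / (3 * AA n s) \<le> a * ln (real n)"
      then show "\<exists>\<delta>. \<bar>\<delta>\<bar> \<le> C' * real n powr (-b) \<and>
          prob_induced n s J H =
            pp n s ^ card H * (1 - pp n s) ^ (J * (J - 1) - card H) * exp (expo n s J H + \<delta>)"
        by (intro CN[rule_format] conjI)
    qed
  qed
qed

end
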